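(* Let $\mu$ be a computable probability measure on the Cantor space $\Omega=\{0,1\}^{\mathbb{N}}$. Let $T:\Omega\to\Omega$ be a (partial) computable, $\mu$-almost everywhere defined, $\mu$-preserving, ergodic transformation. Let $f:\Omega\to[0,+\infty]$ be lower semicomputable. Then for every $\omega\in\Omega$ that is Martin-Löf random with respect to $\mu$, $$\lim_{n\to\infty}\frac1n\sum_{k=0}^{n-1}f(T^k(\omega))=\int f\,\mathrm{d}\mu .$$ (The integral is allowed to be infinite, in which case the left-hand side has limit $+\infty$.)
   Context: For a finite binary string $x$, $x\Omega$ denotes the set of infinite binary sequences with prefix $x$. A set $U\subseteq\Omega$ is effectively open if there is a computably enumerable set $S$ of finite strings such that $U=\bigcup_{x\in S}x\Omega$. A function $f:\Omega\to[0,+\infty]$ is lower semicomputable if it is the pointwise limit of a non-decreasing (uniformly computable) sequence of computable functions; equivalently, the sets $\{\omega: f(\omega)>q\}$ are effectively open uniformly in rational $q$. A probability measure $\mu$ on $\Omega$ is computable if $\mu(x\Omega)$ is a computable real uniformly in $x$. A set $N\subseteq\Omega$ is an effectively null set (w.r.t. $\mu$) if there is an algorithm that, given a rational $\varepsilon>0$, enumerates an effectively open set of $\mu$-measure at most $\varepsilon$ containing $N$. A sequence is Martin-Löf random w.r.t. $\mu$ if it belongs to no effectively null set. Computable transformation: a Turing machine with a read-only input tape (containing an infinite binary sequence) and a write-only one-way output tape determines a map from $\Omega$ to finite and infinite binary sequences; restricting it to the inputs for which the output is infinite gives a partial computable map $T$ from $\Omega$ to $\Omega$. It is almost everywhere defined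 if its domain has $\mu$-measure $1$. It is $\mu$-preserving if $\mu(T^{-1}(B))=\mu(B)$ for every measurable $B$, and ergodic if every measurable $B$ that is invariant ($T^{-1}(B)=B$ up to a $\mu$-null set) has $\mu(B)\in\{0,1\}$. For $\mu$-Martin-Löf random $\omega$ all iterates $T^k(\omega)$ are defined. *)

theory Defs
  imports "HOL-Probability.Probability" "HOL-Library.Nat_Bijection"
begin

section \<open>Total recursive functions and enumerable sets of natural numbers\<close>

text \<open>
  \<open>total_recursive n f\<close> says that \<open>f\<close>, restricted to argument lists of length \<open>n\<close>, is a total
  recursive function of arity \<open>n\<close>; the values of \<open>f\<close> on lists of other lengths carry no meaning.
  Minimisation is admitted only where it always succeeds, which is known to yield exactly
  the total functions among the partial recursive ones.
\<close>

inductive total_recursive :: "nat \<Rightarrow> (nat list \<Rightarrow> nat) \<Rightarrow> bool" where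
  zero: "total_recursive n (\<lambda>_. 0)"
| succ: "total_recursive 1 (\<lambda>xs. Suc (hd xs))"
| proj: "i < n \<Longrightarrow> total_recursive n (\<lambda>xs. xs ! i)"
| comp: "total_recursive (length gs) f \<Longrightarrow> (\<forall>g\<in>set gs. total_recursive n g) \<Longrightarrow>
    total_recursive n (\<lambda>xs. f (map (\<lambda>g. g xs) gs))"
| prim_rec: "total_recursive n f \<Longrightarrow> total_recursive (Suc (Suc n)) g \<Longrightarrow>
    total_recursive (Suc n)
      (\<lambda>xs. rec_nat (f (tl xs)) (\<lambda>k r. g (k # r # tl xs)) (hd xs))"
| minimise: "total_recursive (Suc n) f \<Longrightarrow> (\<forall>xs. length xs = n \<longrightarrow> (\<exists>y. f (y # xs) = 0)) \<Longrightarrow>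
    total_recursive n (\<lambda>xs. LEAST y. f (y # xs) = 0)"

definition computable1 :: "(nat \<Rightarrow> nat) \<Rightarrow> bool" where
  "computable1 f \<longleftrightarrow> (\<exists>F. total_recursive 1 F \<and> (\<forall>x. f x = F [x]))"

definition computable2 :: "(nat \<Rightarrow> nat \<Rightarrow> nat) \<Rightarrow> bool" where
  "computable2 f \<longleftrightarrow> (\<exists>F. total_recursive 2 F \<and> (\<forall>x y. f x y = F [x, y]))"

definition comp_enumerable :: "nat set \<Rightarrow> bool" where
  "comp_enumerable A \<longleftrightarrow> A = {} \<or> (\<exists>f. computable1 f \<and> A = range f)"

section \<open>Codes for strings and rationals\<close>

definition str_code :: "bool list \<Rightarrow> nat" where
  "str_code x = list_encode (map of_bool x)"

text \<open>Every rational number has (several) codes.\<close>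

definition rat_of_code :: "nat \<Rightarrow> rat" where
  "rat_of_code c = (case prod_decode c of (a, b) \<Rightarrow> of_int (int_decode a) / of_nat (Suc b))"

lemma surj_rat_of_code: "surj rat_of_code"
proof (rule surjI)
  fix q :: rat
  obtain a b where ab: "quotient_of q = (a, b)" by fastforce
  have "b > 0" and q: "q = of_int a / of_int b"
    using quotient_of_denom_pos[OF ab] quotient_of_div[OF ab] by auto
  then have "of_nat (Suc (nat b - 1)) = (of_int b :: rat)" by simp
  then show "rat_of_code (case quotient_of q of (a, b) \<Rightarrow>
      prod_encode (int_encode a, nat b - 1)) = q"
    unfolding rat_of_code_def ab by (simp add: q del: of_nat_Suc)
qed

section \<open>Effective notions on the Cantor space\<close>

text \<open>The topology and the Borel \<open>\<sigma>\<close>-algebra on this type are those of the product space.\<close>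

type_synonym cantor = "nat \<Rightarrow> bool"

definition cyl :: "bool list \<Rightarrow> cantor set" where
  "cyl x = {\<omega>. \<forall>i<length x. \<omega> i = x ! i}"

definition uniformly_effectively_open :: "(rat \<Rightarrow> cantor set) \<Rightarrow> bool" where
  "uniformly_effectively_open U \<longleftrightarrow>
    (\<exists>S :: rat \<Rightarrow> bool list set.
       comp_enumerable {prod_encode (c, str_code x) |c x. x \<in> S (rat_of_code c)} \<and>
       (\<forall>q. U q = (\<Union>x\<in>S q. cyl x)))"

definition lower_semicomputable :: "(cantor \<Rightarrow> ennreal) \<Rightarrow> bool" where
  "lower_semicomputable f \<longleftrightarrow>
    uniformly_effectively_open (\<lambda>q. {\<omega>. enn2ereal (f \<omega>) > ereal (of_rat q)})"

definition computable_measure :: "cantor measure \<Rightarrow> bool" where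
  "computable_measure \<mu> \<longleftrightarrow>
    (\<exists>g. computable2 g \<and>
       (\<forall>x n. \<bar>measure \<mu> (cyl x) - of_rat (rat_of_code (g (str_code x) n))\<bar> \<le> 1 / 2 ^ n))"

definition effectively_null :: "cantor measure \<Rightarrow> cantor set \<Rightarrow> bool" where
  "effectively_null \<mu> N \<longleftrightarrow>
    (\<exists>U. uniformly_effectively_open U \<and>
       (\<forall>\<epsilon>>0. N \<subseteq> U \<epsilon> \<and> emeasure \<mu> (U \<epsilon>) \<le> ennreal (of_rat \<epsilon>)))"

definition martin_lof_random :: "cantor measure \<Rightarrow> cantor \<Rightarrow> bool" where
  "martin_lof_random \<mu> \<omega> \<longleftrightarrow> (\<nexists>N. effectively_null \<mu> N \<and> \<omega> \<in> N)"

section \<open>Computable transformations\<close>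

text \<open>
  Turing machines with a read-only one-way infinite input tape, one two-way infinite work tape
  and a write-only one-way output tape. States and work symbols are natural numbers; a program
  is a finite table, so only finitely many of them occur in it. State 0 is initial and symbol 0
  is the blank. A table entry \<open>((q, b, s), (q', s', d, d', out))\<close> reads: in state \<open>q\<close>, with input
  bit \<open>b\<close> and work symbol \<open>s\<close> scanned, enter state \<open>q'\<close>, write \<open>s'\<close> on the work tape, move the
  input head by \<open>d\<close> and the work head by \<open>d'\<close>, and append the bit in \<open>out\<close> (if any) to the output.
  If several entries have the same left-hand side the first one applies; if none applies the
  machine stops. A left move of the input head on the leftmost cell leaves it there.
\<close>

datatype dir = GoLeft | Stay | GoRight

type_synonym program =
  "((nat \<times> bool \<times> nat) \<times> (nat \<times> nat \<times> dir \<times> dir \<times> bool option)) list"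

text \<open>
  The work tape is stored as the scanned symbol, the symbols to its left and the symbols to its
  right (both starting next to the head); beyond the ends of these lists the tape is blank.
\<close>

type_synonym tape = "nat list \<times> nat \<times> nat list"

fun move_tape :: "dir \<Rightarrow> tape \<Rightarrow> tape" where
  "move_tape Stay t = t"
| "move_tape GoLeft ([], s, rs) = ([], 0, s # rs)"
| "move_tape GoLeft (l # ls, s, rs) = (ls, l, s # rs)"
| "move_tape GoRight (ls, s, []) = (s # ls, 0, [])"
| "move_tape GoRight (ls, s, r # rs) = (s # ls, r, rs)"

fun move_input :: "dir \<Rightarrow> nat \<Rightarrow> nat" where
  "move_input Stay h = h"
| "move_input GoLeft h = h - 1"
| "move_input GoRight h = h + 1"

record config =
  state :: nat
  input_head :: nat
  work_tape :: tape
  written :: "bool list"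

definition init_config :: config where
  "init_config = \<lparr>state = 0, input_head = 0, work_tape = ([], 0, []), written = []\<rparr>"

definition step :: "program \<Rightarrow> cantor \<Rightarrow> config \<Rightarrow> config" where
  "step P \<omega> c =
    (case work_tape c of (ls, s, rs) \<Rightarrow>
      (case map_of P (state c, \<omega> (input_head c), s) of
        None \<Rightarrow> c
      | Some (q', s', d, d', out) \<Rightarrow>
          \<lparr>state = q',
           input_head = move_input d (input_head c),
           work_tape = move_tape d' (ls, s', rs),
           written = written c @ (case out of None \<Rightarrow> [] | Some b \<Rightarrow> [b])\<rparr>))"

definition output_at :: "program \<Rightarrow> cantor \<Rightarrow> nat \<Rightarrow> bool list" where
  "output_at P \<omega> t = written ((step P \<omega> ^^ t) init_config)"

definition machine_map :: "program \<Rightarrow> cantor \<rightharpoonup> cantor" where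
  "machine_map P \<omega> =
    (if \<forall>n. \<exists>t. n < length (output_at P \<omega> t)
     then Some (\<lambda>n. output_at P \<omega> (LEAST t. n < length (output_at P \<omega> t)) ! n)
     else None)"

definition computable_transformation :: "(cantor \<rightharpoonup> cantor) \<Rightarrow> bool" where
  "computable_transformation T \<longleftrightarrow> (\<exists>P. T = machine_map P)"

section \<open>Partial maps and measures\<close>

definition preimage :: "('a \<rightharpoonup> 'a) \<Rightarrow> 'a set \<Rightarrow> 'a set" where
  "preimage T B = {\<omega>. \<exists>\<eta>\<in>B. T \<omega> = Some \<eta>}"

definition ae_defined :: "'a measure \<Rightarrow> ('a \<rightharpoonup> 'a) \<Rightarrow> bool" where
  "ae_defined \<mu> T \<longleftrightarrow> emeasure \<mu> (dom T) = 1"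

definition measure_preserving_map :: "'a measure \<Rightarrow> ('a \<rightharpoonup> 'a) \<Rightarrow> bool" where
  "measure_preserving_map \<mu> T \<longleftrightarrow>
    (\<forall>B\<in>sets \<mu>. emeasure \<mu> (preimage T B) = emeasure \<mu> B)"

definition ergodic_map :: "'a measure \<Rightarrow> ('a \<rightharpoonup> 'a) \<Rightarrow> bool" where
  "ergodic_map \<mu> T \<longleftrightarrow>
    (\<forall>B\<in>sets \<mu>. sym_diff (preimage T B) B \<in> null_sets \<mu> \<longrightarrow> emeasure \<mu> B \<in> {0, 1})"

primrec iterate :: "('a \<rightharpoonup> 'a) \<Rightarrow> nat \<Rightarrow> 'a \<rightharpoonup> 'a" where
  "iterate T 0 = Some"
| "iterate T (Suc k) = T \<circ>\<^sub>m iterate T k"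

end

theory Submission
  imports Defs "HOL-Library.Sublist"
begin

text \<open>
  The heart of the proof is a version of Kucera's theorem: an effectively open set \<open>U\<close> of measure
  less than 1 cannot contain the whole orbit of a random point. Since \<open>T\<close> preserves \<open>\<mu>\<close>, the average
  over \<open>k < n\<close> of \<open>\<mu> (I \<inter> T\<^sup>-\<^sup>k U)\<close> is the integral over \<open>T\<^sup>-\<^sup>(\<^sup>n\<^sup>-\<^sup>1\<^sup>) U\<close> of the average
  time spent in the cylinder \<open>I\<close>. By ergodicity that average time is close to \<open>\<mu> I\<close> for a suitable
  \<open>n\<close>, which can be found effectively because only the cylinder \<open>I\<close>, and not \<open>\<mu> U\<close>, enters the search.
  Refining cylinders in this way yields a test with geometrically decreasing measures that
  covers all points whose orbits stay in \<open>U\<close>.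

  For \<open>r > \<integral>f\<close> the sets where some average with \<open>n \<ge> N\<close> exceeds \<open>r\<close> are effectively open, and by the
  classical ergodic theorem their measure is less than 1 for some \<open>N\<close>. So the orbit of a random point
  leaves such a set, and the upper limit of the averages is at most \<open>\<integral>f\<close>. For cylinders the upper bound
  applied to all cylinders of the same length gives convergence, and a lower semicontinuous
  function is a supremum of functions that are constant on cylinders.
\<close>

section \<open>Typed computability\<close>

text \<open>The ergodic theorem comes without a computable rate, and the measure of an effectively
  open set is only approximable from below, so neither can enter a test directly. What can be
  certified is an upper bound for the measure of a clopen event. Hence every rate is found by an
  unbounded search: the classical theorem guarantees that it stops, the computability of \<mu> that
  its result is correct.

  The time found for the cylinder of a string \<sigma> carries an error of order 2^-code \<sigma>.
  Distinct strings have distinct codes, so the errors of infinitely many cylinders can be summed;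
  strings ending stage j have codes at least j, so their total error is O(2^-j), which geometric
  decay absorbs.

  Open sets are presented by decidable upward closed predicates on strings, since only total
  recursive functions are available. Leaving U controls only the averages from some later orbit
  point on, so for the upper limit the finitely many earlier values must be finite; a separate test
  based on Markov's inequality ensures this.\<close>

definition recfn :: "nat \<Rightarrow> (nat list \<Rightarrow> nat) \<Rightarrow> bool" where
  "recfn n f \<longleftrightarrow> (\<exists>F. total_recursive n F \<and> (\<forall>xs. length xs = n \<longrightarrow> F xs = f xs))"

text \<open>\<open>total_recursive\<close> speaks of a function on lists of every length although
  only length n carries meaning; \<open>recfn\<close> makes the notion invariant under changes
  elsewhere.\<close>

lemma recfn_cong: "recfn n f \<Longrightarrow> (\<And>xs. length xs = n \<Longrightarrow> f xs = g xs) \<Longrightarrow> recfn n g"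
  unfolding recfn_def by metis

lemma recfn_proj: "i < n \<Longrightarrow> recfn n (\<lambda>xs. xs ! i)"
  unfolding recfn_def by (auto intro: total_recursive.proj)

lemma recfn_comp:
  assumes "recfn (length gs) f" "\<And>g. g \<in> set gs \<Longrightarrow> recfn n g"
  shows "recfn n (\<lambda>xs. f (map (\<lambda>g. g xs) gs))"
proof -
  obtain F where F: "total_recursive (length gs) F" "\<And>xs. length xs = length gs \<Longrightarrow> F xs = f xs"
    using assms(1) unfolding recfn_def by blast
  have "\<forall>g\<in>set gs. \<exists>G. total_recursive n G \<and> (\<forall>xs. length xs = n \<longrightarrow> G xs = g xs)"
    using assms(2) unfolding recfn_def by blast
  then obtain H where H: "\<And>g. g \<in> set gs \<Longrightarrow> total_recursive n (H g)"
    "\<And>g xs. g \<in> set gs \<Longrightarrow> length xs = n \<Longrightarrow> H g xs = g xs"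
    by (metis bchoice)
  have "total_recursive n (\<lambda>xs. F (map (\<lambda>g. g xs) (map H gs)))"
    by (rule total_recursive.comp) (use F H in auto)
  moreover have "F (map (\<lambda>g. g xs) (map H gs)) = f (map (\<lambda>g. g xs) gs)" if "length xs = n" for xs
    using that F(2) H(2) by (simp add: comp_def cong: map_cong)
  ultimately show ?thesis unfolding recfn_def by blast
qed

lemma recfn_prim_rec:
  assumes "recfn n f" "recfn (Suc (Suc n)) g"
  shows "recfn (Suc n) (\<lambda>xs. rec_nat (f (tl xs)) (\<lambda>k r. g (k # r # tl xs)) (hd xs))"
proof -
  obtain F where F: "total_recursive n F" "\<And>xs. length xs = n \<Longrightarrow> F xs = f xs"
    using assms(1) unfolding recfn_def by blast
  obtain G where G: "total_recursive (Suc (Suc n)) G" "\<And>xs. length xs = Suc (Suc n) \<Longrightarrow> G xs = g xs"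
    using assms(2) unfolding recfn_def by blast
  show ?thesis
    unfolding recfn_def
    by (rule exI, rule conjI, rule total_recursive.prim_rec[OF F(1) G(1)]) (simp add: F(2) G(2))
qed

lemma recfn_minimise:
  assumes "recfn (Suc n) f" "\<And>xs. length xs = n \<Longrightarrow> \<exists>y. f (y # xs) = 0"
  shows "recfn n (\<lambda>xs. LEAST y. f (y # xs) = 0)"
proof -
  obtain F where F: "total_recursive (Suc n) F" "\<And>xs. length xs = Suc n \<Longrightarrow> F xs = f xs"
    using assms(1) unfolding recfn_def by blast
  show ?thesis
    unfolding recfn_def
    by (rule exI, rule conjI, rule total_recursive.minimise[OF F(1)]) (simp_all add: F(2) assms(2))
qed

lemma computable1_iff: "computable1 f \<longleftrightarrow> recfn 1 (\<lambda>xs. f (xs ! 0))"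
proof
  assume "recfn 1 (\<lambda>xs. f (xs ! 0))"
  then show "computable1 f" unfolding recfn_def computable1_def
    by (metis One_nat_def length_Cons list.size(3) nth_Cons_0)
next
  assume "computable1 f"
  then show "recfn 1 (\<lambda>xs. f (xs ! 0))" unfolding recfn_def computable1_def
    by (metis One_nat_def Suc_length_conv length_0_conv nth_Cons_0)
qed

lemma computable2_iff: "computable2 f \<longleftrightarrow> recfn 2 (\<lambda>xs. f (xs ! 0) (xs ! 1))"
proof
  assume "recfn 2 (\<lambda>xs. f (xs ! 0) (xs ! 1))"
  then obtain F where F: "total_recursive 2 F" "\<And>xs. length xs = 2 \<Longrightarrow> F xs = f (xs ! 0) (xs ! 1)"
    unfolding recfn_def by blast
  have "f x y = F [x, y]" for x y using F(2)[of "[x, y]"] by simp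
  with F(1) show "computable2 f" unfolding computable2_def by blast
next
  assume "computable2 f"
  then obtain F where F: "total_recursive 2 F" "\<And>x y. f x y = F [x, y]"
    unfolding computable2_def by blast
  have "F xs = f (xs ! 0) (xs ! 1)" if "length xs = 2" for xs
    using that F(2) by (cases xs; cases "tl xs") auto
  with F(1) show "recfn 2 (\<lambda>xs. f (xs ! 0) (xs ! 1))" unfolding recfn_def by blast
qed

lemma recfn_app1: "computable1 f \<Longrightarrow> recfn n a \<Longrightarrow> recfn n (\<lambda>xs. f (a xs))"
  using recfn_comp[of "[a]" "\<lambda>xs. f (xs ! 0)" n] by (simp add: computable1_iff)

lemma recfn_app2: "computable2 f \<Longrightarrow> recfn n a \<Longrightarrow> recfn n b \<Longrightarrow> recfn n (\<lambda>xs. f (a xs) (b xs))"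
  using recfn_comp[of "[a, b]" "\<lambda>xs. f (xs ! 0) (xs ! 1)" n]
  by (auto simp: computable2_iff numeral_2_eq_2)

lemma computable1_const: "computable1 (\<lambda>_. c)"
proof (induction c)
  case 0
  show ?case unfolding computable1_def using total_recursive.zero by auto
next
  case (Suc c)
  have "computable1 Suc" unfolding computable1_def using total_recursive.succ by auto
  from recfn_app1[OF this] Suc show ?case unfolding computable1_iff by blast
qed

lemma computable1_Suc: "computable1 Suc"
  unfolding computable1_def using total_recursive.succ by auto

lemma computable2_rec:
  assumes "computable1 a" "recfn 3 (\<lambda>xs. s (xs ! 0) (xs ! 1) (xs ! 2))"
  shows "computable2 (\<lambda>n x. rec_nat (a x) (\<lambda>k r. s k r x) n)"
proof -
  have "recfn (Suc 1) (\<lambda>xs. rec_nat (a (tl xs ! 0)) (\<lambda>k r. s k r (tl xs ! 0)) (hd xs))"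
    using recfn_prim_rec[of 1 "\<lambda>xs. a (xs ! 0)" "\<lambda>xs. s (xs ! 0) (xs ! 1) (xs ! 2)"] assms
    by (simp add: computable1_iff numeral_3_eq_3)
  moreover have "rec_nat (a (tl xs ! 0)) (\<lambda>k r. s k r (tl xs ! 0)) (hd xs)
      = rec_nat (a (xs ! 1)) (\<lambda>k r. s k r (xs ! 1)) (xs ! 0)" if "length xs = Suc 1" for xs
    using that by (cases xs; cases "tl xs") auto
  ultimately show ?thesis unfolding computable2_iff
    by (metis (mono_tags, lifting) recfn_cong Suc_1)
qed

lemma computable2_flip: "computable2 f \<Longrightarrow> computable2 (\<lambda>x y. f y x)"
  using recfn_app2[of f 2 "\<lambda>xs. xs ! 1" "\<lambda>xs. xs ! 0"] recfn_proj[of _ 2]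
  by (simp add: computable2_iff)

section \<open>Arithmetic and the Cantor pairing function\<close>

lemma computable2_add: "computable2 (+)"
proof -
  have "computable2 (\<lambda>n x. rec_nat x (\<lambda>k r. Suc r) n)"
    by (rule computable2_rec) (auto simp: computable1_iff intro!: recfn_proj recfn_app1[OF computable1_Suc])
  moreover have "rec_nat x (\<lambda>k r. Suc r) n = n + x" for n x by (induction n) auto
  ultimately show ?thesis by simp
qed

lemma computable1_diag: "computable2 f \<Longrightarrow> computable1 (\<lambda>x. f x x)"
  using recfn_app2[of f 1 "\<lambda>xs. xs ! 0" "\<lambda>xs. xs ! 0"] recfn_proj[of 0 1]
  by (simp add: computable1_iff)

lemma computable1_rec:
  assumes "recfn 2 (\<lambda>xs. s (xs ! 0) (xs ! 1))"
  shows "computable1 (rec_nat c s)"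
proof -
  have "computable2 (\<lambda>n x. rec_nat c (\<lambda>k r. s k r) n)"
  proof (rule computable2_rec[OF computable1_const])
    show "recfn 3 (\<lambda>xs. s (xs ! 0) (xs ! 1))"
      using assms by (intro recfn_app2[of s]) (auto simp: computable2_iff intro!: recfn_proj)
  qed
  from computable1_diag[OF this] show ?thesis .
qed

lemma computable2_diff: "computable2 (-)"
proof -
  have "computable1 (rec_nat 0 (\<lambda>k r. k))"
    by (rule computable1_rec) (auto intro!: recfn_proj)
  moreover have "rec_nat 0 (\<lambda>k r. k) n = n - Suc 0" for n by (cases n) auto
  ultimately have "computable1 (\<lambda>n. n - 1)" by (metis One_nat_def ext)
  then have "computable2 (\<lambda>n x. rec_nat x (\<lambda>k r. r - 1) n)"
    by (intro computable2_rec recfn_app1[of "\<lambda>n. n - 1"]) (auto simp: computable1_iff intro!: recfn_proj)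
  moreover have "rec_nat x (\<lambda>k r. r - 1) n = x - n" for n x by (induction n) auto
  ultimately show ?thesis using computable2_flip by fastforce
qed

lemma computable1_triangle: "computable1 triangle"
proof -
  have "computable1 (rec_nat 0 (\<lambda>k r. r + Suc k))"
    by (rule computable1_rec) (auto intro!: recfn_proj recfn_app2[OF computable2_add] recfn_app1[OF computable1_Suc])
  moreover have "rec_nat 0 (\<lambda>k r. r + Suc k) n = triangle n" for n by (induction n) auto
  ultimately show ?thesis by (metis ext)
qed

lemma computable2_prod_encode: "computable2 (\<lambda>x y. prod_encode (x, y))"
  unfolding prod_encode_def computable2_iff case_prod_conv
  by (intro recfn_app2[OF computable2_add] recfn_app1[OF computable1_triangle] recfn_proj) auto

text \<open>The pairing is \<open>prod_encode (a, b) = triangle (a + b) + a\<close>, so the diagonal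
  a + b of z is the least k with z < \<open>triangle (Suc k)\<close>. Truncated subtraction turns
  this inequality into the equation with 0 that minimisation expects.\<close>

definition diagonal :: "nat \<Rightarrow> nat" where
  "diagonal z = (LEAST k. Suc z - triangle (Suc k) = 0)"

lemma diagonal_prod_encode: "diagonal (prod_encode (a, b)) = a + b"
  unfolding diagonal_def
proof (rule Least_equality)
  show "Suc (prod_encode (a, b)) - triangle (Suc (a + b)) = 0" by (simp add: prod_encode_def)
  fix k assume k: "Suc (prod_encode (a, b)) - triangle (Suc k) = 0"
  have mono: "triangle m \<le> triangle n" if "m \<le> n" for m n
    using that by (induction rule: dec_induct) auto
  show "a + b \<le> k"
  proof (rule ccontr)
    assume "\<not> a + b \<le> k"
    then have "triangle (Suc k) \<le> triangle (a + b)" by (intro mono) auto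
    with k show False by (simp add: prod_encode_def)
  qed
qed

lemma computable1_diagonal: "computable1 diagonal"
proof -
  have "recfn 1 (\<lambda>xs. LEAST k. Suc ((k # xs) ! 1) - triangle (Suc ((k # xs) ! 0)) = 0)"
  proof (rule recfn_minimise)
    show "recfn (Suc 1) (\<lambda>xs. Suc (xs ! 1) - triangle (Suc (xs ! 0)))"
      by (intro recfn_app2[OF computable2_diff] recfn_app1[OF computable1_triangle]
          recfn_app1[OF computable1_Suc] recfn_proj) auto
    have "z \<le> triangle z" for z by (induction z) auto
    then show "\<exists>y. Suc ((y # xs) ! 1) - triangle (Suc ((y # xs) ! 0)) = 0" for xs
      by (intro exI[of _ "xs ! 0"]) (simp add: trans_le_add1)
  qed
  then show ?thesis unfolding computable1_iff by (simp add: diagonal_def)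
qed

lemma computable1_fst: "computable1 (\<lambda>z. fst (prod_decode z))"
proof -
  have "fst (prod_decode z) = z - triangle (diagonal z)" for z
  proof -
    obtain a b where "z = prod_encode (a, b)" by (metis prod_decode_inverse surj_pair)
    then show ?thesis using diagonal_prod_encode[of a b]
      by simp (simp add: prod_encode_def)
  qed
  then show ?thesis unfolding computable1_iff
    by (auto intro!: recfn_app2[OF computable2_diff] recfn_app1[OF computable1_triangle]
        recfn_app1[OF computable1_diagonal] recfn_proj)
qed

lemma computable1_snd: "computable1 (\<lambda>z. snd (prod_decode z))"
proof -
  have "snd (prod_decode z) = diagonal z - fst (prod_decode z)" for z
  proof -
    obtain a b where "z = prod_encode (a, b)" by (metis prod_decode_inverse surj_pair)
    then show ?thesis using diagonal_prod_encode[of a b] by simp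
  qed
  then show ?thesis unfolding computable1_iff
    by (auto intro!: recfn_app2[OF computable2_diff] recfn_app1[OF computable1_fst]
        recfn_app1[OF computable1_diagonal] recfn_proj)
qed

section \<open>Computability of functions between coded types\<close>

class coded =
  fixes code :: "'a \<Rightarrow> nat"
  assumes code_inject: "code x = code y \<Longrightarrow> x = y"

lemma code_eq_iff [simp]: "code x = code y \<longleftrightarrow> x = y" for x y :: "'a :: coded"
  using code_inject by blast

instantiation nat :: coded
begin
definition code_nat :: "nat \<Rightarrow> nat" where [simp]: "code_nat n = n"
instance by standard simp
end

instantiation bool :: coded
begin
definition code_bool :: "bool \<Rightarrow> nat" where "code_bool b = of_bool b"
instance by standard (auto simp: code_bool_def of_bool_def split: if_splits)
end

lemma code_True [simp]: "code True = 1"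
  by (simp add: code_bool_def)

instantiation prod :: (coded, coded) coded
begin
definition code_prod :: "'a \<times> 'b \<Rightarrow> nat" where "code_prod p = prod_encode (code (fst p), code (snd p))"
instance by standard (auto simp: code_prod_def prod_eq_iff)
end

lemma code_Pair [simp]: "code (a, b) = prod_encode (code a, code b)"
  by (simp add: code_prod_def)

instantiation list :: (coded) coded
begin
definition code_list :: "'a list \<Rightarrow> nat" where "code_list xs = list_encode (map code xs)"
instance
proof
  fix xs ys :: "'a list"
  assume "code xs = code ys"
  then have "map code xs = map code ys" by (simp add: code_list_def list_encode_eq)
  then show "xs = ys" by (metis code_inject injI inj_map_eq_map)
qed
end

lemma code_Nil [simp]: "code [] = 0"
  and code_Cons [simp]: "code (x # xs) = Suc (prod_encode (code x, code xs))"
  by (simp_all add: code_list_def)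

lemma str_code_eq: "str_code x = code x"
  by (simp add: str_code_def code_list_def code_bool_def[abs_def])

lemma code_nat_list: "code xs = list_encode xs" for xs :: "nat list"
  by (simp add: code_list_def map_idI)

lemma length_le_code: "length xs \<le> code xs"
proof (induction xs)
  case (Cons x xs)
  then show ?case using le_prod_encode_2[of "code xs" "code x"] by simp
qed simp

text \<open>The function on codes is total on the natural numbers but constrained only at codes,
  since \<open>code\<close> need not be surjective.\<close>

definition cmp :: "('a::coded \<Rightarrow> 'b::coded) \<Rightarrow> bool" where
  "cmp f \<longleftrightarrow> (\<exists>g. computable1 g \<and> (\<forall>x. g (code x) = code (f x)))"

lemma cmp_nat_iff: "cmp f \<longleftrightarrow> computable1 f" for f :: "nat \<Rightarrow> nat"
proof -
  have "g = f" if "\<forall>x. g x = f x" for g using that by auto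
  then show ?thesis unfolding cmp_def code_nat_def by metis
qed

lemma cmp_comp: assumes "cmp f" "cmp g" shows "cmp (\<lambda>x. f (g x))"
proof -
  obtain F G where "computable1 F" "\<And>x. F (code x) = code (f x)"
    "computable1 G" "\<And>x. G (code x) = code (g x)"
    using assms unfolding cmp_def by blast
  moreover have "computable1 (\<lambda>x. F (G x))"
    using calculation recfn_app1 by (simp add: computable1_iff)
  ultimately show ?thesis unfolding cmp_def by (intro exI[of _ "\<lambda>x. F (G x)"]) auto
qed

named_theorems cmp_intros

lemma cmp_id [cmp_intros]: "cmp (\<lambda>x. x)"
  unfolding cmp_def by (intro exI[of _ "\<lambda>x. x"]) (auto simp: computable1_iff intro: recfn_proj)

lemma cmp_const [cmp_intros]: "cmp (\<lambda>x. c)"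
  unfolding cmp_def by (intro exI[of _ "\<lambda>x. code c"]) (auto intro: computable1_const)

lemma cmp_Pair [cmp_intros]:
  assumes "cmp f" "cmp g" shows "cmp (\<lambda>x. (f x, g x))"
proof -
  obtain F G where "computable1 F" "\<And>x. F (code x) = code (f x)"
    "computable1 G" "\<And>x. G (code x) = code (g x)"
    using assms unfolding cmp_def by blast
  moreover have "computable1 (\<lambda>x. prod_encode (F x, G x))"
    using calculation recfn_app2[OF computable2_prod_encode] by (simp add: computable1_iff)
  ultimately show ?thesis unfolding cmp_def by (intro exI[of _ "\<lambda>x. prod_encode (F x, G x)"]) auto
qed

lemma cmp_fst [cmp_intros]: assumes "cmp f" shows "cmp (\<lambda>x. fst (f x))"
proof -
  have "cmp (fst :: 'b \<times> 'c \<Rightarrow> 'b)"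
    unfolding cmp_def by (rule exI[of _ "\<lambda>z. fst (prod_decode z)"]) (auto simp: computable1_fst)
  from cmp_comp[OF this assms] show ?thesis .
qed

lemma cmp_snd [cmp_intros]: assumes "cmp f" shows "cmp (\<lambda>x. snd (f x))"
proof -
  have "cmp (snd :: 'b \<times> 'c \<Rightarrow> 'c)"
    unfolding cmp_def by (rule exI[of _ "\<lambda>z. snd (prod_decode z)"]) (auto simp: computable1_snd)
  from cmp_comp[OF this assms] show ?thesis .
qed

lemma cmp_comp2:
  assumes "cmp (\<lambda>z. F (fst z) (snd z))" "cmp a" "cmp b" shows "cmp (\<lambda>x. F (a x) (b x))"
  using cmp_comp[OF assms(1) cmp_Pair[OF assms(2,3)]] by simp

lemma cmp_comp3:
  assumes "cmp (\<lambda>z. F (fst z) (fst (snd z)) (snd (snd z)))" "cmp a" "cmp b" "cmp c"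
  shows "cmp (\<lambda>x. F (a x) (b x) (c x))"
  using cmp_comp[OF assms(1) cmp_Pair[OF assms(2) cmp_Pair[OF assms(3,4)]]] by simp

lemma cmp_computable2:
  assumes "computable2 f" shows "cmp (\<lambda>z. f (fst z) (snd z))"
  unfolding cmp_def
proof (intro exI conjI allI)
  show "computable1 (\<lambda>z. f (fst (prod_decode z)) (snd (prod_decode z)))"
    unfolding computable1_iff
    by (intro recfn_app2[OF assms] recfn_app1[OF computable1_fst] recfn_app1[OF computable1_snd]
        recfn_proj) auto
qed (auto simp: code_prod_def)

lemma cmp_Suc [cmp_intros]: "cmp f \<Longrightarrow> cmp (\<lambda>x. Suc (f x))"
  by (rule cmp_comp[of Suc]) (auto simp: cmp_nat_iff computable1_Suc)

lemma cmp_add [cmp_intros]: "cmp f \<Longrightarrow> cmp g \<Longrightarrow> cmp (\<lambda>x. f x + g x :: nat)"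
  by (rule cmp_comp2[of "(+)", OF cmp_computable2[OF computable2_add]])

lemma cmp_diff [cmp_intros]: "cmp f \<Longrightarrow> cmp g \<Longrightarrow> cmp (\<lambda>x. f x - g x :: nat)"
  by (rule cmp_comp2[of "(-)", OF cmp_computable2[OF computable2_diff]])

lemma cmp_rec_nat [cmp_intros]:
  fixes s :: "'a::coded \<Rightarrow> nat \<Rightarrow> 'b::coded \<Rightarrow> 'b"
  assumes "cmp a" "cmp (\<lambda>z. s (fst z) (fst (snd z)) (snd (snd z)))" "cmp n"
  shows "cmp (\<lambda>x. rec_nat (a x) (s x) (n x))"
proof -
  obtain A S where A: "computable1 A" "\<And>x. A (code x) = code (a x)"
    and S: "computable1 S"
      "\<And>z :: 'a \<times> nat \<times> 'b. S (code z) = code (s (fst z) (fst (snd z)) (snd (snd z)))"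
    using assms unfolding cmp_def by blast
  define R where "R = (\<lambda>m x. rec_nat (A x) (\<lambda>k r. S (prod_encode (x, prod_encode (k, r)))) m)"
  have "computable2 R"
    unfolding R_def
  proof (rule computable2_rec[OF A(1)])
    show "recfn 3 (\<lambda>xs. S (prod_encode (xs ! 2, prod_encode (xs ! 0, xs ! 1))))"
      by (intro recfn_app1[OF S(1)] recfn_app2[OF computable2_prod_encode] recfn_proj) auto
  qed
  moreover have R: "R m (code x) = code (rec_nat (a x) (s x) m)" for m x
    by (induction m) (use A(2) S(2) in \<open>auto simp: R_def\<close>)
  ultimately have "cmp (\<lambda>x. rec_nat (a (snd x)) (s (snd x)) (fst x))"
    unfolding cmp_def
    by (intro exI[of _ "\<lambda>z. R (fst (prod_decode z)) (snd (prod_decode z))"])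
      (auto simp: code_prod_def computable1_iff intro!: recfn_app2[of R] recfn_app1[OF computable1_fst]
        recfn_app1[OF computable1_snd] recfn_proj)
  from cmp_comp[OF this cmp_Pair[OF assms(3) cmp_id]] show ?thesis by simp
qed

lemma cmp_code: "cmp f \<Longrightarrow> cmp (\<lambda>x. code (f x))"
  by (simp add: cmp_def)

text \<open>The code of a truth value is 0 or 1, so a primitive recursion of that length either
  keeps its start value or replaces it once.\<close>

lemma cmp_if [cmp_intros]:
  assumes "cmp b" "cmp f" "cmp g"
  shows "cmp (\<lambda>x. if b x then f x else g x)"
proof -
  have "cmp (\<lambda>x. rec_nat (g x) (\<lambda>_ _. f x) (code (b x)))"
  proof (rule cmp_rec_nat[OF assms(3) _ cmp_code[OF assms(1)]])
    show "cmp (\<lambda>z :: 'a \<times> nat \<times> 'b. f (fst z))"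
      by (rule cmp_comp[OF assms(2) cmp_fst[OF cmp_id]])
  qed
  moreover have "rec_nat (g x) (\<lambda>_ _. f x) (code (b x)) = (if b x then f x else g x)" for x
    by (cases "b x") (simp_all add: code_bool_def)
  ultimately show ?thesis by simp
qed

lemma cmp_of_bool [cmp_intros]: "cmp b \<Longrightarrow> cmp (\<lambda>x. of_bool (b x) :: nat)"
  unfolding cmp_def by (simp add: code_bool_def)

lemma cmp_not [cmp_intros]: "cmp b \<Longrightarrow> cmp (\<lambda>x. \<not> b x)"
proof -
  have "(\<lambda>x. \<not> b x) = (\<lambda>x. if b x then False else True)" by auto
  then show "cmp b \<Longrightarrow> ?thesis" by (simp only:) (intro cmp_if cmp_const)
qed

lemma cmp_conj [cmp_intros]: "cmp b \<Longrightarrow> cmp c \<Longrightarrow> cmp (\<lambda>x. b x \<and> c x)"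
proof -
  have "(\<lambda>x. b x \<and> c x) = (\<lambda>x. if b x then c x else False)" by auto
  then show "cmp b \<Longrightarrow> cmp c \<Longrightarrow> ?thesis" by (simp only:) (intro cmp_if cmp_const)
qed

lemma cmp_disj [cmp_intros]: "cmp b \<Longrightarrow> cmp c \<Longrightarrow> cmp (\<lambda>x. b x \<or> c x)"
proof -
  have "(\<lambda>x. b x \<or> c x) = (\<lambda>x. if b x then True else c x)" by auto
  then show "cmp b \<Longrightarrow> cmp c \<Longrightarrow> ?thesis" by (simp only:) (intro cmp_if cmp_const)
qed

lemma cmp_eq [cmp_intros]:
  assumes "cmp f" "cmp g" shows "cmp (\<lambda>x. f x = g x)"
proof -
  note 1 = cmp_code[OF assms(1)] cmp_code[OF assms(2)]
  have "cmp (\<lambda>x. 1 - ((code (f x) - code (g x)) + (code (g x) - code (f x))))"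
    by (intro cmp_intros 1)
  moreover have "1 - ((code (f x) - code (g x)) + (code (g x) - code (f x))) = code (f x = g x)" for x
  proof -
    have "1 - ((m - n) + (n - m)) = of_bool (m = n)" for m n :: nat by auto
    then show ?thesis by (simp add: code_bool_def)
  qed
  ultimately show ?thesis unfolding cmp_def by simp
qed

lemma cmp_le [cmp_intros]: "cmp f \<Longrightarrow> cmp g \<Longrightarrow> cmp (\<lambda>x. f x \<le> (g x :: nat))"
  using cmp_eq[OF cmp_diff[of f g] cmp_const[of 0]] by simp

lemma cmp_less [cmp_intros]: "cmp f \<Longrightarrow> cmp g \<Longrightarrow> cmp (\<lambda>x. f x < (g x :: nat))"
  using cmp_le[OF cmp_Suc[of f]] by (simp add: Suc_le_eq)

lemma cmp_sum [cmp_intros]: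
  fixes f :: "'a::coded \<Rightarrow> nat \<Rightarrow> nat"
  assumes "cmp (\<lambda>z. f (fst z) (snd z))" "cmp n"
  shows "cmp (\<lambda>x. \<Sum>k<n x. f x k)"
proof -
  have "cmp (\<lambda>x. rec_nat 0 (\<lambda>k r. r + f x k) (n x))"
    by (intro cmp_intros cmp_comp2[OF assms(1)] assms(2))
  moreover have "rec_nat 0 (\<lambda>k r. r + f x k) n = (\<Sum>k<n. f x k)" for x n by (induction n) auto
  ultimately show ?thesis by simp
qed

lemma cmp_bex [cmp_intros]:
  fixes P :: "'a::coded \<Rightarrow> nat \<Rightarrow> bool"
  assumes "cmp (\<lambda>z. P (fst z) (snd z))" "cmp n"
  shows "cmp (\<lambda>x. \<exists>k<n x. P x k)"
proof -
  have "cmp (\<lambda>x. rec_nat False (\<lambda>k r. r \<or> P x k) (n x))"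
    by (intro cmp_intros cmp_comp2[OF assms(1)] assms(2))
  moreover have "rec_nat False (\<lambda>k r. r \<or> P x k) n = (\<exists>k<n. P x k)" for x n
    by (induction n) (auto simp: less_Suc_eq)
  ultimately show ?thesis by simp
qed

lemma cmp_ball [cmp_intros]:
  fixes P :: "'a::coded \<Rightarrow> nat \<Rightarrow> bool"
  assumes "cmp (\<lambda>z. P (fst z) (snd z))" "cmp n"
  shows "cmp (\<lambda>x. \<forall>k<n x. P x k)"
  using cmp_not[OF cmp_bex[OF cmp_not[OF assms(1)] assms(2)]] by simp

text \<open>Stated for numbers only: minimisation must succeed at every natural number, and for a
  general coded type nothing is known at numbers that code no element. Several parameters are packed
  into one number.\<close>

lemma cmp_Least:
  fixes P :: "nat \<Rightarrow> nat \<Rightarrow> bool"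
  assumes P: "cmp (\<lambda>z. P (fst z) (snd z))" and ex: "\<And>x. \<exists>y. P x y"
  shows "cmp (\<lambda>x. LEAST y. P x y)"
proof -
  obtain Q where Q: "computable1 Q" "\<And>z. Q (code z) = code (\<not> P (fst z) (snd z))"
    using cmp_not[OF P] unfolding cmp_def by blast
  have 0: "Q (prod_encode (x, y)) = 0 \<longleftrightarrow> P x y" for x y
    using Q(2)[of "(x, y)"] by (simp add: code_bool_def)
  have "recfn 1 (\<lambda>xs. LEAST y. Q (prod_encode ((y # xs) ! 1, (y # xs) ! 0)) = 0)"
  proof (rule recfn_minimise)
    show "recfn (Suc 1) (\<lambda>xs. Q (prod_encode (xs ! 1, xs ! 0)))"
      by (intro recfn_app1[OF Q(1)] recfn_app2[OF computable2_prod_encode] recfn_proj) auto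
  qed (use ex in \<open>auto simp: 0\<close>)
  then show ?thesis unfolding cmp_nat_iff computable1_iff by (simp add: 0)
qed

lemma cmp_prod_encode [cmp_intros]: "cmp f \<Longrightarrow> cmp g \<Longrightarrow> cmp (\<lambda>x. prod_encode (f x, g x))"
  using cmp_Pair[of f g] by (simp add: cmp_def)

lemma cmp_prod_decode [cmp_intros]: "cmp f \<Longrightarrow> cmp (\<lambda>x. prod_decode (f x))"
  by (simp add: cmp_def code_prod_def)

lemma cmp_mult [cmp_intros]: assumes "cmp f" "cmp g" shows "cmp (\<lambda>x. f x * g x :: nat)"
proof -
  have "cmp (\<lambda>x. \<Sum>k<f x. g x)"
    by (intro cmp_intros cmp_comp[OF assms(2)] assms(1))
  then show ?thesis by simp
qed

lemma cmp_power [cmp_intros]: assumes "cmp f" "cmp g" shows "cmp (\<lambda>x. f x ^ g x :: nat)"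
proof -
  have "cmp (\<lambda>x. rec_nat 1 (\<lambda>_ r. f x * r) (g x))"
    by (intro cmp_intros cmp_comp[OF assms(1)] assms(2))
  moreover have "rec_nat 1 (\<lambda>_ r. m * r) n = m ^ n" for m n :: nat by (induction n) auto
  ultimately show ?thesis by simp
qed

lemma cmp_div [cmp_intros]: assumes "cmp f" "cmp g" shows "cmp (\<lambda>x. f x div g x :: nat)"
proof -
  \<comment> \<open>The disjunct n = 0 makes the search stop at q = 0, in accordance with
    \<open>m div 0 = 0\<close>.\<close>
  define D where "D m n q \<longleftrightarrow> n = 0 \<or> m < Suc q * n" for m n q :: nat
  have D: "(LEAST q. D m n q) = m div n" for m n
  proof (rule Least_equality)
    show "D m n (m div n)"
      using dividend_less_div_times[of n m] by (cases "n = 0") (simp_all add: D_def)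
    show "m div n \<le> q" if "D m n q" for q
      using that less_mult_imp_div_less[of m "Suc q" n] unfolding D_def by (cases "n = 0") auto
  qed
  have "cmp (\<lambda>z. LEAST q. D (fst (prod_decode z)) (snd (prod_decode z)) q)"
  proof (rule cmp_Least)
    show "cmp (\<lambda>z. D (fst (prod_decode (fst z))) (snd (prod_decode (fst z))) (snd z))"
      unfolding D_def by (intro cmp_intros)
    show "\<exists>y. D (fst (prod_decode x)) (snd (prod_decode x)) y" for x
      unfolding D_def by (cases "snd (prod_decode x)") (auto intro: exI[of _ "fst (prod_decode x)"])
  qed
  from cmp_comp[OF this cmp_prod_encode[OF assms]] show ?thesis by (simp add: D)
qed

lemma cmp_even [cmp_intros]: assumes "cmp f" shows "cmp (\<lambda>x. even (f x :: nat))"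
proof -
  have "cmp (\<lambda>x. 2 * (f x div 2) = f x)" by (intro cmp_intros assms)
  moreover have "2 * (n div 2) = n \<longleftrightarrow> even n" for n :: nat by presburger
  ultimately show ?thesis by simp
qed

section \<open>Computable operations on lists\<close>

lemma cmp_Cons [cmp_intros]:
  assumes "cmp f" "cmp g" shows "cmp (\<lambda>x. f x # g x)"
proof -
  have "cmp (\<lambda>x. Suc (prod_encode (code (f x), code (g x))))"
    by (intro cmp_Suc cmp_prod_encode cmp_code assms)
  then show ?thesis by (simp add: cmp_def)
qed

lemma cmp_foldl [cmp_intros]:
  fixes h :: "'a::coded \<Rightarrow> 'b::coded \<Rightarrow> 'c::coded \<Rightarrow> 'b"
  assumes h: "cmp (\<lambda>z. h (fst z) (fst (snd z)) (snd (snd z)))" and a: "cmp a" and l: "cmp l"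
  shows "cmp (\<lambda>x. foldl (h x) (a x) (l x))"
proof -
  obtain H where H: "computable1 H" "\<And>x b c. H (code (x, b, c)) = code (h x b c)"
    using h unfolding cmp_def by (metis fst_conv snd_conv)
  have cH: "cmp H" using H(1) by (simp add: cmp_nat_iff)
  \<comment> \<open>One step of the fold on the codes of accumulator and remaining list; it idles
    once the list code is 0. Hence any number of steps that is at least the length will do, and by
    \<open>length_le_code\<close> the code of the list is such a number.\<close>
  define s where "s x r = (if snd r = 0 then r else
     (H (prod_encode (x, prod_encode (fst r, fst (prod_decode (snd r - 1))))), snd (prod_decode (snd r - 1))))"
    for x :: nat and r :: "nat \<times> nat"
  have s_list: "fst ((s (code x) ^^ n) (code b, code xs)) = code (foldl (h x) b xs)"
    if "length xs \<le> n" for x n b xs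
    using that
  proof (induction n arbitrary: b xs)
    case (Suc n)
    show ?case
    proof (cases xs)
      case Nil
      have "(s (code x) ^^ m) (code b, 0) = (code b, 0)" for m
        by (induction m) (auto simp: s_def)
      with Nil show ?thesis by (metis code_Nil foldl_Nil fst_conv)
    next
      case (Cons c cs)
      then have "s (code x) (code b, code xs) = (code (h x b c), code cs)"
        using H(2)[of x b c] by (simp add: s_def)
      moreover have "length cs \<le> n" using Suc.prems Cons by simp
      ultimately show ?thesis using Suc.IH[of cs "h x b c"] Cons
        by (simp del: funpow.simps add: funpow_Suc_right)
    qed
  qed simp
  have pow: "rec_nat u (\<lambda>_ r. s y r) n = (s y ^^ n) u" for u y n by (induction n) auto
  note c = cmp_code[OF cmp_id] cmp_code[OF a] cmp_code[OF l]
  have "cmp (\<lambda>x. fst (rec_nat (code (a x), code (l x)) (\<lambda>_ r. s (code x) r) (code (l x))))"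
    unfolding s_def by (intro cmp_intros cmp_comp[OF cH] cmp_comp[OF c(1)] c)
  then show ?thesis unfolding pow s_list[OF length_le_code] by (simp add: cmp_def)
qed

lemma cmp_rev [cmp_intros]: assumes "cmp f" shows "cmp (\<lambda>x. rev (f x))"
proof -
  have "cmp (\<lambda>x. foldl (\<lambda>ys y. y # ys) [] (f x))" by (intro cmp_intros assms)
  moreover have "foldl (\<lambda>ys y. y # ys) zs xs = rev xs @ zs" for xs zs :: "'b list"
    by (induction xs arbitrary: zs) auto
  ultimately show ?thesis by simp
qed

lemma cmp_append [cmp_intros]: assumes "cmp f" "cmp g" shows "cmp (\<lambda>x. f x @ g x)"
proof -
  have "cmp (\<lambda>x. foldl (\<lambda>ys y. y # ys) (g x) (rev (f x)))" by (intro cmp_intros assms)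
  moreover have "foldl (\<lambda>ys y. y # ys) zs xs = rev xs @ zs" for xs zs :: "'b list"
    by (induction xs arbitrary: zs) auto
  ultimately show ?thesis by simp
qed

lemma cmp_length [cmp_intros]: assumes "cmp f" shows "cmp (\<lambda>x. length (f x))"
proof -
  have "cmp (\<lambda>x. foldl (\<lambda>n _. Suc n) 0 (f x))" by (intro cmp_intros assms)
  moreover have "foldl (\<lambda>n _. Suc n) k xs = length xs + k" for xs :: "'b list" and k
    by (induction xs arbitrary: k) auto
  ultimately show ?thesis by simp
qed

lemma cmp_map [cmp_intros]:
  assumes "cmp (\<lambda>z. h (fst z) (snd z))" "cmp f" shows "cmp (\<lambda>x. map (h x) (f x))"
proof -
  have "cmp (\<lambda>x. rev (foldl (\<lambda>ys y. h x y # ys) [] (f x)))"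
    by (intro cmp_intros cmp_comp2[OF assms(1)] assms(2))
  moreover have "foldl (\<lambda>ys y. g y # ys) zs xs = rev (map g xs) @ zs" for g :: "'b \<Rightarrow> 'c" and xs zs
    by (induction xs arbitrary: zs) auto
  ultimately show ?thesis by simp
qed

lemma cmp_sum_list [cmp_intros]: assumes "cmp f" shows "cmp (\<lambda>x. sum_list (f x) :: nat)"
proof -
  have "cmp (\<lambda>x. foldl (+) 0 (f x))" by (intro cmp_intros assms)
  moreover have "foldl (+) k xs = sum_list xs + k" for xs :: "nat list" and k
    by (induction xs arbitrary: k) auto
  ultimately show ?thesis by simp
qed

lemma cmp_case_list [cmp_intros]:
  assumes a: "cmp a" and h: "cmp (\<lambda>z. h (fst z) (fst (snd z)) (snd (snd z)))" and l: "cmp l"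
  shows "cmp (\<lambda>x. case l x of [] \<Rightarrow> a x | y # ys \<Rightarrow> h x y ys)"
proof -
  obtain H where H: "computable1 H" "\<And>x b c. H (code (x, b, c)) = code (h x b c)"
    using h unfolding cmp_def by (metis fst_conv snd_conv)
  have cH: "cmp H" using H(1) by (simp add: cmp_nat_iff)
  note c = cmp_code[OF cmp_id] cmp_code[OF a] cmp_code[OF l]
  have "cmp (\<lambda>x. if code (l x) = 0 then code (a x) else H (prod_encode (code x, code (l x) - 1)))"
    by (intro cmp_intros cmp_comp[OF cH] c)
  moreover have "(if code (l x) = 0 then code (a x) else H (prod_encode (code x, code (l x) - 1)))
      = code (case l x of [] \<Rightarrow> a x | y # ys \<Rightarrow> h x y ys)" for x
    using H(2) by (simp split: list.split)
  ultimately show ?thesis by (simp add: cmp_def)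
qed

lemma cmp_drop [cmp_intros]: assumes "cmp n" "cmp f" shows "cmp (\<lambda>x. drop (n x) (f x))"
proof -
  have "cmp (\<lambda>x. rec_nat (f x) (\<lambda>_ ys. case ys of [] \<Rightarrow> [] | _ # zs \<Rightarrow> zs) (n x))"
    by (intro cmp_intros assms)
  moreover have "rec_nat xs (\<lambda>_ ys. case ys of [] \<Rightarrow> [] | _ # zs \<Rightarrow> zs) n = drop n xs" for n and xs :: "'b list"
  proof (induction n)
    case (Suc n)
    have "(case ys of [] \<Rightarrow> [] | _ # zs \<Rightarrow> zs) = tl ys" for ys :: "'b list" by (cases ys) auto
    with Suc show ?case by (simp add: drop_Suc tl_drop)
  qed simp
  ultimately show ?thesis by simp
qed

lemma cmp_take [cmp_intros]: assumes "cmp n" "cmp f" shows "cmp (\<lambda>x. take (n x) (f x))"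
proof -
  have "cmp (\<lambda>x. rev (drop (length (f x) - n x) (rev (f x))))"
    by (intro cmp_intros assms)
  moreover have "rev (drop (length xs - n) (rev xs)) = take n xs" for n and xs :: "'b list"
    by (cases "n \<le> length xs") (simp_all add: rev_drop)
  ultimately show ?thesis by simp
qed

definition nth_default :: "'a \<Rightarrow> 'a list \<Rightarrow> nat \<Rightarrow> 'a" where
  "nth_default d xs n = (if n < length xs then xs ! n else d)"

lemma cmp_nth_default [cmp_intros]:
  assumes "cmp d" "cmp f" "cmp n" shows "cmp (\<lambda>x. nth_default (d x) (f x) (n x))"
proof -
  have "cmp (\<lambda>x. case drop (n x) (f x) of [] \<Rightarrow> d x | y # _ \<Rightarrow> y)"
    by (intro cmp_intros assms cmp_comp[OF assms(1)])
  moreover have "(case drop n xs of [] \<Rightarrow> d | y # _ \<Rightarrow> y) = nth_default d xs n" for d n and xs :: "'b list"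
    by (cases "n < length xs") (auto simp: nth_default_def Cons_nth_drop_Suc[symmetric])
  ultimately show ?thesis by simp
qed

lemma cmp_funpow:
  fixes F :: "'b::coded \<Rightarrow> 'b"
  assumes "cmp F" "cmp n" "cmp a" shows "cmp (\<lambda>x. (F ^^ n x) (a x))"
proof -
  have "cmp (\<lambda>x. rec_nat (a x) (\<lambda>_ r. F r) (n x))"
    by (intro cmp_intros cmp_comp[OF assms(1)] assms)
  moreover have "rec_nat u (\<lambda>_ r. F r) k = (F ^^ k) u" for u k by (induction k) auto
  ultimately show ?thesis by simp
qed

lemma cmp_list_decode [cmp_intros]: "cmp f \<Longrightarrow> cmp (\<lambda>x. list_decode (f x))"
  by (simp add: cmp_def code_nat_list)

lemma cmp_prefix [cmp_intros]:
  assumes "cmp f" "cmp g" shows "cmp (\<lambda>x. prefix (f x) (g x))"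
proof -
  have "cmp (\<lambda>x. take (length (f x)) (g x) = f x)" by (intro cmp_intros assms)
  moreover have "prefix xs ys \<longleftrightarrow> take (length xs) ys = xs" for xs ys :: "'b list"
    by (metis append_eq_conv_conj prefix_def take_is_prefix)
  ultimately show ?thesis by simp
qed

section \<open>Machines as monotone string functions\<close>

definition pref :: "cantor \<Rightarrow> nat \<Rightarrow> bool list" where
  "pref \<omega> m = map \<omega> [0..<m]"

lemma length_pref [simp]: "length (pref \<omega> m) = m"
  by (simp add: pref_def)

lemma pref_0 [simp]: "pref \<omega> 0 = []"
  by (simp add: pref_def)

lemma pref_Suc: "pref \<omega> (Suc m) = pref \<omega> m @ [\<omega> m]"
  by (simp add: pref_def)

lemma nth_pref [simp]: "i < m \<Longrightarrow> pref \<omega> m ! i = \<omega> i"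
  by (simp add: pref_def)

lemma take_pref: "m \<le> n \<Longrightarrow> take m (pref \<omega> n) = pref \<omega> m"
  by (simp add: pref_def take_map)

lemma pref_mono: "m \<le> n \<Longrightarrow> prefix (pref \<omega> m) (pref \<omega> n)"
  by (metis take_is_prefix take_pref)

lemma prefix_pref_iff: "prefix \<sigma> (pref \<omega> m) \<longleftrightarrow> length \<sigma> \<le> m \<and> \<sigma> = pref \<omega> (length \<sigma>)"
proof
  assume *: "prefix \<sigma> (pref \<omega> m)"
  then have "length \<sigma> \<le> m" using prefix_length_le by fastforce
  moreover have "\<sigma> = take (length \<sigma>) (pref \<omega> m)"
    using * by (auto simp: prefix_def)
  ultimately show "length \<sigma> \<le> m \<and> \<sigma> = pref \<omega> (length \<sigma>)" by (simp add: take_pref)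
next
  assume "length \<sigma> \<le> m \<and> \<sigma> = pref \<omega> (length \<sigma>)"
  then show "prefix \<sigma> (pref \<omega> m)" using pref_mono[of "length \<sigma>" m \<omega>] by simp
qed

lemma mem_cyl_iff: "\<omega> \<in> cyl \<sigma> \<longleftrightarrow> \<sigma> = pref \<omega> (length \<sigma>)"
  by (subst list_eq_iff_nth_eq) (auto simp: cyl_def)

text \<open>Every string is a prefix of a sequence, so facts about runs on sequences carry over to
  strings.\<close>

lemma pref_padded: "pref (nth_default False \<tau>) (length \<tau>) = \<tau>"
  by (subst list_eq_iff_nth_eq) (auto simp: nth_default_def)

text \<open>Configurations as nested pairs, to which the \<open>coded\<close> instances
  apply.\<close>

type_synonym sconfig = "nat \<times> nat \<times> tape \<times> bool list"

definition sconfig_of :: "config \<Rightarrow> sconfig" where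
  "sconfig_of c = (state c, input_head c, work_tape c, written c)"

fun apply_entry :: "nat \<times> nat \<times> dir \<times> dir \<times> bool option \<Rightarrow> sconfig \<Rightarrow> sconfig" where
  "apply_entry (q', s', d, d', out) (q, h, (ls, s, rs), w) =
     (q', move_input d h, move_tape d' (ls, s', rs), w @ (case out of None \<Rightarrow> [] | Some b \<Rightarrow> [b]))"

fun sstep :: "program \<Rightarrow> bool list \<Rightarrow> sconfig \<Rightarrow> sconfig" where
  "sstep P \<sigma> (q, h, (ls, s, rs), w) =
    (case map_of P (q, nth_default False \<sigma> h, s) of
       None \<Rightarrow> (q, h, (ls, s, rs), w)
     | Some e \<Rightarrow> apply_entry e (q, h, (ls, s, rs), w))"

text \<open>After t steps at most the first t input cells have been read, so a run of
  \<open>length \<sigma>\<close> steps cannot tell the padded string from a sequence that extends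
  it.\<close>

definition machine_string :: "program \<Rightarrow> bool list \<Rightarrow> bool list" where
  "machine_string P \<sigma> = snd (snd (snd ((sstep P \<sigma> ^^ length \<sigma>) (sconfig_of init_config))))"

lemma cmp_move_tape: "cmp f \<Longrightarrow> cmp (\<lambda>x. move_tape d (f x))"
proof -
  have *: "move_tape d t = (case d of Stay \<Rightarrow> t
    | GoLeft \<Rightarrow> (case fst t of [] \<Rightarrow> ([], 0, fst (snd t) # snd (snd t)) | l # ls \<Rightarrow> (ls, l, fst (snd t) # snd (snd t)))
    | GoRight \<Rightarrow> (case snd (snd t) of [] \<Rightarrow> (fst (snd t) # fst t, 0, []) | r # rs \<Rightarrow> (fst (snd t) # fst t, r, rs)))"
    for t :: tape
    by (cases "(d, t)" rule: move_tape.cases) auto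
  assume f: "cmp f"
  show ?thesis unfolding * by (cases d) (simp_all only: dir.case, (intro cmp_intros cmp_comp[OF f] f)+)
qed

lemma cmp_move_input: "cmp f \<Longrightarrow> cmp (\<lambda>x. move_input d (f x))"
  by (cases d) (simp_all only: move_input.simps, (intro cmp_intros | assumption)+)

lemma cmp_apply_entry: "cmp f \<Longrightarrow> cmp (\<lambda>x. apply_entry e (f x))"
proof -
  obtain q' s' d d' out where e: "e = (q', s', d, d', out)" by (cases e)
  have *: "apply_entry e c = (q', move_input d (fst (snd c)),
      move_tape d' (fst (fst (snd (snd c))), s', snd (snd (fst (snd (snd c))))),
      snd (snd (snd c)) @ (case out of None \<Rightarrow> [] | Some b \<Rightarrow> [b]))" for c :: sconfig
    unfolding e by (cases "((q', s', d, d', out), c)" rule: apply_entry.cases) auto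
  show "cmp f \<Longrightarrow> ?thesis"
    unfolding * by (intro cmp_intros cmp_move_input cmp_move_tape | assumption)+
qed

text \<open>Table lookup in a fixed program is a finite nest of case distinctions, whence the
  induction on P.\<close>

lemma cmp_sstep: "cmp (\<lambda>z. sstep P (fst z) (snd z))"
proof -
  have *: "sstep P \<sigma> c =
    (case map_of P (fst c, nth_default False \<sigma> (fst (snd c)), fst (snd (fst (snd (snd c))))) of
       None \<Rightarrow> c | Some e \<Rightarrow> apply_entry e c)" for \<sigma> c
    by (cases "(P, \<sigma>, c)" rule: sstep.cases) auto
  have "cmp (\<lambda>z :: bool list \<times> sconfig. case map_of P (fst (snd z), nth_default False (fst z) (fst (snd (snd z))),
      fst (snd (fst (snd (snd (snd z)))))) of None \<Rightarrow> snd z | Some e \<Rightarrow> apply_entry e (snd z))"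
  proof (induction P)
    case Nil
    show ?case by (simp add: cmp_snd cmp_id)
  next
    case (Cons p P)
    have "cmp (\<lambda>z :: bool list \<times> sconfig.
      if (fst (snd z), nth_default False (fst z) (fst (snd (snd z))), fst (snd (fst (snd (snd (snd z)))))) = fst p
      then apply_entry (snd p) (snd z)
      else case map_of P (fst (snd z), nth_default False (fst z) (fst (snd (snd z))),
      fst (snd (fst (snd (snd (snd z)))))) of None \<Rightarrow> snd z | Some e \<Rightarrow> apply_entry e (snd z))"
      by (intro cmp_if Cons.IH) (intro cmp_intros cmp_apply_entry)+
    moreover have "(case map_of (p # P) k of None \<Rightarrow> c | Some e \<Rightarrow> apply_entry e c)
      = (if k = fst p then apply_entry (snd p) c
         else case map_of P k of None \<Rightarrow> c | Some e \<Rightarrow> apply_entry e c)" for k c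
      by (cases p) auto
    ultimately show ?case by simp
  qed
  then show ?thesis unfolding * .
qed

lemma cmp_machine_string: "cmp (machine_string P)"
proof -
  have "cmp (\<lambda>\<sigma>. snd (snd (snd (rec_nat (0, 0, ([], 0, []), []) (\<lambda>_ c. sstep P \<sigma> c) (length \<sigma>)))))"
    by (intro cmp_intros cmp_comp2[of "sstep P", OF cmp_sstep])
  moreover have "rec_nat c (\<lambda>_ c. F c) n = (F ^^ n) c" for F :: "sconfig \<Rightarrow> sconfig" and c n
    by (induction n) auto
  ultimately show ?thesis
    by (simp add: machine_string_def[abs_def] sconfig_of_def init_config_def)
qed

lemma input_head_le: "input_head ((step P \<omega> ^^ t) init_config) \<le> t"
proof (induction t)
  case (Suc t)
  have "move_input d h \<le> Suc h" for d h by (cases d) auto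
  then have "input_head (step P \<omega> c) \<le> Suc (input_head c)" for c
    by (auto simp: step_def split: prod.splits option.splits)
  from le_trans[OF this, of "(step P \<omega> ^^ t) init_config" "Suc t"] Suc show ?case by simp
qed (simp add: init_config_def)

lemma sconfig_of_steps:
  "t \<le> m \<Longrightarrow> sconfig_of ((step P \<omega> ^^ t) init_config) = (sstep P (pref \<omega> m) ^^ t) (sconfig_of init_config)"
proof (induction t)
  case (Suc t)
  let ?c = "(step P \<omega> ^^ t) init_config"
  obtain q h ls s rs w where c: "?c = \<lparr>state = q, input_head = h, work_tape = (ls, s, rs), written = w\<rparr>"
    by (metis config.surjective old.unit.exhaust prod.collapse)
  \<comment> \<open>After t steps the head is at most at cell t, and t < m: the scanned bit lies in
    the prefix and not in the padding.\<close>
  have "h < m" using input_head_le[where P = P and \<omega> = \<omega> and t = t] Suc.prems c by simp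
  then have "sconfig_of (step P \<omega> ?c) = sstep P (pref \<omega> m) (sconfig_of ?c)"
    unfolding c by (auto simp: step_def sconfig_of_def nth_default_def split: option.split)
  with Suc show ?case by simp
qed simp

lemma machine_string_pref: "machine_string P (pref \<omega> m) = output_at P \<omega> m"
  using sconfig_of_steps[where t = m and m = m and P = P and \<omega> = \<omega>]
  by (simp add: machine_string_def output_at_def sconfig_of_def[of "(step P \<omega> ^^ m) init_config"] flip: sconfig_of_steps)

lemma output_at_mono: "m \<le> n \<Longrightarrow> prefix (output_at P \<omega> m) (output_at P \<omega> n)"
proof (induction rule: dec_induct)
  case (step k)
  have "prefix (written c) (written (Defs.step P \<omega> c))" for c
    by (auto simp: step_def split: prod.splits option.splits)
  with step show ?case unfolding output_at_def by (metis funpow.simps(2) comp_apply prefix_order.trans)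
qed simp

section \<open>Monotone string functions and the partial maps they induce\<close>

definition string_mono :: "(bool list \<Rightarrow> bool list) \<Rightarrow> bool" where
  "string_mono A \<longleftrightarrow> (\<forall>\<sigma> \<tau>. prefix \<sigma> \<tau> \<longrightarrow> prefix (A \<sigma>) (A \<tau>))"

lemma string_monoD: "string_mono A \<Longrightarrow> prefix \<sigma> \<tau> \<Longrightarrow> prefix (A \<sigma>) (A \<tau>)"
  by (simp add: string_mono_def)

lemma string_mono_funpow: "string_mono A \<Longrightarrow> string_mono (A ^^ k)"
  by (induction k) (auto simp: string_mono_def)

text \<open>Both strings are prefixes of \<tau> padded to a sequence, and the output on one sequence
  grows with time.\<close>

lemma string_mono_machine_string: "string_mono (machine_string P)"
  unfolding string_mono_def
proof (intro allI impI)
  fix \<sigma> \<tau> :: "bool list"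
  assume "prefix \<sigma> \<tau>"
  then have "length \<sigma> \<le> length \<tau>" "\<sigma> = pref (nth_default False \<tau>) (length \<sigma>)"
    using pref_padded[of \<tau>] prefix_pref_iff[of \<sigma> "nth_default False \<tau>" "length \<tau>"] by auto
  then show "prefix (machine_string P \<sigma>) (machine_string P \<tau>)"
    by (metis pref_padded machine_string_pref output_at_mono)
qed

text \<open>The graph of the partial continuous map induced by A. Unlike \<open>machine_map\<close>
  it also makes sense for the iterates of a string function.\<close>

definition realizes :: "(bool list \<Rightarrow> bool list) \<Rightarrow> cantor \<Rightarrow> cantor \<Rightarrow> bool" where
  "realizes A \<omega> \<eta> \<longleftrightarrow> (\<forall>m. A (pref \<omega> m) = pref \<eta> (length (A (pref \<omega> m)))) \<and>
     (\<forall>l. \<exists>m. l < length (A (pref \<omega> m)))"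

text \<open>The witness imitates the definition of \<open>machine_map\<close>, so that the two can
  be matched; by monotonicity its n-th bit is the same on every prefix whose output is long
  enough.\<close>

lemma realizes_exists:
  assumes A: "string_mono A" and unb: "\<And>l. \<exists>m. l < length (A (pref \<omega> m))"
  shows "realizes A \<omega> (\<lambda>n. A (pref \<omega> (LEAST m. n < length (A (pref \<omega> m)))) ! n)"
proof -
  have nth: "A (pref \<omega> m) ! n = A (pref \<omega> m') ! n"
    if "n < length (A (pref \<omega> m))" "n < length (A (pref \<omega> m'))" for m m' n
  proof -
    have "prefix (A (pref \<omega> m)) (A (pref \<omega> m')) \<or> prefix (A (pref \<omega> m')) (A (pref \<omega> m))"
      by (metis string_monoD[OF A] pref_mono nat_le_linear)
    then show ?thesis using that by (auto simp: prefix_def nth_append)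
  qed
  have "A (pref \<omega> m) ! n = A (pref \<omega> (LEAST m. n < length (A (pref \<omega> m)))) ! n"
    if "n < length (A (pref \<omega> m))" for m n
    by (rule nth[OF that LeastI[of "\<lambda>m. n < length (A (pref \<omega> m))", OF that]])
  then show ?thesis unfolding realizes_def using unb by (auto simp: list_eq_iff_nth_eq)
qed

lemma realizes_unique:
  assumes "realizes A \<omega> \<eta>" "realizes A \<omega> \<eta>'" shows "\<eta> = \<eta>'"
proof
  fix n
  obtain m where m: "n < length (A (pref \<omega> m))" using assms(1) unfolding realizes_def by blast
  have "pref \<eta> (length (A (pref \<omega> m))) = pref \<eta>' (length (A (pref \<omega> m)))"
    using assms unfolding realizes_def by metis
  then show "\<eta> n = \<eta>' n" using m by (metis nth_pref)
qed

lemma machine_map_iff: "machine_map P \<omega> = Some \<eta> \<longleftrightarrow> realizes (machine_string P) \<omega> \<eta>"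
proof -
  note ex = realizes_exists[OF string_mono_machine_string[of P], of \<omega>, unfolded machine_string_pref]
  show ?thesis
  proof
    assume "machine_map P \<omega> = Some \<eta>"
    then show "realizes (machine_string P) \<omega> \<eta>"
      using ex by (auto simp: machine_map_def split: if_splits)
  next
    assume r: "realizes (machine_string P) \<omega> \<eta>"
    then have unb: "\<forall>n. \<exists>t. n < length (output_at P \<omega> t)"
      unfolding realizes_def machine_string_pref by blast
    from realizes_unique[OF r ex] unb show "machine_map P \<omega> = Some \<eta>"
      by (simp add: machine_map_def)
  qed
qed

lemma realizes_comp:
  assumes B: "string_mono B" and A: "realizes A \<omega> \<eta>" and r: "realizes B \<eta> \<zeta>"
  shows "realizes (B \<circ> A) \<omega> \<zeta>"
  unfolding realizes_def comp_def
proof (intro conjI allI)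
  fix m
  have "A (pref \<omega> m) = pref \<eta> (length (A (pref \<omega> m)))" using A by (simp add: realizes_def)
  then show "B (A (pref \<omega> m)) = pref \<zeta> (length (B (A (pref \<omega> m))))"
    using r unfolding realizes_def by metis
next
  fix n
  obtain l where l: "n < length (B (pref \<eta> l))" using r by (auto simp: realizes_def)
  obtain m where m: "l < length (A (pref \<omega> m))" using A by (auto simp: realizes_def)
  have "prefix (pref \<eta> l) (A (pref \<omega> m))"
    using A m pref_mono by (metis realizes_def less_imp_le)
  from string_monoD[OF B this] l have "n < length (B (A (pref \<omega> m)))"
    using prefix_length_le by fastforce
  then show "\<exists>m. n < length (B (A (pref \<omega> m)))" ..
qed

lemma realizes_iterate:
  assumes M: "string_mono M" and T: "\<And>\<omega> \<eta>. T \<omega> = Some \<eta> \<longleftrightarrow> realizes M \<omega> \<eta>"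
  shows "iterate T k \<omega> = Some \<eta> \<Longrightarrow> realizes (M ^^ k) \<omega> \<eta>"
proof (induction k arbitrary: \<eta>)
  case (Suc k)
  then obtain \<xi> where "iterate T k \<omega> = Some \<xi>" "T \<xi> = Some \<eta>"
    by (auto simp: map_comp_Some_iff)
  with realizes_comp[OF M Suc.IH] T have "realizes (M \<circ> M ^^ k) \<omega> \<eta>" by blast
  then show ?case by (simp add: comp_def)
qed (auto simp: realizes_def)

lemma dom_iterate:
  assumes M: "string_mono M" and T: "\<And>\<omega> \<eta>. T \<omega> = Some \<eta> \<longleftrightarrow> realizes M \<omega> \<eta>"
    and unb: "\<And>k l. \<exists>m. l < length ((M ^^ k) (pref \<omega> m))"
  shows "\<omega> \<in> dom (iterate T k)"
proof (induction k)
  case (Suc k)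
  then obtain \<xi> where \<xi>: "iterate T k \<omega> = Some \<xi>" by blast
  from realizes_iterate[OF M T this] have r: "realizes (M ^^ k) \<omega> \<xi>" .
  \<comment> \<open>Each \<open>(M ^^ k) (pref \<omega> m)\<close> is a prefix of \<xi>, so long
    outputs of \<open>M ^^ Suc k\<close> on \<omega> are long outputs of M on \<xi>.\<close>
  have "\<exists>m. l < length (M (pref \<xi> m))" for l
    using unb[of l "Suc k"] r by (auto simp: realizes_def) metis
  from realizes_exists[OF M this] T have "T \<xi> \<noteq> None" by auto
  with \<xi> show ?case by auto
qed simp

definition up_closed :: "(bool list \<Rightarrow> bool) \<Rightarrow> bool" where
  "up_closed B \<longleftrightarrow> (\<forall>\<sigma> \<tau>. prefix \<sigma> \<tau> \<longrightarrow> B \<sigma> \<longrightarrow> B \<tau>)"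

definition open_of :: "(bool list \<Rightarrow> bool) \<Rightarrow> cantor set" where
  "open_of B = {\<omega>. \<exists>m. B (pref \<omega> m)}"

text \<open>Upward closure lets B wait for longer approximations of \<eta>, so membership of \<eta>
  can be recognised on a prefix of \<omega>.\<close>

lemma realizes_open_of:
  assumes B: "up_closed B" and r: "realizes A \<omega> \<eta>"
  shows "\<eta> \<in> open_of B \<longleftrightarrow> (\<exists>m. B (A (pref \<omega> m)))"
proof
  assume "\<eta> \<in> open_of B"
  then obtain l where l: "B (pref \<eta> l)" by (auto simp: open_of_def)
  obtain m where "l < length (A (pref \<omega> m))" using r by (auto simp: realizes_def)
  then have "prefix (pref \<eta> l) (A (pref \<omega> m))"
    using r pref_mono by (metis realizes_def less_imp_le)
  with B l show "\<exists>m. B (A (pref \<omega> m))" unfolding up_closed_def by blast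
qed (use r in \<open>auto simp: open_of_def realizes_def, metis\<close>)

section \<open>Martin-Loef tests\<close>

lemma cyl_in_borel: "cyl x \<in> sets borel"
proof -
  have "{\<omega> :: cantor. \<omega> i = b} \<in> sets borel" for i b
    using measurable_sets[OF measurable_product_coordinates[of i] , of "{b}"]
    by (simp add: vimage_def)
  then have "(\<Inter>i\<in>{..<length x}. {\<omega>. \<omega> i = x ! i}) \<in> sets borel \<or> length x = 0"
    by (cases "length x = 0") (auto intro!: sets.finite_INT)
  moreover have "cyl x = (\<Inter>i\<in>{..<length x}. {\<omega>. \<omega> i = x ! i})" by (auto simp: cyl_def)
  ultimately show ?thesis by (cases "length x = 0") simp_all
qed

lemma pref_set_eq: "{\<omega>. P (pref \<omega> m)} = (\<Union>x\<in>{x. length x = m \<and> P x}. cyl x)"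
  by (auto simp: mem_cyl_iff)

lemma finite_strings: "finite {x :: bool list. length x = m \<and> P x}"
  by (rule finite_subset[OF _ finite_lists_length_eq[of "UNIV :: bool set" m]]) auto

lemma pref_in_borel: "{\<omega>. P (pref \<omega> m)} \<in> sets borel"
  unfolding pref_set_eq using finite_strings cyl_in_borel by (intro sets.finite_UN) auto

lemma open_of_borel: "open_of B \<in> sets borel"
proof -
  have "open_of B = (\<Union>m. {\<omega>. B (pref \<omega> m)})" by (auto simp: open_of_def)
  then show ?thesis using pref_in_borel by auto
qed

lemma open_of_eq_cyl: "open_of B = (\<Union>x\<in>{x. B x}. cyl x)"
  by (auto simp: open_of_def mem_cyl_iff) metis+

lemma comp_enumerable_decidable:
  fixes Q :: "nat \<Rightarrow> bool list \<Rightarrow> bool"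
  assumes Q: "cmp (\<lambda>z. Q (fst z) (snd z))"
  shows "comp_enumerable {prod_encode (c, str_code x) |c x. Q c x}"
proof (cases "\<exists>c x. Q c x")
  case True
  then obtain c0 x0 where 0: "Q c0 x0" by blast
  \<comment> \<open>Every number is read as a pair, with nonzero list entries standing for
    \<open>True\<close>; decoding is thus total and inverts \<open>code\<close>.\<close>
  define D :: "nat \<Rightarrow> nat \<times> bool list"
    where "D n = (fst (prod_decode n), map ((<) 0) (list_decode (snd (prod_decode n))))" for n
  have D: "cmp D" unfolding D_def by (intro cmp_intros)
  have DI: "D (code z) = z" for z
  proof -
    have "list_decode (code x) = map of_bool x" for x :: "bool list"
      by (simp add: code_list_def code_bool_def[abs_def])
    then have "map ((<) 0) (list_decode (code x)) = x" for x :: "bool list"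
      by (simp add: map_idI)
    then show ?thesis by (simp add: D_def code_prod_def)
  qed
  \<comment> \<open>An enumeration is the range of a total function, so numbers whose pair fails Q
    are sent to a fixed member.\<close>
  define f where "f n = (if Q (fst (D n)) (snd (D n)) then code (D n) else code (c0, x0))" for n
  have "cmp f" unfolding f_def
    by (intro cmp_if cmp_comp[OF Q] cmp_code cmp_comp[OF D] cmp_intros D)
  moreover have "{prod_encode (c, str_code x) |c x. Q c x} = range f"
  proof
    show "{prod_encode (c, str_code x) |c x. Q c x} \<subseteq> range f"
    proof clarify
      fix c x assume "Q c x"
      then have "f (code (c, x)) = prod_encode (c, str_code x)"
        unfolding f_def DI by (simp add: str_code_eq)
      then show "prod_encode (c, str_code x) \<in> range f" by (metis rangeI)
    qed
    show "range f \<subseteq> {prod_encode (c, str_code x) |c x. Q c x}"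
      using 0 by (auto simp: f_def code_prod_def str_code_eq)
  qed
  ultimately show ?thesis unfolding comp_enumerable_def cmp_nat_iff by blast
qed (auto simp: comp_enumerable_def)

text \<open>\<open>int_decode\<close> sends even numbers to the nonnegative integers, so this is the
  numerator of the positive part of a coded rational.\<close>

definition pos_num :: "nat \<Rightarrow> nat" where
  "pos_num a = (if even a then a div 2 else 0)"

lemma pos_num: "int (pos_num a) = max 0 (int_decode a)"
  by (auto simp: pos_num_def int_decode_def sum_decode_def)

lemma cmp_pos_num: "cmp f \<Longrightarrow> cmp (\<lambda>x. pos_num (f x))"
  unfolding pos_num_def by (intro cmp_intros | assumption)+

lemma rat_of_code_max: "max 0 (rat_of_code c)
    = of_nat (pos_num (fst (prod_decode c))) / of_nat (Suc (snd (prod_decode c)))"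
proof -
  have "of_nat (pos_num a) = (max 0 (of_int (int_decode a)) :: rat)" for a
    using arg_cong[OF pos_num[of a], of "of_int :: int \<Rightarrow> rat"] by (simp add: of_int_max)
  then show ?thesis
    by (auto simp: rat_of_code_def max_def field_simps split: prod.splits simp del: of_nat_Suc)
qed

text \<open>Effective null sets are tested by rationals, the tests here by levels. The least level i
  with 2^-i \<le> q is computable from any code of q and depends on q alone, as it must, because
  \<open>uniformly_effectively_open\<close> indexes its sets by rationals and not by codes.\<close>

lemma ml_test:
  fixes A :: "nat \<Rightarrow> bool list \<Rightarrow> bool"
  assumes A: "cmp (\<lambda>z. A (fst z) (snd z))"
    and small: "\<And>j. emeasure \<mu> (open_of (A j)) \<le> ennreal (1 / 2 ^ j)"
    and random: "martin_lof_random \<mu> \<omega>"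
  shows "\<exists>j. \<omega> \<notin> open_of (A j)"
proof (rule ccontr)
  assume "\<not> ?thesis"
  then have all: "\<omega> \<in> open_of (A j)" for j by blast
  \<comment> \<open>For q \<le> 0, where no bound is demanded, the level is 0; this keeps the search
    total.\<close>
  define i where "i q = (LEAST i. q \<le> 0 \<or> 1 / 2 ^ i \<le> q)" for q :: rat
  define S where "S q = {x. A (i q) x}" for q
  define lev where "lev c = (LEAST i. pos_num (fst (prod_decode c)) = 0 \<or>
    Suc (snd (prod_decode c)) \<le> pos_num (fst (prod_decode c)) * 2 ^ i)" for c
  have ex: "\<exists>i. q \<le> 0 \<or> 1 / 2 ^ i \<le> q" for q :: rat
  proof (cases "q > 0")
    case True
    then obtain n where "1 / q < of_nat n" using reals_Archimedean2 by blast
    moreover have "of_nat n < (2::rat) ^ n" by (metis of_nat_less_numeral_power_cancel_iff less_exp)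
    ultimately have "1 / q \<le> 2 ^ n" by linarith
    with True have "1 / 2 ^ n \<le> q" by (simp add: field_simps)
    then show ?thesis by blast
  qed auto
  have lev_iff: "(pos_num (fst (prod_decode c)) = 0 \<or>
      Suc (snd (prod_decode c)) \<le> pos_num (fst (prod_decode c)) * 2 ^ i)
      \<longleftrightarrow> (rat_of_code c \<le> 0 \<or> 1 / 2 ^ i \<le> rat_of_code c)" for c i
  proof -
    let ?a = "pos_num (fst (prod_decode c))" and ?b = "Suc (snd (prod_decode c))"
    have "(rat_of_code c \<le> 0) = (max 0 (rat_of_code c) = 0)" by auto
    also have "\<dots> = (?a = 0)" unfolding rat_of_code_max by simp
    finally have 1: "(rat_of_code c \<le> 0) = (?a = 0)" .
    have "(1 / 2 ^ i \<le> rat_of_code c) = (1 / 2 ^ i \<le> max 0 (rat_of_code c))"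
      by (simp add: le_max_iff_disj not_le flip: linorder_not_less)
    also have "\<dots> = (of_nat ?b \<le> (of_nat (?a * 2 ^ i) :: rat))"
      unfolding rat_of_code_max by (simp add: field_simps del: of_nat_Suc)
    finally have "(1 / 2 ^ i \<le> rat_of_code c) = (?b \<le> ?a * 2 ^ i)" by (simp only: of_nat_le_iff)
    with 1 show ?thesis by blast
  qed
  have lev: "lev c = i (rat_of_code c)" for c
    unfolding lev_def i_def lev_iff ..
  have cl: "cmp lev"
    unfolding lev_def
  proof (rule cmp_Least)
    show "cmp (\<lambda>z. pos_num (fst (prod_decode (fst z))) = 0 \<or>
      Suc (snd (prod_decode (fst z))) \<le> pos_num (fst (prod_decode (fst z))) * 2 ^ snd z)"
      by (intro cmp_intros cmp_pos_num)
  qed (use ex lev_iff in blast)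
  have "cmp (\<lambda>z. A (lev (fst z)) (snd z))"
    by (intro cmp_comp2[of A, OF A] cmp_intros cmp_comp[OF cl])
  from comp_enumerable_decidable[of "\<lambda>c. A (lev c)", OF this]
  have "comp_enumerable {prod_encode (c, str_code x) |c x. x \<in> S (rat_of_code c)}"
    by (simp add: S_def lev)
  then have "uniformly_effectively_open (\<lambda>q. \<Union>x\<in>S q. cyl x)"
    unfolding uniformly_effectively_open_def by blast
  moreover have "{\<omega>} \<subseteq> (\<Union>x\<in>S q. cyl x) \<and> emeasure \<mu> (\<Union>x\<in>S q. cyl x) \<le> ennreal (of_rat q)"
    if "q > 0" for q
  proof -
    have U: "(\<Union>x\<in>S q. cyl x) = open_of (A (i q))" by (simp add: open_of_eq_cyl S_def)
    have "1 / 2 ^ i q \<le> q"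
      using LeastI_ex[OF ex[of q]] that unfolding i_def by linarith
    then have "of_rat (1 / 2 ^ i q) \<le> (of_rat q :: real)" by (simp only: of_rat_less_eq)
    then have "ennreal (1 / 2 ^ i q) \<le> ennreal (of_rat q)"
      by (intro ennreal_leI) (simp add: of_rat_divide of_rat_power)
    then show ?thesis unfolding U using all small[of "i q"] by auto
  qed
  ultimately have "effectively_null \<mu> {\<omega>}" unfolding effectively_null_def by blast
  with random show False unfolding martin_lof_random_def by blast
qed

lemma ml_test_geometric:
  fixes A :: "nat \<Rightarrow> bool list \<Rightarrow> bool" and C r :: real
  assumes A: "cmp (\<lambda>z. A (fst z) (snd z))"
    and small: "\<And>j. emeasure \<mu> (open_of (A j)) \<le> ennreal (C * r ^ j)" and r: "0 \<le> r" "r < 1"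
    and random: "martin_lof_random \<mu> \<omega>"
  shows "\<exists>j. \<omega> \<notin> open_of (A j)"
proof -
  \<comment> \<open>Every k levels gain a factor 1/2, and starting l blocks later absorbs the
    constant C < 2^l.\<close>
  obtain k where k: "r ^ k < 1 / 2" using real_arch_pow_inv[of "1/2" r] r by auto
  obtain l where l: "C < 2 ^ l" using real_arch_pow[of 2 C] by auto
  have bound: "C * r ^ (k * (j + l)) \<le> 1 / 2 ^ j" for j
  proof -
    have "r ^ (k * (j + l)) \<le> (1 / 2) ^ (j + l)"
      using k r by (simp add: power_mult power_mono)
    then have "C * r ^ (k * (j + l)) \<le> 2 ^ l * (1 / 2) ^ (j + l)"
      using l r by (intro mult_mono) auto
    then show ?thesis by (simp add: power_add power_divide)
  qed
  have "\<exists>j. \<omega> \<notin> open_of (A (k * (j + l)))"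
  proof (rule ml_test[OF _ _ random])
    show "cmp (\<lambda>z. A (k * (fst z + l)) (snd z))"
      by (intro cmp_comp2[of A, OF A] cmp_intros)
    show "emeasure \<mu> (open_of (A (k * (j + l)))) \<le> ennreal (1 / 2 ^ j)" for j
      using small[of "k * (j + l)"] ennreal_leI[OF bound[of j]] by (rule order_trans)
  qed
  then show ?thesis by blast
qed

section \<open>Effective search for clopen sets of small measure\<close>

locale cantor_prob = prob_space \<mu> for \<mu> :: "cantor measure" +
  assumes sets_eq: "sets \<mu> = sets borel"
begin

lemma space_eq [simp]: "space \<mu> = UNIV"
  using sets_eq_imp_space_eq[OF sets_eq] by simp

lemma cyl_sets [measurable, simp]: "cyl x \<in> sets \<mu>"
  by (simp add: sets_eq cyl_in_borel)

lemma pref_sets [measurable, simp]: "{\<omega>. P (pref \<omega> m)} \<in> sets \<mu>"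
  by (simp add: sets_eq pref_in_borel)

lemma open_of_sets [measurable, simp]: "open_of B \<in> sets \<mu>"
  by (simp add: sets_eq open_of_borel)

lemma measure_pref: "measure \<mu> {\<omega>. P (pref \<omega> m)} = (\<Sum>x | length x = m \<and> P x. measure \<mu> (cyl x))"
  unfolding pref_set_eq
proof (rule finite_measure_finite_Union)
  show "disjoint_family_on cyl {x. length x = m \<and> P x}"
    by (auto simp: disjoint_family_on_def mem_cyl_iff)
qed (auto simp: finite_strings)

end

primrec strings :: "nat \<Rightarrow> bool list list" where
  "strings 0 = [[]]"
| "strings (Suc n) = map ((#) True) (strings n) @ map ((#) False) (strings n)"

lemma set_strings: "set (strings n) = {x. length x = n}"
proof (induction n)
  case (Suc n)
  have "{x. length x = Suc n} = (#) True ` {x. length x = n} \<union> (#) False ` {x. length x = n}"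
    by (auto simp: length_Suc_conv image_iff)
  with Suc show ?case by simp
qed auto

lemma distinct_strings: "distinct (strings n)"
  by (induction n) (auto simp: distinct_map)

lemma length_strings: "length (strings n) = 2 ^ n"
  by (induction n) auto

lemma cmp_strings: "cmp n \<Longrightarrow> cmp (\<lambda>x. strings (n x))"
proof -
  assume n: "cmp n"
  have "cmp (\<lambda>x. rec_nat [[]] (\<lambda>_ ys. map ((#) True) ys @ map ((#) False) ys) (n x))"
    by (intro cmp_intros n)
  moreover have "rec_nat [[]] (\<lambda>_ ys. map ((#) True) ys @ map ((#) False) ys) k = strings k" for k
    by (induction k) auto
  ultimately show ?thesis by simp
qed

locale computable_cantor_prob = cantor_prob +
  assumes computable: "computable_measure \<mu>"
begin

text \<open>Integer weights avoid rational arithmetic. Of the error 2, one half comes from the given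
  approximation and the other from rounding down.\<close>

lemma measure_approx:
  obtains w :: "bool list \<Rightarrow> nat \<Rightarrow> nat" where "cmp (\<lambda>z. w (fst z) (snd z))"
    and "\<And>x n. \<bar>measure \<mu> (cyl x) * 2 ^ n - real (w x n)\<bar> \<le> 2"
proof -
  obtain g where g: "computable2 g"
    and gm: "\<And>x n. \<bar>measure \<mu> (cyl x) - of_rat (rat_of_code (g (str_code x) n))\<bar> \<le> 1 / 2 ^ n"
    using computable unfolding computable_measure_def by blast
  define w where "w x n = (pos_num (fst (prod_decode (g (str_code x) n))) * 2 ^ n)
    div Suc (snd (prod_decode (g (str_code x) n)))" for x n
  have "cmp (\<lambda>z. w (fst z) (snd z))"
    unfolding w_def str_code_eq
    by (intro cmp_intros cmp_pos_num cmp_comp2[of g, OF cmp_computable2[OF g]] cmp_code)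
  moreover have "\<bar>measure \<mu> (cyl x) * 2 ^ n - real (w x n)\<bar> \<le> 2" for x n
  proof -
    let ?c = "g (str_code x) n"
    let ?q = "of_rat (rat_of_code ?c) :: real"
    let ?r = "real (pos_num (fst (prod_decode ?c))) / real (Suc (snd (prod_decode ?c)))"
    have "of_rat (max 0 (rat_of_code ?c)) = max 0 ?q"
      by (simp add: max_def)
    then have r: "?r = max 0 ?q"
      unfolding rat_of_code_max by (simp add: of_rat_divide del: of_nat_Suc)
    have "\<bar>measure \<mu> (cyl x) - max 0 ?q\<bar> \<le> \<bar>measure \<mu> (cyl x) - ?q\<bar>"
    proof -
      have "\<bar>a - max 0 b\<bar> \<le> \<bar>a - b\<bar>" if "0 \<le> a" for a b :: real using that by (auto simp: max_def)
      then show ?thesis by simp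
    qed
    also note gm[of x n]
    finally have "\<bar>measure \<mu> (cyl x) - ?r\<bar> * 2 ^ n \<le> 1 / 2 ^ n * 2 ^ n"
      unfolding r by (intro mult_right_mono) auto
    moreover have "\<bar>a * 2 ^ n - b * 2 ^ n\<bar> = \<bar>a - b\<bar> * 2 ^ n" for a b :: real
      by (simp add: abs_mult flip: left_diff_distrib)
    ultimately have 1: "\<bar>measure \<mu> (cyl x) * 2 ^ n - ?r * 2 ^ n\<bar> \<le> 1" by (simp only:) simp
    have "real (w x n) = real_of_int \<lfloor>?r * 2 ^ n\<rfloor>"
      unfolding w_def
      using floor_divide_of_nat_eq[of "pos_num (fst (prod_decode ?c)) * 2 ^ n" "Suc (snd (prod_decode ?c))", where 'a = real]
      by (simp add: mult.commute del: of_nat_Suc)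
    then have "\<bar>?r * 2 ^ n - real (w x n)\<bar> \<le> 1" by linarith
    with 1 show ?thesis by linarith
  qed
  ultimately show ?thesis by (rule that)
qed

text \<open>The candidate y is also the prefix length, so the bad event is clopen and its measure
  computable; further search parameters can be coded into y. The factor 4 in \<open>ex\<close> pays
  for the approximation. On the scale 2^(y+p+4) the weights of the 2^y strings err by at most
  2^(y+1) altogether. A candidate as in \<open>ex\<close> passes the test because 2^(y+2) + 2^(y+1)
  \<le> 2^(y+3), and passing certifies 2^(y+3) + 2^(y+1) \<le> 2^(y+4), that is, measure at most
  2^-p.\<close>

lemma search_small:
  fixes Bad :: "nat \<Rightarrow> nat \<Rightarrow> bool list \<Rightarrow> bool"
  assumes Bad: "cmp (\<lambda>z. Bad (fst z) (fst (snd z)) (snd (snd z)))"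
    and ex: "\<And>p. \<exists>y. measure \<mu> {\<omega>. Bad p y (pref \<omega> y)} < 1 / 2 ^ (p + 2)"
  obtains h where "cmp h" "\<And>p. measure \<mu> {\<omega>. Bad p (h p) (pref \<omega> (h p))} \<le> 1 / 2 ^ p"
proof -
  obtain w where w: "cmp (\<lambda>z. w (fst z) (snd z))"
    and wm: "\<And>x n. \<bar>measure \<mu> (cyl x) * 2 ^ n - real (w x n)\<bar> \<le> 2"
    using measure_approx by blast
  define s where "s p y = sum_list (map (\<lambda>x. if Bad p y x then w x (y + p + 4) else 0) (strings y))" for p y
  have close: "\<bar>measure \<mu> {\<omega>. Bad p y (pref \<omega> y)} * 2 ^ (y + p + 4) - real (s p y)\<bar> \<le> 2 ^ (y + 1)" for p y
  proof -
    have "s p y = (\<Sum>x | length x = y. if Bad p y x then w x (y + p + 4) else 0)"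
      unfolding s_def using distinct_strings set_strings by (simp add: sum_list_distinct_conv_sum_set)
    also have "\<dots> = (\<Sum>x | length x = y \<and> Bad p y x. w x (y + p + 4))"
      using finite_strings[of y "\<lambda>_. True"] by (simp add: sum.If_cases Collect_conj_eq[symmetric] Int_def)
    finally have "measure \<mu> {\<omega>. Bad p y (pref \<omega> y)} * 2 ^ (y + p + 4) - real (s p y) =
      (\<Sum>x | length x = y \<and> Bad p y x. measure \<mu> (cyl x) * 2 ^ (y + p + 4) - real (w x (y + p + 4)))"
      unfolding measure_pref by (simp only: sum_subtractf sum_distrib_right of_nat_sum)
    also have "\<bar>\<dots>\<bar> \<le> (\<Sum>x | length x = y \<and> Bad p y x. 2)"
      by (rule order_trans[OF sum_abs sum_mono]) (rule wm)
    also have "\<dots> \<le> (\<Sum>x :: bool list | length x = y. 2)"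
      using finite_strings[of y "\<lambda>_. True"] by (intro sum_mono2) auto
    also have "\<dots> = 2 * real (card (set (strings y)))" by (simp add: set_strings)
    also have "\<dots> = 2 ^ (y + 1)"
      by (simp add: distinct_card[OF distinct_strings] length_strings)
    finally show ?thesis .
  qed
  define h where "h p = (LEAST y. s p y \<le> 2 ^ (y + 3))" for p
  have ex': "\<exists>y. s p y \<le> 2 ^ (y + 3)" for p
  proof -
    obtain y where "measure \<mu> {\<omega>. Bad p y (pref \<omega> y)} < 1 / 2 ^ (p + 2)" using ex by blast
    then have "measure \<mu> {\<omega>. Bad p y (pref \<omega> y)} * 2 ^ (y + p + 4) \<le> 1 / 2 ^ (p + 2) * 2 ^ (y + p + 4)"
      by (intro mult_right_mono) auto
    also have "\<dots> = 2 ^ (y + 2)" by (simp add: power_add field_simps)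
    finally have "real (s p y) \<le> 2 ^ (y + 2) + 2 ^ (y + 1)" using close[of p y] by linarith
    also have "\<dots> \<le> 2 ^ (y + 3)" by (simp add: power_add)
    finally have "s p y \<le> 2 ^ (y + 3)" by (metis of_nat_le_numeral_power_cancel_iff)
    then show ?thesis ..
  qed
  have "cmp h"
    unfolding h_def
  proof (rule cmp_Least)
    show "cmp (\<lambda>z. s (fst z) (snd z) \<le> 2 ^ (snd z + 3))"
      unfolding s_def by (intro cmp_intros cmp_strings cmp_comp3[of Bad, OF Bad] cmp_comp2[of w, OF w])
  qed (rule ex')
  moreover have "measure \<mu> {\<omega>. Bad p (h p) (pref \<omega> (h p))} \<le> 1 / 2 ^ p" for p
  proof -
    have "s p (h p) \<le> 2 ^ (h p + 3)" unfolding h_def using ex' by (rule LeastI_ex)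
    then have "real (s p (h p)) \<le> 2 ^ (h p + 3)" by (metis of_nat_le_numeral_power_cancel_iff)
    then have "measure \<mu> {\<omega>. Bad p (h p) (pref \<omega> (h p))} * 2 ^ (h p + p + 4) \<le> 2 ^ (h p + 3) + 2 ^ (h p + 1)"
      using close[of p "h p"] by linarith
    also have "\<dots> \<le> 2 ^ (h p + 4)" by (simp add: power_add)
    finally show ?thesis by (simp add: power_add field_simps)
  qed
  ultimately show ?thesis by (rule that)
qed

end

section \<open>One-sided pointwise ergodic theorem\<close>

lemma (in prob_space) decseq_small_prob:
  assumes B: "\<And>m. B m \<in> events" "decseq B" and AE: "AE \<omega> in M. \<exists>m. \<omega> \<notin> B m" and e: "e > 0"
  shows "\<exists>m :: nat. prob (B m) < e"
proof -
  have "(\<lambda>m. prob (B m)) \<longlonglongrightarrow> prob (\<Inter>m. B m)"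
    using B by (intro finite_Lim_measure_decseq) auto
  moreover have "prob (\<Inter>m. B m) = 0"
    using B(1) AE by (subst prob_eq_0) auto
  ultimately have "\<forall>\<^sub>F m in sequentially. prob (B m) < e" using e by (auto dest: order_tendstoD(2))
  then show ?thesis by (auto simp: eventually_sequentially)
qed

text \<open>Ergodicity is formulated for exactly invariant sets, because the exceptional set of
  \<open>max_sum_bounded\<close> is one.\<close>

locale ergodic_pmp = prob_space M for M :: "'a measure" +
  fixes S :: "'a \<Rightarrow> 'a"
  assumes S [measurable]: "S \<in> measurable M M"
    and distr_S: "distr M M S = M"
    and ergodic: "\<And>B. B \<in> sets M \<Longrightarrow> S -` B \<inter> space M = B \<Longrightarrow> prob B = 0 \<or> prob B = 1"
begin

lemma S_funpow [measurable]: "S ^^ k \<in> measurable M M"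
proof (induction k)
  case (Suc k)
  from measurable_comp[OF this S] show ?case by simp
qed (simp add: id_def)

lemma distr_funpow: "distr M M (S ^^ k) = M"
proof (induction k)
  case 0
  show ?case using distr_id[of M] by (simp add: id_def)
next
  case (Suc k)
  have "distr M M (S ^^ Suc k) = distr (distr M M (S ^^ k)) M S"
    by (subst distr_distr) (auto simp: comp_def)
  with Suc show ?case by (simp add: distr_S comp_def)
qed

lemma integral_funpow:
  fixes g :: "'a \<Rightarrow> real"
  assumes [measurable]: "g \<in> borel_measurable M"
  shows "(\<integral>\<omega>. g ((S ^^ k) \<omega>) \<partial>M) = (\<integral>\<omega>. g \<omega> \<partial>M)"
proof -
  have "(\<integral>\<omega>. g ((S ^^ k) \<omega>) \<partial>M) = (\<integral>\<omega>. g \<omega> \<partial>distr M M (S ^^ k))"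
    by (rule integral_distr[symmetric]) measurable
  then show ?thesis by (simp add: distr_funpow)
qed

lemma integrable_funpow:
  fixes g :: "'a \<Rightarrow> real"
  assumes g: "integrable M g"
  shows "integrable M (\<lambda>\<omega>. g ((S ^^ k) \<omega>))"
  using g by (intro integrable_distr[of "S ^^ k" M M]) (auto simp: distr_funpow)

lemma nn_integral_funpow:
  assumes [measurable]: "g \<in> borel_measurable M"
  shows "(\<integral>\<^sup>+\<omega>. g ((S ^^ k) \<omega>) \<partial>M) = (\<integral>\<^sup>+\<omega>. g \<omega> \<partial>M)"
proof -
  have "(\<integral>\<^sup>+\<omega>. g ((S ^^ k) \<omega>) \<partial>M) = (\<integral>\<^sup>+\<omega>. g \<omega> \<partial>distr M M (S ^^ k))"
    by (rule nn_integral_distr[symmetric]) measurable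
  then show ?thesis by (simp add: distr_funpow)
qed

lemma AE_funpow:
  assumes "AE \<omega> in M. P \<omega>" shows "AE \<omega> in M. P ((S ^^ k) \<omega>)"
proof (rule AE_distrD[OF S_funpow])
  show "AE \<omega> in distr M M (S ^^ k). P \<omega>" unfolding distr_funpow by (rule assms)
qed

lemma AE_all_funpow:
  assumes "AE \<omega> in M. P \<omega>" shows "AE \<omega> in M. \<forall>k. P ((S ^^ k) \<omega>)"
  unfolding AE_all_countable using AE_funpow[OF assms] by blast

text \<open>The maximum of the sums of at most n terms of g along the orbit, the empty sum included.
  The recursion through \<open>S \<omega>\<close> is the identity that
  \<open>max_sum_bounded\<close> integrates.\<close>

fun max_sum :: "('a \<Rightarrow> real) \<Rightarrow> nat \<Rightarrow> 'a \<Rightarrow> real" where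
  "max_sum g 0 \<omega> = 0"
| "max_sum g (Suc n) \<omega> = max 0 (g \<omega> + max_sum g n (S \<omega>))"

lemma max_sum_nonneg: "0 \<le> max_sum g n \<omega>"
  by (cases n) auto

lemma max_sum_mono: "m \<le> n \<Longrightarrow> max_sum g m \<omega> \<le> max_sum g n \<omega>"
proof -
  have "max_sum g n \<omega> \<le> max_sum g (Suc n) \<omega>" for n
  proof (induction n arbitrary: \<omega>)
    case (Suc n)
    have "max_sum g n (S \<omega>) \<le> max_sum g (Suc n) (S \<omega>)" by (rule Suc)
    then show ?case by (subst (1 2) max_sum.simps(2)) linarith
  qed simp
  then show "m \<le> n \<Longrightarrow> ?thesis" by (rule lift_Suc_mono_le)
qed

lemma sum_le_max_sum: "(\<Sum>k<n. g ((S ^^ k) \<omega>)) \<le> max_sum g n \<omega>"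
proof (induction n arbitrary: \<omega>)
  case (Suc n)
  have "(\<Sum>k<Suc n. g ((S ^^ k) \<omega>)) = g \<omega> + (\<Sum>k<n. g ((S ^^ k) (S \<omega>)))"
    by (simp only: sum.lessThan_Suc_shift) (simp add: funpow_swap1)
  with Suc[of "S \<omega>"] show ?case by simp
qed simp

lemma max_sum_integrable: "integrable M g \<Longrightarrow> integrable M (max_sum g n)"
proof (induction n)
  case (Suc n)
  have "integrable M (\<lambda>\<omega>. max_sum g n (S \<omega>))" using integrable_funpow[OF Suc.IH[OF Suc.prems], of 1] by simp
  with Suc.prems show ?case by (auto simp: max_sum.simps(2)[abs_def])
qed (auto simp: max_sum.simps(1)[abs_def])

text \<open>If the partial sums were almost surely unbounded, then
  \<open>max_sum g (n+1) - max_sum g n \<circ> S = max (- max_sum g n \<circ> S) g\<close> would decrease to \<open>g\<close>,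
  while its integral is nonnegative because \<open>S\<close> preserves the measure.\<close>

lemma max_sum_bounded:
  assumes g: "integrable M g" and neg: "(\<integral>\<omega>. g \<omega> \<partial>M) < 0"
  shows "AE \<omega> in M. \<exists>c::nat. \<forall>n. max_sum g n \<omega> \<le> c"
proof -
  have [measurable]: "max_sum g n \<in> borel_measurable M" "g \<in> borel_measurable M" for n
    using max_sum_integrable[OF g] g by auto
  define E where "E = {\<omega> \<in> space M. \<forall>c::nat. \<exists>n. real c < max_sum g n \<omega>}"
  have E [measurable]: "E \<in> sets M" unfolding E_def by measurable
  \<comment> \<open>By the recursion a positive maximum at \<omega> exceeds the one at
    \<open>S \<omega>\<close>, with one index less, by exactly \<open>g \<omega>\<close>; so
    unboundedness passes in both directions.\<close>
  have inv: "S -` E \<inter> space M = E"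
  proof (intro set_eqI iffI)
    fix \<omega> assume \<omega>: "\<omega> \<in> S -` E \<inter> space M"
    have "\<exists>n. real c < max_sum g n \<omega>" for c :: nat
    proof -
      obtain n where "real (nat \<lceil>real c - g \<omega>\<rceil>) < max_sum g n (S \<omega>)" using \<omega> unfolding E_def by blast
      then have "real c < max_sum g (Suc n) \<omega>" by simp linarith
      then show ?thesis ..
    qed
    with \<omega> show "\<omega> \<in> E" unfolding E_def by blast
  next
    fix \<omega> assume \<omega>: "\<omega> \<in> E"
    then have sp: "\<omega> \<in> space M" "S \<omega> \<in> space M" using measurable_space[OF S] by (auto simp: E_def)
    have "\<exists>n. real c < max_sum g n (S \<omega>)" for c :: nat
    proof -
      obtain n where n: "real (nat \<lceil>max 0 (real c + g \<omega>)\<rceil>) < max_sum g n \<omega>" using \<omega> unfolding E_def by blast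
      then obtain k where "n = Suc k" by (cases n) auto
      with n have "real c < max_sum g k (S \<omega>)" by simp linarith
      then show ?thesis ..
    qed
    with sp show "\<omega> \<in> S -` E \<inter> space M" unfolding E_def by blast
  qed
  have "prob E \<noteq> 1"
  proof
    assume "prob E = 1"
    then have AE: "AE \<omega> in M. S \<omega> \<in> E"
      using AE_funpow[of "\<lambda>\<omega>. \<omega> \<in> E" 1] prob_eq_1[OF E] by simp
    define d where "d n \<omega> = max_sum g (Suc n) \<omega> - max_sum g n (S \<omega>)" for n \<omega>
    have d: "d n \<omega> = max (- max_sum g n (S \<omega>)) (g \<omega>)" for n \<omega> by (auto simp: d_def)
    have "(\<lambda>n. \<integral>\<omega>. d n \<omega> \<partial>M) \<longlonglongrightarrow> (\<integral>\<omega>. g \<omega> \<partial>M)"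
    proof (rule integral_dominated_convergence)
      show "integrable M (\<lambda>\<omega>. \<bar>g \<omega>\<bar>)" using g by simp
      have "\<bar>max (- a) b\<bar> \<le> \<bar>b\<bar>" if "0 \<le> a" for a b :: real using that by linarith
      then show "AE \<omega> in M. norm (d n \<omega>) \<le> \<bar>g \<omega>\<bar>" for n
        unfolding d real_norm_def using max_sum_nonneg by (intro AE_I2) blast
      show "AE \<omega> in M. (\<lambda>n. d n \<omega>) \<longlonglongrightarrow> g \<omega>"
        using AE
      proof eventually_elim
        case (elim \<omega>)
        then obtain N where N: "real (nat \<lceil>- g \<omega>\<rceil>) < max_sum g N (S \<omega>)" unfolding E_def by blast
        have "d n \<omega> = g \<omega>" if "n \<ge> N" for n
          using max_sum_mono[OF that, of g "S \<omega>"] N unfolding d by linarith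
        then show ?case by (intro tendsto_eventually eventually_sequentiallyI[of N])
      qed
    qed (auto simp: d_def)
    moreover have "0 \<le> (\<integral>\<omega>. d n \<omega> \<partial>M)" for n
    proof -
      have i: "integrable M (\<lambda>\<omega>. max_sum g n (S \<omega>))"
        using integrable_funpow[OF max_sum_integrable[OF g], of n 1] by simp
      have "(\<integral>\<omega>. d n \<omega> \<partial>M) = (\<integral>\<omega>. max_sum g (Suc n) \<omega> \<partial>M) - (\<integral>\<omega>. max_sum g n (S \<omega>) \<partial>M)"
        unfolding d_def by (rule Bochner_Integration.integral_diff[OF max_sum_integrable[OF g] i])
      moreover have "(\<integral>\<omega>. max_sum g n (S \<omega>) \<partial>M) = (\<integral>\<omega>. max_sum g n \<omega> \<partial>M)"
        using integral_funpow[of "max_sum g n" 1] by simp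
      moreover have "(\<integral>\<omega>. max_sum g n \<omega> \<partial>M) \<le> (\<integral>\<omega>. max_sum g (Suc n) \<omega> \<partial>M)"
        by (intro integral_mono max_sum_integrable g max_sum_mono) simp
      ultimately show ?thesis by linarith
    qed
    ultimately have "0 \<le> (\<integral>\<omega>. g \<omega> \<partial>M)" by (intro LIMSEQ_le_const) auto
    with neg show False by simp
  qed
  with ergodic[OF E inv] have "prob E = 0" by blast
  then have "AE \<omega> in M. \<omega> \<notin> E" using prob_eq_0[OF E] by simp
  then show ?thesis
    using AE_space by eventually_elim (auto simp: E_def not_less)
qed

text \<open>For an intermediate value s the function h - s has negative integral, so its partial
  sums are bounded above almost surely; the bound is eventually below n (r - s).\<close>

lemma birkhoff_upper:
  assumes h: "integrable M h" and r: "(\<integral>\<omega>. h \<omega> \<partial>M) < r"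
  shows "AE \<omega> in M. \<exists>N. \<forall>n\<ge>N. (\<Sum>k<n. h ((S ^^ k) \<omega>)) \<le> real n * r"
proof -
  obtain s where s: "(\<integral>\<omega>. h \<omega> \<partial>M) < s" "s < r" using dense[OF r] by blast
  have "AE \<omega> in M. \<exists>c::nat. \<forall>n. max_sum (\<lambda>\<omega>. h \<omega> - s) n \<omega> \<le> c"
    by (rule max_sum_bounded) (use h s in \<open>auto simp: prob_space\<close>)
  then show ?thesis
  proof eventually_elim
    case (elim \<omega>)
    then obtain c :: nat where c: "max_sum (\<lambda>\<omega>. h \<omega> - s) n \<omega> \<le> c" for n by blast
    have "(\<Sum>k<n. h ((S ^^ k) \<omega>)) \<le> real n * r" if "n \<ge> nat \<lceil>c / (r - s)\<rceil>" for n
    proof -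
      have "c / (r - s) \<le> n" using that by linarith
      then have "c \<le> n * (r - s)" using s by (simp add: field_simps)
      moreover have "(\<Sum>k<n. h ((S ^^ k) \<omega>)) - n * s \<le> c"
        using order_trans[OF sum_le_max_sum c[of n]] by (simp add: sum_subtractf)
      ultimately show ?thesis by (simp add: algebra_simps)
    qed
    then show ?case by blast
  qed
qed

lemma birkhoff_upper_measure:
  assumes h: "integrable M h" and r: "(\<integral>\<omega>. h \<omega> \<partial>M) < r" and e: "e > 0"
  shows "\<exists>N. prob {\<omega> \<in> space M. \<exists>n\<ge>N. (\<Sum>k<n. h ((S ^^ k) \<omega>)) > real n * r} < e"
proof -
  have [measurable]: "h \<in> borel_measurable M" using h by auto
  show ?thesis
  proof (rule decseq_small_prob)
    show "decseq (\<lambda>N. {\<omega> \<in> space M. \<exists>n\<ge>N. (\<Sum>k<n. h ((S ^^ k) \<omega>)) > real n * r})"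
      unfolding decseq_def by (blast intro: order_trans)
    show "AE \<omega> in M. \<exists>N. \<omega> \<notin> {\<omega> \<in> space M. \<exists>n\<ge>N. (\<Sum>k<n. h ((S ^^ k) \<omega>)) > real n * r}"
      using birkhoff_upper[OF h r] by eventually_elim (auto simp: not_less)
  qed (use e in measurable)
qed

end

text \<open>Shifting time turns \<open>I \<inter> S\<^sup>-\<^sup>k U\<close> into a set seen at time \<open>n - 1\<close> for \<open>U\<close>, so that the
  average over \<open>k\<close> only involves the visits to \<open>I\<close>; the bound is therefore uniform in \<open>U\<close>.\<close>

lemma (in ergodic_pmp) return_bound:
  assumes [measurable]: "I \<in> sets M" "U \<in> sets M" and n: "n > 0" and a: "a \<ge> 0"
    and B: "prob {\<omega> \<in> space M. (\<Sum>k<n. indicator I ((S ^^ k) \<omega>)) > real n * a} \<le> e"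
  shows "prob {\<omega> \<in> space M. \<omega> \<in> I \<and> (\<forall>k<n. (S ^^ k) \<omega> \<in> U)} \<le> a * prob U + e"
proof -
  let ?B = "{\<omega> \<in> space M. (\<Sum>k<n. indicator I ((S ^^ k) \<omega>)) > real n * a}"
  let ?W = "{\<omega> \<in> space M. \<omega> \<in> I \<and> (\<forall>k<n. (S ^^ k) \<omega> \<in> U)}"
  let ?J = "\<lambda>j k \<omega>. indicator I ((S ^^ j) \<omega>) * indicator U ((S ^^ k) \<omega>) :: real"
  have int: "integrable M (?J j k)" for j k
    by (rule integrable_const_bound[of _ 1]) (auto simp: indicator_def)
  have intU: "integrable M (\<lambda>\<omega>. indicator U ((S ^^ (n - 1)) \<omega>) :: real)"
    by (intro integrable_funpow integrable_real_indicator) (auto simp: less_top[symmetric])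
  have intB: "integrable M (indicator ?B :: _ \<Rightarrow> real)"
    by (intro integrable_real_indicator) (auto simp: less_top[symmetric])
  have J: "prob ?W \<le> (\<integral>\<omega>. ?J (n - Suc k) (n - 1) \<omega> \<partial>M)" if k: "k < n" for k
  proof -
    have "prob ?W = (\<integral>\<omega>. indicator ?W \<omega> \<partial>M)" by simp
    also have "\<dots> \<le> (\<integral>\<omega>. ?J 0 k \<omega> \<partial>M)"
    proof (rule integral_mono[OF _ int])
      show "integrable M (indicator ?W :: _ \<Rightarrow> real)"
        by (intro integrable_real_indicator) (auto simp: less_top[symmetric])
    qed (use k in \<open>auto simp: indicator_def\<close>)
    also have "\<dots> = (\<integral>\<omega>. ?J 0 k ((S ^^ (n - Suc k)) \<omega>) \<partial>M)"
      by (rule integral_funpow[symmetric]) measurable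
    also have "\<dots> = (\<integral>\<omega>. ?J (n - Suc k) (n - 1) \<omega> \<partial>M)"
    proof -
      have "(S ^^ k) ((S ^^ (n - Suc k)) \<omega>) = (S ^^ (n - 1)) \<omega>" for \<omega>
        using k by (simp add: funpow_add[symmetric, THEN fun_cong, unfolded comp_def] )
      then show ?thesis by simp
    qed
    finally show ?thesis .
  qed
  have "real n * prob ?W = (\<Sum>k<n. prob ?W)" by simp
  also have "\<dots> \<le> (\<Sum>k<n. \<integral>\<omega>. ?J (n - Suc k) (n - 1) \<omega> \<partial>M)"
    by (intro sum_mono J) simp
  also have "\<dots> = (\<integral>\<omega>. (\<Sum>k<n. ?J (n - Suc k) (n - 1) \<omega>) \<partial>M)"
    by (rule Bochner_Integration.integral_sum[symmetric]) (rule int)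
  also have "\<dots> = (\<integral>\<omega>. (\<Sum>k<n. ?J k (n - 1) \<omega>) \<partial>M)"
    by (intro Bochner_Integration.integral_cong refl sum.nat_diff_reindex)
  also have "\<dots> \<le> (\<integral>\<omega>. real n * a * indicator U ((S ^^ (n - 1)) \<omega>) + real n * indicator ?B \<omega> \<partial>M)"
  proof (rule integral_mono)
    show "integrable M (\<lambda>\<omega>. \<Sum>k<n. ?J k (n - 1) \<omega>)" by (intro Bochner_Integration.integrable_sum int)
    show "integrable M (\<lambda>\<omega>. real n * a * indicator U ((S ^^ (n - 1)) \<omega>) + real n * indicator ?B \<omega>)"
      by (intro Bochner_Integration.integrable_add integrable_mult_right intU intB)
    fix \<omega> assume \<omega>: "\<omega> \<in> space M"
    have "(\<Sum>k<n. indicator I ((S ^^ k) \<omega>)) \<le> (\<Sum>k<n. 1 :: real)"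
      by (intro sum_mono) (simp add: indicator_def)
    then have le: "(\<Sum>k<n. indicator I ((S ^^ k) \<omega>)) \<le> real n" by simp
    have "(\<Sum>k<n. ?J k (n - 1) \<omega>) = (\<Sum>k<n. indicator I ((S ^^ k) \<omega>)) * indicator U ((S ^^ (n - 1)) \<omega>)"
      by (simp only: sum_distrib_right)
    \<comment> \<open>Off \<open>?B\<close> there are at most n a visits; on \<open>?B\<close> the
      trivial count n is covered by the second term.\<close>
    also have "\<dots> \<le> real n * a * indicator U ((S ^^ (n - 1)) \<omega>) + real n * indicator ?B \<omega>"
    proof (cases "\<omega> \<in> ?B")
      case True
      with le a show ?thesis by (auto simp: indicator_def[of U] intro: order_trans)
    next
      case False
      with \<omega> show ?thesis by (auto simp: indicator_def[of U] not_less)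
    qed
    finally show "(\<Sum>k<n. ?J k (n - 1) \<omega>) \<le> real n * a * indicator U ((S ^^ (n - 1)) \<omega>) + real n * indicator ?B \<omega>" .
  qed
  also have "\<dots> = real n * a * (\<integral>\<omega>. indicator U ((S ^^ (n - 1)) \<omega>) \<partial>M) + real n * prob ?B"
    using intU intB by simp
  also have "(\<integral>\<omega>. indicator U ((S ^^ (n - 1)) \<omega>) \<partial>M) = prob U"
    using integral_funpow[of "indicator U" "n - 1"] by simp
  also have "real n * a * prob U + real n * prob ?B \<le> real n * (a * prob U + e)"
    using B n by (simp add: algebra_simps)
  finally show ?thesis using n by (simp add: mult_le_cancel_left_pos)
qed

section \<open>Stages along a string\<close>

text \<open>A stage ends at the first string \<open>\<rho>\<close> with \<open>C \<sigma> \<rho>\<close>, where \<open>\<sigma>\<close>, the anchor, is the string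
  at which the preceding stage ended.\<close>

definition stages :: "(bool list \<Rightarrow> bool list \<Rightarrow> bool) \<Rightarrow> bool list \<Rightarrow> nat \<times> bool list \<times> bool list" where
  "stages C \<tau> = foldl (\<lambda>s b. if C (fst (snd s)) (snd (snd s) @ [b])
     then (Suc (fst s), snd (snd s) @ [b], snd (snd s) @ [b])
     else (fst s, fst (snd s), snd (snd s) @ [b])) (0, [], []) \<tau>"

definition level :: "(bool list \<Rightarrow> bool list \<Rightarrow> bool) \<Rightarrow> bool list \<Rightarrow> nat" where
  "level C \<tau> = fst (stages C \<tau>)"

definition anchor :: "(bool list \<Rightarrow> bool list \<Rightarrow> bool) \<Rightarrow> bool list \<Rightarrow> bool list" where
  "anchor C \<tau> = fst (snd (stages C \<tau>))"

lemma stages_current: "snd (snd (stages C \<tau>)) = \<tau>"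
  by (induction \<tau> rule: rev_induct) (auto simp: stages_def)

lemma level_Nil [simp]: "level C [] = 0" and anchor_Nil [simp]: "anchor C [] = []"
  by (simp_all add: level_def anchor_def stages_def)

lemma stages_snoc: "stages C (\<tau> @ [b]) = (if C (anchor C \<tau>) (\<tau> @ [b])
     then (Suc (level C \<tau>), \<tau> @ [b], \<tau> @ [b]) else (level C \<tau>, anchor C \<tau>, \<tau> @ [b]))"
  using stages_current[of C \<tau>] by (simp add: stages_def anchor_def level_def)

lemma level_snoc: "level C (\<tau> @ [b]) = (if C (anchor C \<tau>) (\<tau> @ [b]) then Suc (level C \<tau>) else level C \<tau>)"
  by (simp add: level_def[of C "\<tau> @ [b]"] stages_snoc)

lemma anchor_snoc: "anchor C (\<tau> @ [b]) = (if C (anchor C \<tau>) (\<tau> @ [b]) then \<tau> @ [b] else anchor C \<tau>)"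
  by (simp add: anchor_def[of C "\<tau> @ [b]"] stages_snoc)

lemma cmp_level: assumes "cmp (\<lambda>z. C (fst z) (snd z))" "cmp f" shows "cmp (\<lambda>x. level C (f x))"
  unfolding level_def stages_def by (intro cmp_intros cmp_comp2[of C, OF assms(1)] assms(2))

text \<open>A stage consumes at least one bit. In \<open>random_leaves\<close> this makes the codes
  of the strings ending stage j at least j.\<close>

lemma level_le_length: "level C \<tau> \<le> length \<tau>"
  by (induction \<tau> rule: rev_induct) (auto simp: level_snoc)

lemma level_mono: "m \<le> n \<Longrightarrow> level C (pref \<omega> m) \<le> level C (pref \<omega> n)"
  by (rule lift_Suc_mono_le[of "\<lambda>m. level C (pref \<omega> m)"]) (auto simp: pref_Suc level_snoc)

lemma anchor_const:
  "m \<le> n \<Longrightarrow> level C (pref \<omega> m) = level C (pref \<omega> n) \<Longrightarrow> anchor C (pref \<omega> n) = anchor C (pref \<omega> m)"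
proof (induction n rule: dec_induct)
  case (step n)
  then have "level C (pref \<omega> m) = level C (pref \<omega> n)"
    using level_mono[of m n C \<omega>] level_mono[of n "Suc n" C \<omega>] by linarith
  moreover from this have "\<not> C (anchor C (pref \<omega> n)) (pref \<omega> n @ [\<omega> n])"
    using step.prems by (auto simp: pref_Suc level_snoc)
  ultimately show ?case using step.IH by (simp add: pref_Suc anchor_snoc)
qed simp

definition stage_ends :: "(bool list \<Rightarrow> bool list \<Rightarrow> bool) \<Rightarrow> nat \<Rightarrow> bool list set" where
  "stage_ends C j = {\<sigma>. level C \<sigma> = j \<and> anchor C \<sigma> = \<sigma>}"

text \<open>Of two comparable strings on the same level the longer one has the anchor of the shorter
  one; each being its own anchor, they coincide.\<close>

lemma stage_ends_disjoint: "disjoint_family_on cyl (stage_ends C j)"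
  unfolding disjoint_family_on_def
proof (intro ballI impI)
  fix \<sigma> \<sigma>' assume *: "\<sigma> \<in> stage_ends C j" "\<sigma>' \<in> stage_ends C j" "\<sigma> \<noteq> \<sigma>'"
  have "\<sigma> = \<sigma>'" if "\<omega> \<in> cyl \<sigma>" "\<omega> \<in> cyl \<sigma>'" for \<omega>
    using that * anchor_const[of "length \<sigma>" "length \<sigma>'" C \<omega>] anchor_const[of "length \<sigma>'" "length \<sigma>" C \<omega>]
    unfolding mem_cyl_iff stage_ends_def by (metis (mono_tags, lifting) mem_Collect_eq nat_le_linear)
  with * show "cyl \<sigma> \<inter> cyl \<sigma>' = {}" by blast
qed

lemma level_reached:
  assumes "j \<le> level C (pref \<omega> m)"
  obtains m' where "m' \<le> m" "pref \<omega> m' \<in> stage_ends C j"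
    "\<And>i. j = Suc i \<Longrightarrow> \<exists>m''. m' = Suc m'' \<and> level C (pref \<omega> m'') = i \<and> C (anchor C (pref \<omega> m'')) (pref \<omega> m')"
proof (cases j)
  case 0
  then show ?thesis using that[of 0] by (simp add: stage_ends_def)
next
  case (Suc i)
  \<comment> \<open>The level rises by at most one per bit, so at the first prefix with level at
    least j it equals j and a stage has just ended.\<close>
  define m' where "m' = (LEAST m. j \<le> level C (pref \<omega> m))"
  have m': "j \<le> level C (pref \<omega> m')" "m' \<le> m"
    unfolding m'_def using assms by (auto intro: LeastI Least_le)
  then obtain k where k: "m' = Suc k" using Suc by (cases m') auto
  then have "\<not> j \<le> level C (pref \<omega> k)" unfolding m'_def by (metis lessI not_less_Least)
  with m' Suc k show ?thesis
    by (intro that[of m']) (auto simp: stage_ends_def pref_Suc level_snoc anchor_snoc split: if_splits)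
qed

lemma open_of_level: "open_of (\<lambda>\<tau>. j \<le> level C \<tau>) = (\<Union>\<sigma>\<in>stage_ends C j. cyl \<sigma>)"
proof (intro set_eqI iffI)
  fix \<omega> assume "\<omega> \<in> open_of (\<lambda>\<tau>. j \<le> level C \<tau>)"
  then obtain m where "j \<le> level C (pref \<omega> m)" by (auto simp: open_of_def)
  then obtain m' where "pref \<omega> m' \<in> stage_ends C j" by (rule level_reached)
  moreover have "\<omega> \<in> cyl (pref \<omega> m')" by (simp add: mem_cyl_iff)
  ultimately show "\<omega> \<in> (\<Union>\<sigma>\<in>stage_ends C j. cyl \<sigma>)" by blast
next
  fix \<omega> assume "\<omega> \<in> (\<Union>\<sigma>\<in>stage_ends C j. cyl \<sigma>)"
  then obtain \<sigma> where "level C \<sigma> = j" "\<sigma> = pref \<omega> (length \<sigma>)"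
    by (auto simp: mem_cyl_iff stage_ends_def)
  then have "j \<le> level C (pref \<omega> (length \<sigma>))" by simp
  then show "\<omega> \<in> open_of (\<lambda>\<tau>. j \<le> level C \<tau>)" unfolding open_of_def by blast
qed

text \<open>The anchor stays \<sigma> until the next stage ends, so it is C with first argument
  \<sigma> that ended it.\<close>

lemma next_level_subset:
  assumes \<sigma>: "\<sigma> \<in> stage_ends C j" and \<omega>: "\<omega> \<in> cyl \<sigma>" "\<omega> \<in> open_of (\<lambda>\<tau>. Suc j \<le> level C \<tau>)"
  shows "\<exists>m. C \<sigma> (pref \<omega> m)"
proof -
  obtain m where "Suc j \<le> level C (pref \<omega> m)" using \<omega>(2) by (auto simp: open_of_def)
  then obtain k where k: "level C (pref \<omega> k) = j" "C (anchor C (pref \<omega> k)) (pref \<omega> (Suc k))"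
    by (rule level_reached) blast
  have s: "pref \<omega> (length \<sigma>) = \<sigma>" using \<omega>(1) by (simp add: mem_cyl_iff)
  have "anchor C (pref \<omega> k) = \<sigma>"
    using anchor_const[of k "length \<sigma>" C \<omega>] anchor_const[of "length \<sigma>" k C \<omega>] k \<sigma>
    unfolding s stage_ends_def by (metis (mono_tags, lifting) mem_Collect_eq nat_le_linear)
  with k show ?thesis by auto
qed

lemma level_unbounded:
  assumes C: "\<And>\<sigma>. \<exists>m0. \<forall>m\<ge>m0. C \<sigma> (pref \<omega> m)"
  shows "\<exists>m. j \<le> level C (pref \<omega> m)"
proof (induction j)
  case (Suc j)
  then obtain m where m: "j \<le> level C (pref \<omega> m)" by blast
  \<comment> \<open>While the level is constant the anchor is too: either the level has risen by
    \<open>?n\<close>, or C holds for this very anchor at \<open>Suc ?n\<close>.\<close>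
  obtain m0 where m0: "\<And>n. n \<ge> m0 \<Longrightarrow> C (anchor C (pref \<omega> m)) (pref \<omega> n)" using C by blast
  let ?n = "max m m0"
  show ?case
  proof (cases "level C (pref \<omega> ?n) = level C (pref \<omega> m)")
    case True
    then have "level C (pref \<omega> (Suc ?n)) = Suc (level C (pref \<omega> m))"
      using anchor_const[of m ?n C \<omega>] m0[of "Suc ?n"] by (simp add: pref_Suc[of _ ?n] level_snoc)
    with m show ?thesis by (metis Suc_le_mono)
  next
    case False
    then have "Suc j \<le> level C (pref \<omega> ?n)" using level_mono[of m ?n C \<omega>] m by linarith
    then show ?thesis ..
  qed
qed simp

section \<open>Effective dynamical systems\<close>

text \<open>Second countability of the factors makes coordinatewise measurability sufficient for
  Borel measurability into \<open>cantor\<close>.\<close>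

instance bool :: second_countable_topology
proof
  show "\<exists>B::bool set set. countable B \<and> open = generate_topology B"
    by (intro exI[of _ "range lessThan \<union> range greaterThan"]) (auto simp: open_bool_def)
qed

locale effective_dynamics = computable_cantor_prob +
  fixes T :: "cantor \<rightharpoonup> cantor" and R :: "bool list \<Rightarrow> bool list"
  assumes cmp_R: "cmp R" and mono_R: "string_mono R"
    and T_iff: "\<And>\<omega> \<eta>. T \<omega> = Some \<eta> \<longleftrightarrow> realizes R \<omega> \<eta>"
    and ae_def: "ae_defined \<mu> T" and pres: "measure_preserving_map \<mu> T"
    and erg: "ergodic_map \<mu> T"
begin

text \<open>A total version of T. The default sequence is taken on a null set only, so measures and
  integrals do not see it; orbits of random points are formed with \<open>iterate T\<close>.\<close>

definition S :: "cantor \<Rightarrow> cantor" where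
  "S \<omega> = (case T \<omega> of Some \<eta> \<Rightarrow> \<eta> | None \<Rightarrow> (\<lambda>_. False))"

lemma dom_T: "dom T = (\<Inter>l. \<Union>m. {\<omega>. l < length (R (pref \<omega> m))})"
proof (intro set_eqI iffI)
  fix \<omega> assume "\<omega> \<in> dom T"
  then show "\<omega> \<in> (\<Inter>l. \<Union>m. {\<omega>. l < length (R (pref \<omega> m))})"
    using T_iff by (auto simp: realizes_def)
next
  fix \<omega> assume "\<omega> \<in> (\<Inter>l. \<Union>m. {\<omega>. l < length (R (pref \<omega> m))})"
  then have "\<exists>m. l < length (R (pref \<omega> m))" for l by auto
  from realizes_exists[OF mono_R this] T_iff show "\<omega> \<in> dom T" by blast
qed

lemma dom_T_sets [measurable]: "dom T \<in> sets \<mu>"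
  unfolding dom_T by auto

lemma AE_dom: "AE \<omega> in \<mu>. \<omega> \<in> dom T"
  using ae_def by (simp add: ae_defined_def prob_eq_1[OF dom_T_sets, symmetric] emeasure_eq_measure)

lemma S_measurable [measurable]: "S \<in> measurable \<mu> \<mu>"
proof -
  have "(\<lambda>\<omega>. S \<omega> i) \<in> borel_measurable \<mu>" for i
  proof -
    have "{\<omega>. S \<omega> i} = dom T \<inter> (\<Union>m. {\<omega>. i < length (R (pref \<omega> m)) \<and> R (pref \<omega> m) ! i})"
    proof (intro set_eqI iffI)
      fix \<omega> assume "\<omega> \<in> {\<omega>. S \<omega> i}"
      then obtain \<eta> where \<eta>: "T \<omega> = Some \<eta>" "\<eta> i" by (auto simp: S_def split: option.splits)
      then have r: "realizes R \<omega> \<eta>" using T_iff by simp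
      then obtain m where "i < length (R (pref \<omega> m))" by (auto simp: realizes_def)
      moreover from this have "R (pref \<omega> m) ! i = \<eta> i" using r unfolding realizes_def by (metis nth_pref)
      ultimately show "\<omega> \<in> dom T \<inter> (\<Union>m. {\<omega>. i < length (R (pref \<omega> m)) \<and> R (pref \<omega> m) ! i})"
        using \<eta> by auto
    next
      fix \<omega> assume "\<omega> \<in> dom T \<inter> (\<Union>m. {\<omega>. i < length (R (pref \<omega> m)) \<and> R (pref \<omega> m) ! i})"
      then obtain \<eta> m where \<eta>: "T \<omega> = Some \<eta>" "i < length (R (pref \<omega> m))" "R (pref \<omega> m) ! i" by auto
      then have "realizes R \<omega> \<eta>" using T_iff by simp
      then have "R (pref \<omega> m) ! i = \<eta> i" using \<eta>(2) unfolding realizes_def by (metis nth_pref)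
      with \<eta> show "\<omega> \<in> {\<omega>. S \<omega> i}" by (simp add: S_def)
    qed
    then have "{\<omega>. S \<omega> i} \<in> sets \<mu>" by auto
    then have "(\<lambda>\<omega>. S \<omega> i) \<in> measurable \<mu> (count_space UNIV)"
      by (simp add: pred_def)
    then show ?thesis
      using measurable_cong_sets[OF refl sets_borel_eq_count_space[where 'a = bool]] by blast
  qed
  then have "S \<in> borel_measurable \<mu>" by (rule measurable_coordinatewise_then_product)
  then show ?thesis using measurable_cong_sets[OF refl sets_eq] by blast
qed

lemma vimage_S: "B \<in> sets \<mu> \<Longrightarrow> emeasure \<mu> (S -` B) = emeasure \<mu> B"
proof -
  assume B: "B \<in> sets \<mu>"
  have eq: "preimage T B = S -` B \<inter> dom T"
    by (auto simp: preimage_def S_def split: option.splits)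
  have SB: "S -` B \<in> sets \<mu>" using measurable_sets[OF S_measurable B] by simp
  have "emeasure \<mu> (S -` B) = emeasure \<mu> (preimage T B)"
    unfolding eq using AE_dom SB by (intro emeasure_eq_AE) auto
  then show ?thesis using pres B unfolding measure_preserving_map_def by simp
qed

sublocale ergodic_pmp \<mu> S
proof
  show "S \<in> measurable \<mu> \<mu>" by (rule S_measurable)
  show "distr \<mu> \<mu> S = \<mu>"
    by (rule measure_eqI) (auto simp: emeasure_distr vimage_S)
  show "prob B = 0 \<or> prob B = 1" if B: "B \<in> sets \<mu>" and inv: "S -` B \<inter> space \<mu> = B" for B
  proof -
    have "preimage T B = S -` B \<inter> dom T"
      by (auto simp: preimage_def S_def split: option.splits)
    \<comment> \<open>Exact invariance under S is invariance under T up to the complement of the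
      domain, which is null.\<close>
    then have "sym_diff (preimage T B) B = B - dom T" using inv by auto
    moreover have "B - dom T \<in> null_sets \<mu>"
      using AE_dom B by (subst AE_iff_null_sets) auto
    ultimately have "emeasure \<mu> B \<in> {0, 1}" using erg B unfolding ergodic_map_def by simp
    then show ?thesis by (auto simp: emeasure_eq_measure)
  qed
qed

lemma iterate_S:
  assumes "\<And>k. (S ^^ k) \<omega> \<in> dom T" shows "iterate T k \<omega> = Some ((S ^^ k) \<omega>)"
proof (induction k)
  case (Suc k)
  obtain \<eta> where "T ((S ^^ k) \<omega>) = Some \<eta>" using assms[of k] by blast
  moreover from this have "S ((S ^^ k) \<omega>) = \<eta>" by (simp add: S_def)
  ultimately show ?case using Suc by simp
qed simp

text \<open>Almost every orbit stays in the domain, and there the iterates of S are read off from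
  iterates of R on prefixes. This is the passage from decidable statements about R to measures of
  events for S.\<close>

lemma AE_realizes: "AE \<omega> in \<mu>. \<forall>k. realizes (R ^^ k) \<omega> ((S ^^ k) \<omega>)"
  using AE_all_funpow[OF AE_dom]
proof eventually_elim
  case (elim \<omega>)
  then have "iterate T k \<omega> = Some ((S ^^ k) \<omega>)" for k by (intro iterate_S) blast
  then show ?case by (blast intro: realizes_iterate[OF mono_R T_iff])
qed

lemma AE_realizes_open:
  assumes "up_closed B"
  shows "AE \<omega> in \<mu>. \<forall>k. (S ^^ k) \<omega> \<in> open_of B \<longleftrightarrow> (\<exists>m. B ((R ^^ k) (pref \<omega> m)))"
  using AE_realizes by eventually_elim (use realizes_open_of[OF assms] in blast)

lemma cmp_R_funpow: "cmp n \<Longrightarrow> cmp f \<Longrightarrow> cmp (\<lambda>x. (R ^^ n x) (f x))"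
  by (rule cmp_funpow[OF cmp_R])

lemma prefix_R: "m \<le> n \<Longrightarrow> prefix ((R ^^ k) (pref \<omega> m)) ((R ^^ k) (pref \<omega> n))"
  by (rule string_monoD[OF string_mono_funpow[OF mono_R] pref_mono])

text \<open>The event that y input bits yield at most l output bits shrinks to a null set as y
  grows; \<open>search_small\<close> supplies the rate that turns this into a test.\<close>

lemma random_unbounded:
  assumes "martin_lof_random \<mu> \<omega>" shows "\<exists>m. l < length ((R ^^ k) (pref \<omega> m))"
proof -
  define Bad where "Bad p y \<tau> \<longleftrightarrow> length ((R ^^ k) \<tau>) \<le> l" for p y :: nat and \<tau>
  have c: "cmp (\<lambda>z. Bad (fst z) (fst (snd z)) (snd (snd z)))"
    unfolding Bad_def by (intro cmp_intros cmp_R_funpow)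
  have "\<exists>y. prob {\<omega>. Bad p y (pref \<omega> y)} < 1 / 2 ^ (p + 2)" for p
  proof (rule decseq_small_prob)
    show "decseq (\<lambda>y. {\<omega>. Bad p y (pref \<omega> y)})"
      unfolding decseq_def Bad_def by (auto intro: order_trans[OF prefix_length_le[OF prefix_R]])
    show "AE \<omega> in \<mu>. \<exists>y. \<omega> \<notin> {\<omega>. Bad p y (pref \<omega> y)}"
      using AE_realizes by eventually_elim (auto simp: Bad_def realizes_def not_le)
  qed (auto simp: pref_sets)
  from search_small[OF c this] obtain h
    where h: "cmp h" and small: "\<And>p. prob {\<omega>. Bad p (h p) (pref \<omega> (h p))} \<le> 1 / 2 ^ p" by blast
  \<comment> \<open>Fixing the length to \<open>h p\<close> makes the open set equal to the clopen
    event.\<close>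
  define A where "A p \<tau> \<longleftrightarrow> length \<tau> = h p \<and> Bad p (h p) \<tau>" for p \<tau>
  have A: "open_of (A p) = {\<omega>. Bad p (h p) (pref \<omega> (h p))}" for p
    by (auto simp: open_of_def A_def)
  have "\<exists>j. \<omega> \<notin> open_of (A j)"
  proof (rule ml_test[OF _ _ assms])
    show "cmp (\<lambda>z. A (fst z) (snd z))"
      unfolding A_def by (intro cmp_intros cmp_comp3[of Bad, OF c] cmp_comp[OF h])
    show "emeasure \<mu> (open_of (A j)) \<le> ennreal (1 / 2 ^ j)" for j
      unfolding A emeasure_eq_measure using small by (rule ennreal_leI)
  qed
  then show ?thesis unfolding A by (auto simp: Bad_def not_le)
qed

lemma random_iterate:
  assumes "martin_lof_random \<mu> \<omega>"
  obtains "\<And>k. iterate T k \<omega> = Some (the (iterate T k \<omega>))"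
    "\<And>k. realizes (R ^^ k) \<omega> (the (iterate T k \<omega>))"
proof -
  have "\<omega> \<in> dom (iterate T k)" for k
    by (rule dom_iterate[OF mono_R T_iff random_unbounded[OF assms]])
  then have "iterate T k \<omega> = Some (the (iterate T k \<omega>))" for k by (metis domIff option.collapse)
  with realizes_iterate[OF mono_R T_iff] that show ?thesis by blast
qed

text \<open>The time for \<sigma> must be certified from finite data. \<open>near\<close> counts an
  output as a visit as long as it does not contradict \<sigma>. Longer prefixes only lower such a
  count, and up to a null set the decidable event \<open>bad\<close> contains the true event of too
  many visits. In \<open>+ 3\<close>, 1 is the permitted excess 2^-p of the visit frequency and 2
  the error of the weight; read back with the error 2 this becomes 5, and the measure 2^-p of the
  bad event makes it 6.\<close>

lemma hitting_bound:
  obtains n where "cmp n" "\<And>\<sigma> U. U \<in> sets \<mu> \<Longrightarrow>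
    prob {\<omega>. \<omega> \<in> cyl \<sigma> \<and> (\<forall>k<n \<sigma>. (S ^^ k) \<omega> \<in> U)} \<le> prob U * prob (cyl \<sigma>) + 6 / 2 ^ code \<sigma>"
proof -
  obtain w where w: "cmp (\<lambda>z. w (fst z) (snd z))"
    and wm: "\<And>x n. \<bar>prob (cyl x) * 2 ^ n - real (w x n)\<bar> \<le> 2"
    using measure_approx by blast
  \<comment> \<open>The search must succeed at every number p, so every p has to denote a
    string.\<close>
  define dec where "dec p = map ((<) 0) (list_decode p)" for p
  have dec: "dec (code \<sigma>) = \<sigma>" for \<sigma> :: "bool list"
    by (simp add: dec_def code_list_def code_bool_def[abs_def] map_idI)
  define near where "near \<sigma> x \<longleftrightarrow> prefix \<sigma> x \<or> prefix x \<sigma>" for \<sigma> x :: "bool list"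
  define count where "count n \<sigma> \<tau> = (\<Sum>k<n. of_bool (near \<sigma> ((R ^^ k) \<tau>)) :: nat)" for n \<sigma> \<tau>
  \<comment> \<open>The disjunct n = 0 marks time 0 as bad, which would otherwise pass with an empty
    count.\<close>
  define bad where "bad n p \<tau> \<longleftrightarrow> n = 0 \<or> n * (w (dec p) p + 3) < 2 ^ p * count n (dec p) \<tau>" for n p \<tau>
  \<comment> \<open>A candidate y codes a time n and a second component, which only serves to make
    y, and with it the inspected prefix, as long as required.\<close>
  define Bad where "Bad p y \<tau> \<longleftrightarrow> bad (fst (prod_decode y)) p \<tau>" for p y \<tau>
  have c: "cmp (\<lambda>z. Bad (fst z) (fst (snd z)) (snd (snd z)))"
    unfolding Bad_def bad_def count_def near_def dec_def
    by (intro cmp_intros cmp_R_funpow cmp_comp2[of w, OF w])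
  have near_antimono: "near \<sigma> x" if "near \<sigma> x'" "prefix x x'" for \<sigma> x x'
    using that unfolding near_def by (metis prefix_order.trans prefix_same_cases)
  have bad_antimono: "bad n p (pref \<omega> m)" if "bad n p (pref \<omega> m')" "m \<le> m'" for n p \<omega> m m'
  proof -
    have "count n (dec p) (pref \<omega> m') \<le> count n (dec p) (pref \<omega> m)"
      unfolding count_def using near_antimono[OF _ prefix_R[OF that(2)]] by (intro sum_mono) auto
    then have "2 ^ p * count n (dec p) (pref \<omega> m') \<le> 2 ^ p * count n (dec p) (pref \<omega> m)" by simp
    with that(1) show ?thesis unfolding bad_def by linarith
  qed
  have near_iff: "near \<sigma> x \<longleftrightarrow> \<eta> \<in> cyl \<sigma>" if "x = pref \<eta> (length x)" "length \<sigma> \<le> length x" for \<sigma> x \<eta>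
  proof -
    have "near \<sigma> x \<longleftrightarrow> prefix \<sigma> x"
      using that(2) unfolding near_def by (auto simp: prefix_def)
    also have "\<dots> \<longleftrightarrow> \<eta> \<in> cyl \<sigma>"
      using that prefix_pref_iff[of \<sigma> \<eta> "length x"] unfolding mem_cyl_iff by metis
    finally show ?thesis .
  qed
  have nearI: "near \<sigma> x" if "x = pref \<eta> (length x)" "\<eta> \<in> cyl \<sigma>" for \<sigma> x \<eta>
    using that unfolding near_def mem_cyl_iff by (metis pref_mono nat_le_linear)
  have ex: "\<exists>y. prob {\<omega>. Bad p y (pref \<omega> y)} < 1 / 2 ^ (p + 2)" for p
  proof -
    let ?I = "cyl (dec p)"
    let ?a = "prob ?I + 1 / 2 ^ p"
    have int: "integrable \<mu> (indicator ?I :: _ \<Rightarrow> real)"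
      by (intro integrable_real_indicator) (auto simp: less_top[symmetric])
    obtain N where N: "prob {\<omega> \<in> space \<mu>. \<exists>n\<ge>N. (\<Sum>k<n. indicator ?I ((S ^^ k) \<omega>)) > real n * ?a} < 1 / 2 ^ (p + 2)"
      using birkhoff_upper_measure[OF int, of ?a "1 / 2 ^ (p + 2)"] by auto
    define n where "n = Suc N"
    define G where "G = {\<omega> \<in> space \<mu>. (\<Sum>k<n. indicator ?I ((S ^^ k) \<omega>)) > real n * ?a}"
    have G [measurable]: "G \<in> sets \<mu>" unfolding G_def by measurable
    have "prob G \<le> prob {\<omega> \<in> space \<mu>. \<exists>n\<ge>N. (\<Sum>k<n. indicator ?I ((S ^^ k) \<omega>)) > real n * ?a}"
    proof (rule finite_measure_mono)
      show "{\<omega> \<in> space \<mu>. \<exists>n\<ge>N. (\<Sum>k<n. indicator ?I ((S ^^ k) \<omega>)) > real n * ?a} \<in> events"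
        by measurable
    qed (auto simp: G_def n_def intro: le_SucI)
    with N have pG: "prob G < 1 / 2 ^ (p + 2)" by linarith
    \<comment> \<open>Outside G the count becomes exact once the prefix shows
      \<open>length (dec p)\<close> bits of each of the first n iterates; so what is left of the bad
      event shrinks to a null set.\<close>
    have "\<exists>m. prob ({\<omega>. bad n p (pref \<omega> m)} - G) < 1 / 2 ^ (p + 2) - prob G"
    proof (rule decseq_small_prob)
      show "decseq (\<lambda>m. {\<omega>. bad n p (pref \<omega> m)} - G)"
        unfolding decseq_def using bad_antimono by blast
      show "AE \<omega> in \<mu>. \<exists>m. \<omega> \<notin> {\<omega>. bad n p (pref \<omega> m)} - G"
        using AE_realizes
      proof eventually_elim
        case (elim \<omega>)
        have "\<exists>m. \<not> bad n p (pref \<omega> m)" if "\<omega> \<notin> G"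
        proof -
          have "\<forall>\<^sub>F m in sequentially. length (dec p) \<le> length ((R ^^ k) (pref \<omega> m))" for k
          proof -
            obtain m0 where "length (dec p) < length ((R ^^ k) (pref \<omega> m0))"
              using elim unfolding realizes_def by blast
            then have "length (dec p) \<le> length ((R ^^ k) (pref \<omega> m))" if "m \<ge> m0" for m
              using prefix_length_le[OF prefix_R[OF that, of k \<omega>]] by linarith
            then show ?thesis by (rule eventually_sequentiallyI)
          qed
          then have "\<forall>\<^sub>F m in sequentially. \<forall>k\<in>{..<n}. length (dec p) \<le> length ((R ^^ k) (pref \<omega> m))"
            by (intro eventually_ball_finite) auto
          then obtain m where m: "\<And>k. k < n \<Longrightarrow> length (dec p) \<le> length ((R ^^ k) (pref \<omega> m))"
            by (auto simp: eventually_sequentially)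
          have "real (count n (dec p) (pref \<omega> m)) = (\<Sum>k<n. indicator ?I ((S ^^ k) \<omega>))"
            unfolding count_def of_nat_sum
          proof (rule sum.cong[OF refl])
            fix k assume "k \<in> {..<n}"
            then have "near (dec p) ((R ^^ k) (pref \<omega> m)) \<longleftrightarrow> (S ^^ k) \<omega> \<in> ?I"
              using elim m by (intro near_iff) (auto simp: realizes_def)
            then show "real (of_bool (near (dec p) ((R ^^ k) (pref \<omega> m)))) = indicator ?I ((S ^^ k) \<omega>)"
              by simp
          qed
          also have "\<dots> \<le> real n * ?a" using that by (simp add: G_def not_less)
          finally have "2 ^ p * real (count n (dec p) (pref \<omega> m)) \<le> 2 ^ p * (real n * ?a)" by simp
          also have "\<dots> = real n * (prob ?I * 2 ^ p + 1)" by (simp add: field_simps)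
          also have "\<dots> \<le> real n * (real (w (dec p) p) + 3)"
            using wm[of "dec p" p] by (intro mult_left_mono) auto
          finally have "real (2 ^ p * count n (dec p) (pref \<omega> m)) \<le> real (n * (w (dec p) p + 3))" by simp
          then have "\<not> bad n p (pref \<omega> m)" unfolding bad_def of_nat_le_iff by (simp add: n_def)
          then show ?thesis ..
        qed
        then show ?case by blast
      qed
    qed (use pG in \<open>auto simp: pref_sets\<close>)
    then obtain m where m: "prob ({\<omega>. bad n p (pref \<omega> m)} - G) < 1 / 2 ^ (p + 2) - prob G" by blast
    have "{\<omega>. Bad p (prod_encode (n, m)) (pref \<omega> (prod_encode (n, m)))} \<subseteq> G \<union> ({\<omega>. bad n p (pref \<omega> m)} - G)"
      using bad_antimono[OF _ le_prod_encode_2[of m n]] by (auto simp: Bad_def)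
    then have "prob {\<omega>. Bad p (prod_encode (n, m)) (pref \<omega> (prod_encode (n, m)))}
        \<le> prob (G \<union> ({\<omega>. bad n p (pref \<omega> m)} - G))"
      by (rule finite_measure_mono) auto
    also have "\<dots> \<le> prob G + prob ({\<omega>. bad n p (pref \<omega> m)} - G)"
      by (rule measure_Un_le) auto
    finally show ?thesis using m by (intro exI[of _ "prod_encode (n, m)"]) linarith
  qed
  from search_small[OF c ex] obtain h
    where h: "cmp h" and small: "\<And>p. prob {\<omega>. Bad p (h p) (pref \<omega> (h p))} \<le> 1 / 2 ^ p" by blast
  define n where "n \<sigma> = fst (prod_decode (h (code \<sigma>)))" for \<sigma> :: "bool list"
  have "cmp n" unfolding n_def by (intro cmp_intros cmp_comp[OF h] cmp_code)
  moreover have "prob {\<omega>. \<omega> \<in> cyl \<sigma> \<and> (\<forall>k<n \<sigma>. (S ^^ k) \<omega> \<in> U)} \<le> prob U * prob (cyl \<sigma>) + 6 / 2 ^ code \<sigma>"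
    if U [measurable]: "U \<in> sets \<mu>" for \<sigma> U
  proof -
    let ?p = "code \<sigma>"
    have B: "prob {\<omega>. bad (n \<sigma>) ?p (pref \<omega> (h ?p))} \<le> 1 / 2 ^ ?p"
      using small[of ?p] by (simp add: Bad_def n_def)
    show ?thesis
    proof (cases "n \<sigma> = 0")
      case True
      \<comment> \<open>Time 0 is bad everywhere, so it can be the result only if the permitted
        measure 2^-p is 1, and then the claim is trivial.\<close>
      then have "1 \<le> 1 / (2::real) ^ ?p" using B prob_space by (simp add: bad_def)
      then have "1 \<le> 6 / (2::real) ^ ?p" by (simp add: field_simps)
      moreover have "0 \<le> prob U * prob (cyl \<sigma>)" by simp
      ultimately show ?thesis
        using prob_le_1[of "{\<omega>. \<omega> \<in> cyl \<sigma> \<and> (\<forall>k<n \<sigma>. (S ^^ k) \<omega> \<in> U)}"] by linarith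
    next
      case False
      let ?a = "prob (cyl \<sigma>) + 5 / 2 ^ ?p"
      have "prob {\<omega> \<in> space \<mu>. (\<Sum>k<n \<sigma>. indicator (cyl \<sigma>) ((S ^^ k) \<omega>)) > real (n \<sigma>) * ?a}
        \<le> prob {\<omega>. bad (n \<sigma>) ?p (pref \<omega> (h ?p))}"
      proof (rule finite_measure_mono_AE)
        show "AE \<omega> in \<mu>. \<omega> \<in> {\<omega> \<in> space \<mu>. (\<Sum>k<n \<sigma>. indicator (cyl \<sigma>) ((S ^^ k) \<omega>)) > real (n \<sigma>) * ?a}
          \<longrightarrow> \<omega> \<in> {\<omega>. bad (n \<sigma>) ?p (pref \<omega> (h ?p))}"
          using AE_realizes
        proof eventually_elim
          case (elim \<omega>)
          show ?case
          proof
            assume "\<omega> \<in> {\<omega> \<in> space \<mu>. (\<Sum>k<n \<sigma>. indicator (cyl \<sigma>) ((S ^^ k) \<omega>)) > real (n \<sigma>) * ?a}"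
            then have "real (n \<sigma>) * ?a < (\<Sum>k<n \<sigma>. indicator (cyl \<sigma>) ((S ^^ k) \<omega>))" by simp
            also have "\<dots> \<le> real (count (n \<sigma>) \<sigma> (pref \<omega> (h ?p)))"
              unfolding count_def of_nat_sum
            proof (rule sum_mono)
              fix k
              have "(S ^^ k) \<omega> \<in> cyl \<sigma> \<Longrightarrow> near \<sigma> ((R ^^ k) (pref \<omega> (h ?p)))"
                using elim by (intro nearI) (auto simp: realizes_def)
              then show "indicator (cyl \<sigma>) ((S ^^ k) \<omega>) \<le> real (of_bool (near \<sigma> ((R ^^ k) (pref \<omega> (h ?p)))))"
                by (simp add: indicator_def)
            qed
            finally have "2 ^ ?p * (real (n \<sigma>) * ?a) < 2 ^ ?p * real (count (n \<sigma>) \<sigma> (pref \<omega> (h ?p)))" by simp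
            moreover have "2 ^ ?p * (real (n \<sigma>) * ?a) = real (n \<sigma>) * (prob (cyl \<sigma>) * 2 ^ ?p + 5)"
              by (simp add: field_simps)
            moreover have "real (n \<sigma>) * (real (w \<sigma> ?p) + 3) \<le> real (n \<sigma>) * (prob (cyl \<sigma>) * 2 ^ ?p + 5)"
              using wm[of \<sigma> ?p] by (intro mult_left_mono) auto
            ultimately have "real (n \<sigma> * (w \<sigma> ?p + 3)) < real (2 ^ ?p * count (n \<sigma>) \<sigma> (pref \<omega> (h ?p)))" by simp
            then show "\<omega> \<in> {\<omega>. bad (n \<sigma>) ?p (pref \<omega> (h ?p))}"
              unfolding bad_def of_nat_less_iff by (simp add: dec)
          qed
        qed
      qed (auto simp: pref_sets)
      with B have "prob {\<omega> \<in> space \<mu>. (\<Sum>k<n \<sigma>. indicator (cyl \<sigma>) ((S ^^ k) \<omega>)) > real (n \<sigma>) * ?a} \<le> 1 / 2 ^ ?p"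
        by linarith
      with False return_bound[of "cyl \<sigma>" U "n \<sigma>" ?a "1 / 2 ^ ?p"]
      have "prob {\<omega>. \<omega> \<in> cyl \<sigma> \<and> (\<forall>k<n \<sigma>. (S ^^ k) \<omega> \<in> U)} \<le> ?a * prob U + 1 / 2 ^ ?p"
        by simp
      also have "\<dots> = prob U * prob (cyl \<sigma>) + (5 * prob U + 1) / 2 ^ ?p" by (simp add: field_simps)
      also have "\<dots> \<le> prob U * prob (cyl \<sigma>) + 6 / 2 ^ ?p"
        using prob_le_1[of U] by (intro add_left_mono divide_right_mono) auto
      finally show ?thesis .
    qed
  qed
  ultimately show ?thesis by (rule that)
qed

end

text \<open>Distinct strings have distinct codes, so the sum is dominated by a geometric
  tail.\<close>

lemma nn_integral_code_tail:
  fixes X :: "bool list set"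
  assumes X: "\<And>\<sigma>. \<sigma> \<in> X \<Longrightarrow> j \<le> code \<sigma>"
  shows "(\<integral>\<^sup>+\<sigma>. ennreal (1 / 2 ^ code \<sigma>) \<partial>count_space X) \<le> ennreal (2 / 2 ^ j)"
proof -
  have "bij_betw code X (code ` X)" by (auto simp: bij_betw_def inj_on_def)
  then have "(\<integral>\<^sup>+\<sigma>. ennreal (1 / 2 ^ code \<sigma>) \<partial>count_space X) = (\<integral>\<^sup>+c. ennreal (1 / 2 ^ c) \<partial>count_space (code ` X))"
    by (rule nn_integral_bij_count_space)
  also have "\<dots> \<le> (\<integral>\<^sup>+c. ennreal (1 / 2 ^ c) \<partial>count_space {j..})"
  proof -
    have "code ` X \<subseteq> {j..}" using X by auto
    then have "indicator (code ` X) c \<le> (indicator {j..} c :: ennreal)" for c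
      by (auto simp: indicator_def)
    then show ?thesis
      by (simp add: nn_integral_count_space_indicator nn_integral_mono mult_left_mono)
  qed
  also have "\<dots> = (\<integral>\<^sup>+i. ennreal (1 / 2 ^ (i + j)) \<partial>count_space UNIV)"
  proof (rule nn_integral_bij_count_space[symmetric])
    show "bij_betw (\<lambda>i. i + j) UNIV {j..}"
      by (rule bij_betwI[of _ _ _ "\<lambda>i. i - j"]) auto
  qed
  also have "\<dots> = (\<Sum>i. ennreal (1 / 2 ^ (i + j)))" by (rule nn_integral_count_space_nat)
  also have "\<dots> = ennreal (2 / 2 ^ j)"
  proof (rule suminf_ennreal_eq)
    have "(\<lambda>i. (1 / 2 ^ j) * (1 / 2) ^ i) sums ((1 / 2 ^ j) * (1 / (1 - 1 / 2 :: real)))"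
      by (intro sums_mult geometric_sums) auto
    then show "(\<lambda>i. 1 / 2 ^ (i + j)) sums (2 / 2 ^ j :: real)"
      by (simp add: power_add power_divide mult.commute)
  qed simp
  finally show ?thesis .
qed

lemma ennreal_mult_add_mult:
  "0 \<le> a \<Longrightarrow> 0 \<le> b \<Longrightarrow> 0 \<le> c \<Longrightarrow> 0 \<le> d \<Longrightarrow>
    ennreal a * ennreal b + ennreal c * ennreal d = ennreal (a * b + c * d)"
  by (simp add: ennreal_mult ennreal_plus)

context effective_dynamics
begin

text \<open>An orbit that never leaves \<open>U = open_of B\<close> passes through stages without end. Given an
  anchor \<open>\<sigma>\<close>, a stage ends when the first \<open>n \<sigma>\<close> iterates have been seen to be in \<open>U\<close>; by
  \<open>hitting_bound\<close> each stage multiplies the measure by about the measure of \<open>U\<close>.\<close>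

theorem random_leaves:
  assumes B: "up_closed B" "cmp B" and small: "prob (open_of B) < 1"
    and random: "martin_lof_random \<mu> \<omega>"
  shows "\<exists>k. \<forall>m. \<not> B ((R ^^ k) (pref \<omega> m))"
proof (rule ccontr)
  assume "\<not> ?thesis"
  then have stay: "\<exists>m. B ((R ^^ k) (pref \<omega> m))" for k by blast
  obtain n where n: "cmp n" and bound: "\<And>\<sigma> U. U \<in> sets \<mu> \<Longrightarrow>
    prob {\<omega>. \<omega> \<in> cyl \<sigma> \<and> (\<forall>k<n \<sigma>. (S ^^ k) \<omega> \<in> U)} \<le> prob U * prob (cyl \<sigma>) + 6 / 2 ^ code \<sigma>"
    using hitting_bound by blast
  define C where "C \<sigma> \<rho> \<longleftrightarrow> (\<forall>k<n \<sigma>. B ((R ^^ k) \<rho>))" for \<sigma> \<rho>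
  have C: "cmp (\<lambda>z. C (fst z) (snd z))"
    unfolding C_def by (intro cmp_intros cmp_comp[OF B(2)] cmp_comp[OF n] cmp_R_funpow)
  define V where "V j = open_of (\<lambda>\<tau>. j \<le> level C \<tau>)" for j
  have V [measurable]: "V j \<in> sets \<mu>" for j unfolding V_def by simp
  let ?u = "prob (open_of B)"
  \<comment> \<open>\<open>hitting_bound\<close> is summed over the ends of stage j, whose cylinders
    are disjoint with union \<open>V j\<close>; the constant 12 is 6 times the 2 of the code
    tail.\<close>
  have step: "prob (V (Suc j)) \<le> ?u * prob (V j) + 12 / 2 ^ j" for j
  proof -
    let ?F = "stage_ends C j"
    have disj: "disjoint_family_on (\<lambda>\<sigma>. cyl \<sigma> \<inter> V (Suc j)) ?F"
      using stage_ends_disjoint[of C j] by (auto simp: disjoint_family_on_def)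
    have "V (Suc j) \<subseteq> V j" unfolding V_def open_of_def by (auto intro: Suc_leD)
    then have eq: "V (Suc j) = (\<Union>\<sigma>\<in>?F. cyl \<sigma> \<inter> V (Suc j))"
      using open_of_level[of j C] unfolding V_def by auto
    have each: "emeasure \<mu> (cyl \<sigma> \<inter> V (Suc j)) \<le> ennreal ?u * emeasure \<mu> (cyl \<sigma>) + ennreal 6 * ennreal (1 / 2 ^ code \<sigma>)"
      if \<sigma>: "\<sigma> \<in> ?F" for \<sigma>
    proof -
      have "prob (cyl \<sigma> \<inter> V (Suc j)) \<le> prob {\<omega>. \<omega> \<in> cyl \<sigma> \<and> (\<forall>k<n \<sigma>. (S ^^ k) \<omega> \<in> open_of B)}"
      proof (rule finite_measure_mono_AE)
        show "AE \<omega> in \<mu>. \<omega> \<in> cyl \<sigma> \<inter> V (Suc j) \<longrightarrow> \<omega> \<in> {\<omega>. \<omega> \<in> cyl \<sigma> \<and> (\<forall>k<n \<sigma>. (S ^^ k) \<omega> \<in> open_of B)}"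
          using AE_realizes_open[OF B(1)]
        proof eventually_elim
          case (elim \<omega>)
          show ?case
          proof
            assume *: "\<omega> \<in> cyl \<sigma> \<inter> V (Suc j)"
            then obtain m where "C \<sigma> (pref \<omega> m)" using next_level_subset[OF \<sigma>] unfolding V_def by blast
            with * elim show "\<omega> \<in> {\<omega>. \<omega> \<in> cyl \<sigma> \<and> (\<forall>k<n \<sigma>. (S ^^ k) \<omega> \<in> open_of B)}"
              unfolding C_def by blast
          qed
        qed
        have "{\<omega> \<in> space \<mu>. \<omega> \<in> cyl \<sigma> \<and> (\<forall>k<n \<sigma>. (S ^^ k) \<omega> \<in> open_of B)} \<in> sets \<mu>" by measurable
        then show "{\<omega>. \<omega> \<in> cyl \<sigma> \<and> (\<forall>k<n \<sigma>. (S ^^ k) \<omega> \<in> open_of B)} \<in> sets \<mu>" by simp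
      qed
      also have "\<dots> \<le> ?u * prob (cyl \<sigma>) + 6 * (1 / 2 ^ code \<sigma>)" using bound[of "open_of B" \<sigma>] by simp
      finally have "ennreal (prob (cyl \<sigma> \<inter> V (Suc j))) \<le> ennreal (?u * prob (cyl \<sigma>) + 6 * (1 / 2 ^ code \<sigma>))"
        by (rule ennreal_leI)
      then show ?thesis
        unfolding emeasure_eq_measure by (subst ennreal_mult_add_mult) simp_all
    qed
    have "emeasure \<mu> (V (Suc j)) = (\<integral>\<^sup>+\<sigma>. emeasure \<mu> (cyl \<sigma> \<inter> V (Suc j)) \<partial>count_space ?F)"
      by (subst eq, rule emeasure_UN_countable) (use disj in auto)
    also have "\<dots> \<le> (\<integral>\<^sup>+\<sigma>. ennreal ?u * emeasure \<mu> (cyl \<sigma>) + ennreal 6 * ennreal (1 / 2 ^ code \<sigma>) \<partial>count_space ?F)"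
      by (rule nn_integral_mono) (use each in simp)
    also have "\<dots> = ennreal ?u * (\<integral>\<^sup>+\<sigma>. emeasure \<mu> (cyl \<sigma>) \<partial>count_space ?F)
        + ennreal 6 * (\<integral>\<^sup>+\<sigma>. ennreal (1 / 2 ^ code \<sigma>) \<partial>count_space ?F)"
      by (simp add: nn_integral_add nn_integral_cmult)
    also have "(\<integral>\<^sup>+\<sigma>. emeasure \<mu> (cyl \<sigma>) \<partial>count_space ?F) = emeasure \<mu> (V j)"
      unfolding V_def open_of_level
      by (rule emeasure_UN_countable[symmetric]) (use stage_ends_disjoint in auto)
    also have "ennreal ?u * emeasure \<mu> (V j) + ennreal 6 * (\<integral>\<^sup>+\<sigma>. ennreal (1 / 2 ^ code \<sigma>) \<partial>count_space ?F)
        \<le> ennreal ?u * emeasure \<mu> (V j) + ennreal 6 * ennreal (2 / 2 ^ j)"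
    proof (intro add_left_mono mult_left_mono nn_integral_code_tail)
      fix \<sigma> assume "\<sigma> \<in> ?F"
      then have "j \<le> length \<sigma>" using level_le_length[of C \<sigma>] by (auto simp: stage_ends_def)
      then show "j \<le> code \<sigma>" using length_le_code[of \<sigma>] by linarith
    qed auto
    also have "\<dots> = ennreal (?u * prob (V j) + 12 / 2 ^ j)"
      unfolding emeasure_eq_measure by (subst ennreal_mult_add_mult) auto
    finally show ?thesis unfolding emeasure_eq_measure by (subst (asm) ennreal_le_iff) auto
  qed
  obtain r where r: "max ?u (1 / 2) < r" "r < 1" using dense[of "max ?u (1/2)" 1] small by auto
  \<comment> \<open>K satisfies \<open>?u * K * r ^ j + 12 / 2 ^ j \<le> K * r ^ Suc j\<close>,
    because r > 1/2; the lower bound 1 starts the induction.\<close>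
  define K where "K = max 1 (12 / (r - ?u))"
  have geometric: "prob (V j) \<le> K * r ^ j" for j
  proof (induction j)
    case 0
    show ?case by (simp add: K_def le_max_iff_disj)
  next
    case (Suc j)
    have "(1 / 2) ^ j \<le> r ^ j" using r by (intro power_mono) auto
    then have p: "12 / 2 ^ j \<le> 12 * r ^ j" by (simp add: power_divide)
    have "12 \<le> K * (r - ?u)"
    proof -
      have "12 = 12 / x * x" if "x > 0" for x :: real using that by simp
      from this[of "r - ?u"] have "12 = 12 / (r - ?u) * (r - ?u)" using r by linarith
      also have "\<dots> \<le> K * (r - ?u)" using r by (intro mult_right_mono) (auto simp: K_def)
      finally show ?thesis .
    qed
    then have "12 * r ^ j \<le> K * (r - ?u) * r ^ j" using r by (intro mult_right_mono) auto
    moreover have "?u * prob (V j) \<le> ?u * (K * r ^ j)" using Suc by (intro mult_left_mono) auto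
    ultimately show ?case using step[of j] p by (simp add: algebra_simps)
  qed
  have "\<exists>j. \<omega> \<notin> open_of (\<lambda>\<tau>. j \<le> level C \<tau>)"
  proof (rule ml_test_geometric[where C = K and r = r, OF _ _ _ _ random])
    show "cmp (\<lambda>z. fst z \<le> level C (snd z))" by (intro cmp_intros cmp_level C)
    show "emeasure \<mu> (open_of (\<lambda>\<tau>. j \<le> level C \<tau>)) \<le> ennreal (K * r ^ j)" for j
      using geometric[of j] unfolding V_def emeasure_eq_measure by (rule ennreal_leI)
  qed (use r in auto)
  moreover have "\<omega> \<in> open_of (\<lambda>\<tau>. j \<le> level C \<tau>)" for j
  proof -
    have "\<exists>m0. \<forall>m\<ge>m0. C \<sigma> (pref \<omega> m)" for \<sigma>
    proof -
      have "\<forall>\<^sub>F m in sequentially. B ((R ^^ k) (pref \<omega> m))" for k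
      proof -
        obtain m0 where "B ((R ^^ k) (pref \<omega> m0))" using stay by blast
        then have "B ((R ^^ k) (pref \<omega> m))" if "m \<ge> m0" for m
          using B(1) prefix_R[OF that] unfolding up_closed_def by blast
        then show ?thesis by (rule eventually_sequentiallyI)
      qed
      then have "\<forall>\<^sub>F m in sequentially. \<forall>k\<in>{..<n \<sigma>}. B ((R ^^ k) (pref \<omega> m))"
        by (intro eventually_ball_finite) auto
      then show ?thesis by (auto simp: eventually_sequentially C_def)
    qed
    from level_unbounded[of C, OF this] show ?thesis by (simp add: open_of_def)
  qed
  ultimately show False by blast
qed

end

section \<open>Birkhoff averages at random points\<close>

text \<open>An effective supremum of natural numbers: integer values keep all comparisons decidable,
  and general lower semicomputable functions are reached by scaling.\<close>

definition string_sup :: "(bool list \<Rightarrow> nat) \<Rightarrow> cantor \<Rightarrow> ennreal" where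
  "string_sup F \<omega> = (SUP m. of_nat (F (pref \<omega> m)))"

definition string_incr :: "(bool list \<Rightarrow> nat) \<Rightarrow> bool" where
  "string_incr F \<longleftrightarrow> (\<forall>\<sigma> \<tau>. prefix \<sigma> \<tau> \<longrightarrow> F \<sigma> \<le> F \<tau>)"

lemma realizes_string_sup:
  assumes F: "string_incr F" and r: "realizes A \<omega> \<eta>"
  shows "string_sup F \<eta> = (SUP m. of_nat (F (A (pref \<omega> m))))"
  unfolding string_sup_def
proof (rule antisym)
  show "(SUP m. of_nat (F (pref \<eta> m))) \<le> (SUP m. of_nat (F (A (pref \<omega> m))) :: ennreal)"
  proof (rule SUP_least)
    fix l
    obtain m where "l < length (A (pref \<omega> m))" using r by (auto simp: realizes_def)
    then have "prefix (pref \<eta> l) (A (pref \<omega> m))"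
      using r pref_mono by (metis realizes_def less_imp_le)
    then have "F (pref \<eta> l) \<le> F (A (pref \<omega> m))" using F by (simp add: string_incr_def)
    then show "of_nat (F (pref \<eta> l)) \<le> (SUP m. of_nat (F (A (pref \<omega> m))) :: ennreal)"
      by (intro SUP_upper2[of m]) auto
  qed
  show "(SUP m. of_nat (F (A (pref \<omega> m)))) \<le> (SUP m. of_nat (F (pref \<eta> m)) :: ennreal)"
  proof (rule SUP_least)
    fix m
    have "A (pref \<omega> m) = pref \<eta> (length (A (pref \<omega> m)))" using r by (simp add: realizes_def)
    then show "of_nat (F (A (pref \<omega> m))) \<le> (SUP m. of_nat (F (pref \<eta> m)) :: ennreal)"
      by (metis SUP_upper UNIV_I)
  qed
qed

section \<open>Upper bounds for averages of integer-valued suprema\<close>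

context effective_dynamics
begin

lemma pref_measurable [measurable]: "(\<lambda>\<omega>. pref \<omega> m) \<in> measurable \<mu> (count_space UNIV)"
  by (rule measurableI) (auto simp: vimage_def pref_sets)

lemma string_sup_measurable [measurable]: "string_sup F \<in> borel_measurable \<mu>"
  unfolding string_sup_def[abs_def] by measurable

text \<open>By Markov's inequality the event that the value at the k-th iterate reaches 2^j has
  measure at most c / 2^j, and finite prefixes reveal it.\<close>

lemma random_string_sup_finite:
  assumes F: "string_incr F" "cmp F" and fin: "(\<integral>\<^sup>+\<omega>. string_sup F \<omega> \<partial>\<mu>) < \<infinity>"
    and random: "martin_lof_random \<mu> \<omega>"
  shows "string_sup F (the (iterate T k \<omega>)) < \<infinity>"
proof -
  define A where "A j \<tau> \<longleftrightarrow> 2 ^ j \<le> F ((R ^^ k) \<tau>)" for j \<tau>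
  define c where "c = enn2real (\<integral>\<^sup>+\<omega>. string_sup F \<omega> \<partial>\<mu>)"
  have c: "(\<integral>\<^sup>+\<omega>. string_sup F \<omega> \<partial>\<mu>) = ennreal c" using fin by (simp add: c_def less_top)
  have "\<exists>j. \<omega> \<notin> open_of (A j)"
  proof (rule ml_test_geometric[where C = c and r = "1 / 2", OF _ _ _ _ random])
    show "cmp (\<lambda>z. A (fst z) (snd z))"
      unfolding A_def by (intro cmp_intros cmp_comp[OF F(2)] cmp_R_funpow)
    show "emeasure \<mu> (open_of (A j)) \<le> ennreal (c * (1 / 2) ^ j)" for j
    proof -
      let ?G = "\<lambda>\<omega>. string_sup F ((S ^^ k) \<omega>)"
      have "emeasure \<mu> (open_of (A j)) \<le> emeasure \<mu> {\<omega> \<in> space \<mu>. 1 \<le> ennreal (1 / 2 ^ j) * ?G \<omega>}"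
      proof (rule emeasure_mono_AE)
        show "AE \<omega> in \<mu>. \<omega> \<in> open_of (A j) \<longrightarrow> \<omega> \<in> {\<omega> \<in> space \<mu>. 1 \<le> ennreal (1 / 2 ^ j) * ?G \<omega>}"
          using AE_realizes
        proof eventually_elim
          case (elim \<omega>)
          show ?case
          proof
            assume "\<omega> \<in> open_of (A j)"
            then obtain m where m: "2 ^ j \<le> F ((R ^^ k) (pref \<omega> m))" by (auto simp: open_of_def A_def)
            have "(1::ennreal) = ennreal (1 / 2 ^ j) * ennreal (2 ^ j)" by (simp add: ennreal_mult'[symmetric])
            also have "\<dots> \<le> ennreal (1 / 2 ^ j) * of_nat (F ((R ^^ k) (pref \<omega> m)))"
            proof (rule mult_left_mono)
              have "real (2 ^ j) \<le> real (F ((R ^^ k) (pref \<omega> m)))" using m by (simp only: of_nat_le_iff)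
              then show "ennreal (2 ^ j) \<le> of_nat (F ((R ^^ k) (pref \<omega> m)))"
                by (simp add: ennreal_of_nat_eq_real_of_nat ennreal_leI)
            qed simp
            also have "\<dots> \<le> ennreal (1 / 2 ^ j) * ?G \<omega>"
              using realizes_string_sup[OF F(1), of "R ^^ k" \<omega> "(S ^^ k) \<omega>"] elim
              by (intro mult_left_mono) (auto intro!: SUP_upper)
            finally show "\<omega> \<in> {\<omega> \<in> space \<mu>. 1 \<le> ennreal (1 / 2 ^ j) * ?G \<omega>}" by simp
          qed
        qed
      qed measurable
      also have "\<dots> \<le> ennreal (1 / 2 ^ j) * (\<integral>\<^sup>+\<omega>. ?G \<omega> * indicator (space \<mu>) \<omega> \<partial>\<mu>)"
        using nn_integral_Markov_inequality[where u = ?G and M = \<mu> and A = "space \<mu>" and c = "ennreal (1 / 2 ^ j)"] sets.top[of \<mu>]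
        by simp
      also have "(\<integral>\<^sup>+\<omega>. ?G \<omega> * indicator (space \<mu>) \<omega> \<partial>\<mu>) = ennreal c"
        using nn_integral_funpow[of "string_sup F" k] c by simp
      also have "ennreal (1 / 2 ^ j) * ennreal c = ennreal (c * (1 / 2) ^ j)"
        by (simp add: ennreal_mult'[symmetric] power_divide)
      finally show ?thesis .
    qed
  qed auto
  then obtain j where j: "\<omega> \<notin> open_of (A j)" by blast
  obtain real: "realizes (R ^^ k) \<omega> (the (iterate T k \<omega>))" using random_iterate[OF random] by blast
  have "string_sup F (the (iterate T k \<omega>)) \<le> of_nat (2 ^ j)"
    unfolding realizes_string_sup[OF F(1) real]
  proof (rule SUP_least)
    fix m
    have "F ((R ^^ k) (pref \<omega> m)) \<le> 2 ^ j" using j by (auto simp: open_of_def A_def not_le intro: less_imp_le)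
    then show "of_nat (F ((R ^^ k) (pref \<omega> m))) \<le> (of_nat (2 ^ j) :: ennreal)" by (simp only: of_nat_le_iff)
  qed
  also have "\<dots> < \<infinity>" by (simp del: of_nat_power add: of_nat_less_top)
  finally show ?thesis .
qed

text \<open>\<open>random_leaves\<close> yields a k such that, counted from the k-th iterate, all
  averages of length at least N are at most q. The k earlier terms have a finite sum by
  \<open>random_string_sup_finite\<close>, and the gap between q and r absorbs it.\<close>

lemma random_average_upper:
  assumes F: "string_incr F" "cmp F" and r: "(\<integral>\<^sup>+\<omega>. string_sup F \<omega> \<partial>\<mu>) < ennreal r"
    and random: "martin_lof_random \<mu> \<omega>"
  shows "\<forall>\<^sub>F n in sequentially. (\<Sum>k<n. string_sup F (the (iterate T k \<omega>))) \<le> ennreal (real n * r)"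
proof -
  define \<eta> where "\<eta> k = the (iterate T k \<omega>)" for k
  have real: "realizes (R ^^ k) \<omega> (\<eta> k)" for k
    using random_iterate[OF random] unfolding \<eta>_def by blast
  have sup_\<eta>: "string_sup F (\<eta> k) = (SUP m. of_nat (F ((R ^^ k) (pref \<omega> m))))" for k
    by (rule realizes_string_sup[OF F(1) real])
  have fin: "(\<integral>\<^sup>+\<omega>. string_sup F \<omega> \<partial>\<mu>) < \<infinity>" using r by (metis ennreal_less_top infinity_ennreal_def less_trans)
  define h where "h \<omega> = enn2real (string_sup F \<omega>)" for \<omega>
  have AE_fin: "AE \<omega> in \<mu>. string_sup F \<omega> = ennreal (h \<omega>)"
    using nn_integral_PInf_AE[OF string_sup_measurable less_imp_neq[OF fin]]
    by eventually_elim (simp add: h_def less_top)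
  have "(\<integral>\<^sup>+\<omega>. ennreal (h \<omega>) \<partial>\<mu>) = (\<integral>\<^sup>+\<omega>. string_sup F \<omega> \<partial>\<mu>)"
    by (rule nn_integral_cong_AE) (use AE_fin in auto)
  moreover have hm: "h \<in> borel_measurable \<mu>" unfolding h_def[abs_def] by measurable
  ultimately have int: "integrable \<mu> h" and int_eq: "ennreal (\<integral>\<omega>. h \<omega> \<partial>\<mu>) = (\<integral>\<^sup>+\<omega>. string_sup F \<omega> \<partial>\<mu>)"
  proof -
    assume *: "(\<integral>\<^sup>+\<omega>. ennreal (h \<omega>) \<partial>\<mu>) = (\<integral>\<^sup>+\<omega>. string_sup F \<omega> \<partial>\<mu>)"
    show i: "integrable \<mu> h"
      by (rule integrableI_nonneg) (use hm fin * in \<open>auto simp: h_def\<close>)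
    show "ennreal (\<integral>\<omega>. h \<omega> \<partial>\<mu>) = (\<integral>\<^sup>+\<omega>. string_sup F \<omega> \<partial>\<mu>)"
      using nn_integral_eq_integral[OF i] * by (simp add: h_def[abs_def])
  qed
  have "0 \<le> (\<integral>\<omega>. h \<omega> \<partial>\<mu>)" by (simp add: h_def)
  then have hr: "(\<integral>\<omega>. h \<omega> \<partial>\<mu>) < r" using r unfolding int_eq[symmetric] by (simp add: ennreal_less_iff)
  obtain q where q: "(\<integral>\<omega>. h \<omega> \<partial>\<mu>) < of_rat q" "of_rat q < r" using of_rat_dense[OF hr] by blast
  have q0: "0 < q" using q(1) \<open>0 \<le> (\<integral>\<omega>. h \<omega> \<partial>\<mu>)\<close> by (meson le_less_trans zero_less_of_rat_iff)
  obtain a b :: nat where ab: "b > 0" "of_rat q = real a / real b"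
  proof -
    obtain i j where ij: "quotient_of q = (i, j)" by fastforce
    then have "j > 0" "q = of_int i / of_int j" using quotient_of_denom_pos quotient_of_div by auto
    moreover from this q0 have "i > 0" by (simp add: zero_less_divide_iff)
    ultimately show ?thesis by (intro that[of "nat j" "nat i"]) (auto simp: of_rat_divide)
  qed
  obtain N where N: "prob {\<omega> \<in> space \<mu>. \<exists>n\<ge>N. (\<Sum>k<n. h ((S ^^ k) \<omega>)) > real n * of_rat q} < 1"
    using birkhoff_upper_measure[OF int q(1), of 1] by auto
  \<comment> \<open>Bounding n by the length keeps B decidable, and clearing the denominator of q
    leaves a comparison of integers.\<close>
  define B where "B \<tau> \<longleftrightarrow> (\<exists>n<length \<tau>. N \<le> n \<and> n * a < b * (\<Sum>k<n. F ((R ^^ k) \<tau>)))" for \<tau>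
  have upB: "up_closed B"
    unfolding up_closed_def
  proof (intro allI impI)
    fix \<sigma> \<tau> :: "bool list" assume pre: "prefix \<sigma> \<tau>" and "B \<sigma>"
    then obtain n where n: "n < length \<sigma>" "N \<le> n" "n * a < b * (\<Sum>k<n. F ((R ^^ k) \<sigma>))"
      by (auto simp: B_def)
    have "(\<Sum>k<n. F ((R ^^ k) \<sigma>)) \<le> (\<Sum>k<n. F ((R ^^ k) \<tau>))"
      using F(1) string_monoD[OF string_mono_funpow[OF mono_R] pre] unfolding string_incr_def
      by (intro sum_mono) blast
    then have "b * (\<Sum>k<n. F ((R ^^ k) \<sigma>)) \<le> b * (\<Sum>k<n. F ((R ^^ k) \<tau>))" by simp
    with n prefix_length_le[OF pre] show "B \<tau>"
      unfolding B_def by (intro exI[of _ n]) linarith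
  qed
  have cB: "cmp B"
    unfolding B_def by (intro cmp_intros cmp_comp[OF F(2)] cmp_R_funpow)
  have "prob (open_of B) \<le> prob {\<omega> \<in> space \<mu>. \<exists>n\<ge>N. (\<Sum>k<n. h ((S ^^ k) \<omega>)) > real n * of_rat q}"
  proof (rule finite_measure_mono_AE)
    have [measurable]: "h \<in> borel_measurable \<mu>" by (rule hm)
    show "{\<omega> \<in> space \<mu>. \<exists>n\<ge>N. (\<Sum>k<n. h ((S ^^ k) \<omega>)) > real n * of_rat q} \<in> events" by measurable
    show "AE \<omega> in \<mu>. \<omega> \<in> open_of B \<longrightarrow>
      \<omega> \<in> {\<omega> \<in> space \<mu>. \<exists>n\<ge>N. (\<Sum>k<n. h ((S ^^ k) \<omega>)) > real n * of_rat q}"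
      using AE_realizes AE_all_funpow[OF AE_fin]
    proof eventually_elim
      case (elim \<omega>)
      show ?case
      proof
        assume "\<omega> \<in> open_of B"
        then obtain m n where n: "N \<le> n" "n * a < b * (\<Sum>k<n. F ((R ^^ k) (pref \<omega> m)))"
          by (auto simp: open_of_def B_def)
        have "real (F ((R ^^ k) (pref \<omega> m))) \<le> h ((S ^^ k) \<omega>)" for k
        proof -
          have "of_nat (F ((R ^^ k) (pref \<omega> m))) \<le> string_sup F ((S ^^ k) \<omega>)"
            using realizes_string_sup[OF F(1), of "R ^^ k" \<omega> "(S ^^ k) \<omega>"] elim(1)
            by (auto intro!: SUP_upper)
          also have "\<dots> = ennreal (h ((S ^^ k) \<omega>))" using elim(2) by blast
          finally show ?thesis
            by (simp add: ennreal_of_nat_eq_real_of_nat h_def)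
        qed
        then have le: "real (\<Sum>k<n. F ((R ^^ k) (pref \<omega> m))) \<le> (\<Sum>k<n. h ((S ^^ k) \<omega>))"
          by (simp add: sum_mono)
        have "real (n * a) < real (b * (\<Sum>k<n. F ((R ^^ k) (pref \<omega> m))))" using n(2) by (simp only: of_nat_less_iff)
        then have "real n * of_rat q < real (\<Sum>k<n. F ((R ^^ k) (pref \<omega> m)))"
          unfolding ab(2) using ab(1) by (simp add: field_simps del: of_nat_sum)
        with le n(1) show "\<omega> \<in> {\<omega> \<in> space \<mu>. \<exists>n\<ge>N. (\<Sum>k<n. h ((S ^^ k) \<omega>)) > real n * of_rat q}" by force
      qed
    qed
  qed
  with N have "prob (open_of B) < 1" by linarith
  from random_leaves[OF upB cB this random] obtain k where k: "\<And>m. \<not> B ((R ^^ k) (pref \<omega> m))" by blast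
  have tail: "(\<Sum>i<n. string_sup F (\<eta> (k + i))) \<le> ennreal (real n * of_rat q)" if n: "n \<ge> N" for n
  proof -
    let ?f = "\<lambda>i m. of_nat (F ((R ^^ (k + i)) (pref \<omega> m))) :: ennreal"
    have inc: "incseq (?f i)" for i
      using F(1) prefix_R unfolding incseq_def string_incr_def by (simp add: of_nat_mono)
    have "(\<Sum>i<n. string_sup F (\<eta> (k + i))) = (\<Sum>i<n. SUP m. ?f i m)" by (simp add: sup_\<eta>)
    also have "\<dots> = (SUP m. \<Sum>i<n. ?f i m)" by (rule ennreal_SUP_sum[symmetric]) (rule inc)
    also have "\<dots> \<le> ennreal (real n * of_rat q)"
    proof (rule SUP_least)
      fix m
      \<comment> \<open>B at a string ignores all n beyond its length, so the prefix is extended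
        until the k-th iterate shows more than n bits.\<close>
      obtain m' where m': "n < length ((R ^^ k) (pref \<omega> m'))" using real[of k] by (auto simp: realizes_def)
      let ?m = "max m m'"
      have "n < length ((R ^^ k) (pref \<omega> ?m))"
        using m' prefix_length_le[OF prefix_R[of m' ?m k \<omega>]] by simp
      then have le: "b * (\<Sum>i<n. F ((R ^^ i) ((R ^^ k) (pref \<omega> ?m)))) \<le> n * a"
        using k[of ?m] n unfolding B_def by (auto simp: not_less)
      have "(R ^^ i) ((R ^^ k) x) = (R ^^ (k + i)) x" for i x
        by (simp add: funpow_add add.commute)
      with le have "real (b * (\<Sum>i<n. F ((R ^^ (k + i)) (pref \<omega> ?m)))) \<le> real (n * a)"
        by (simp only: of_nat_le_iff)
      then have "real (\<Sum>i<n. F ((R ^^ (k + i)) (pref \<omega> ?m))) \<le> real n * of_rat q"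
        unfolding ab(2) using ab(1) by (simp add: field_simps del: of_nat_sum)
      then have "of_nat (\<Sum>i<n. F ((R ^^ (k + i)) (pref \<omega> ?m))) \<le> ennreal (real n * of_rat q)"
        by (simp add: ennreal_of_nat_eq_real_of_nat ennreal_leI del: of_nat_sum)
      moreover have "(\<Sum>i<n. ?f i m) \<le> (\<Sum>i<n. ?f i ?m)"
        using inc by (intro sum_mono) (simp add: incseq_def)
      ultimately show "(\<Sum>i<n. ?f i m) \<le> ennreal (real n * of_rat q)" by simp
    qed
    finally show ?thesis .
  qed
  define c where "c = enn2real (\<Sum>i<k. string_sup F (\<eta> i))"
  have "string_sup F (\<eta> i) < \<infinity>" for i
    unfolding \<eta>_def by (rule random_string_sup_finite[OF F fin random])
  then have "(\<Sum>i<k. string_sup F (\<eta> i)) < \<infinity>" by (simp add: less_top)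
  then have c: "(\<Sum>i<k. string_sup F (\<eta> i)) = ennreal c" by (simp add: c_def less_top)
  have c0: "0 \<le> c" by (simp add: c_def)
  have "(\<Sum>i<n. string_sup F (\<eta> i)) \<le> ennreal (real n * r)"
    if n: "n \<ge> k + N + nat \<lceil>c / (r - of_rat q)\<rceil>" for n
  proof -
    have "{..<n} = {..<k} \<union> {k..<n}" using n by auto
    then have "(\<Sum>i<n. string_sup F (\<eta> i)) = (\<Sum>i<k. string_sup F (\<eta> i)) + (\<Sum>i=k..<n. string_sup F (\<eta> i))"
      by (simp add: sum.union_disjoint ivl_disj_int)
    also have "(\<Sum>i=k..<n. string_sup F (\<eta> i)) = (\<Sum>i<n - k. string_sup F (\<eta> (k + i)))"
      using n sum.shift_bounds_nat_ivl[of "\<lambda>i. string_sup F (\<eta> i)" 0 k "n - k"]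
      by (simp add: lessThan_atLeast0 add.commute)
    also have "(\<Sum>i<k. string_sup F (\<eta> i)) + \<dots> \<le> ennreal c + ennreal (real (n - k) * of_rat q)"
      unfolding c using n by (intro add_left_mono tail) linarith
    also have "\<dots> = ennreal (c + real (n - k) * of_rat q)"
      using c0 q0 by (simp add: ennreal_plus)
    also have "\<dots> \<le> ennreal (real n * r)"
    proof (rule ennreal_leI)
      have "c / (r - of_rat q) \<le> real n" using n by linarith
      then have "c \<le> real n * (r - of_rat q)" using q(2) by (simp add: field_simps)
      moreover have "real (n - k) * of_rat q \<le> real n * of_rat q" using q0 by (intro mult_right_mono) auto
      ultimately show "c + real (n - k) * of_rat q \<le> real n * r" by (simp add: algebra_simps)
    qed
    finally show ?thesis .
  qed
  then show ?thesis unfolding \<eta>_def by (rule eventually_sequentiallyI)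
qed

end

section \<open>Cylinder frequencies and lower bounds for averages\<close>

context effective_dynamics
begin

lemma random_cylinder_average:
  assumes random: "martin_lof_random \<mu> \<omega>"
  shows "(\<lambda>n. (\<Sum>k<n. indicator (cyl x) (the (iterate T k \<omega>))) / real n) \<longlonglongrightarrow> prob (cyl x)"
proof -
  define \<eta> where "\<eta> k = the (iterate T k \<omega>)" for k
  define N where "N y n = (\<Sum>k<n. indicator (cyl y) (\<eta> k) :: real)" for y n
  have upper: "\<forall>\<^sub>F n in sequentially. N y n \<le> real n * r" if r: "prob (cyl y) < r" for y r
  proof -
    define F where "F \<tau> = (of_bool (prefix y \<tau>) :: nat)" for \<tau>
    have "string_incr F" unfolding string_incr_def F_def by (auto intro: prefix_order.trans)
    moreover have "cmp F" unfolding F_def by (intro cmp_intros)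
    moreover have F: "string_sup F = indicator (cyl y)"
    proof
      fix \<xi> :: cantor
      show "string_sup F \<xi> = indicator (cyl y) \<xi>"
      proof (cases "\<xi> \<in> cyl y")
        case True
        then have "F (pref \<xi> (length y)) = 1" by (simp add: F_def mem_cyl_iff[symmetric] prefix_pref_iff)
        then have "1 \<le> string_sup F \<xi>"
          unfolding string_sup_def by (intro SUP_upper2[of "length y"]) auto
        moreover have "string_sup F \<xi> \<le> 1" unfolding string_sup_def by (rule SUP_least) (simp add: F_def)
        ultimately show ?thesis using True by simp
      next
        case False
        then have "F (pref \<xi> m) = 0" for m by (simp add: F_def mem_cyl_iff prefix_pref_iff)
        with False show ?thesis by (simp add: string_sup_def)
      qed
    qed
    moreover have "(\<integral>\<^sup>+\<xi>. string_sup F \<xi> \<partial>\<mu>) < ennreal r"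
      unfolding F using r by (simp add: emeasure_eq_measure ennreal_less_iff)
    ultimately have "\<forall>\<^sub>F n in sequentially. (\<Sum>k<n. indicator (cyl y) (\<eta> k)) \<le> ennreal (real n * r)"
      using random_average_upper[OF _ _ _ random] unfolding \<eta>_def by force
    then show ?thesis
    proof eventually_elim
      case (elim n)
      have "0 < r" using r measure_nonneg[of \<mu> "cyl y"] by linarith
      have "(\<Sum>k<n. indicator (cyl y) (\<eta> k)) = ennreal (N y n)"
        unfolding N_def by (subst sum_ennreal[symmetric]) (auto simp: ennreal_indicator)
      with elim \<open>0 < r\<close> show ?case by (simp add: ennreal_le_iff)
    qed
  qed
  let ?L = "{y :: bool list. length y = length x}"
  have fin: "finite ?L" using finite_strings[of "length x" "\<lambda>_. True"] by simp
  have card: "real (card ?L) = 2 ^ length x"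
    by (metis distinct_card distinct_strings length_strings of_nat_numeral of_nat_power set_strings)
  have one: "(\<Sum>y\<in>?L. prob (cyl y)) = 1"
    using measure_pref[of "\<lambda>_. True" "length x"] prob_space by simp
  have total: "(\<Sum>y\<in>?L. N y n) = real n" for n
  proof -
    have "(\<Sum>y\<in>?L. indicator (cyl y) \<xi>) = (1 :: real)" for \<xi>
    proof -
      have "(\<Sum>y\<in>?L. indicator (cyl y) \<xi>) = (\<Sum>y\<in>{pref \<xi> (length x)}. indicator (cyl y) \<xi> :: real)"
        by (rule sum.mono_neutral_right) (auto simp: fin mem_cyl_iff indicator_def)
      then show ?thesis by (simp add: mem_cyl_iff)
    qed
    then show ?thesis unfolding N_def by (subst sum.swap) simp
  qed
  have lower: "\<forall>\<^sub>F n in sequentially. real n * (prob (cyl x) - e) \<le> N x n" if e: "e > 0" for e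
  proof -
    \<comment> \<open>Visits to x are n minus the visits to the other cylinders of that length;
      there are 2^length x cylinders in all, so their slacks add up to e.\<close>
    let ?d = "e / 2 ^ length x"
    have "\<forall>\<^sub>F n in sequentially. \<forall>y\<in>?L. N y n \<le> real n * (prob (cyl y) + ?d)"
      using fin e by (intro eventually_ball_finite ballI upper) auto
    then show ?thesis
    proof eventually_elim
      case (elim n)
      have "real n - N x n = (\<Sum>y\<in>?L - {x}. N y n)"
        using total[of n] sum.remove[OF fin, of x "\<lambda>y. N y n"] by simp
      also have "\<dots> \<le> (\<Sum>y\<in>?L - {x}. real n * (prob (cyl y) + ?d))"
        using elim by (intro sum_mono) auto
      also have "\<dots> = real n * (\<Sum>y\<in>?L - {x}. prob (cyl y) + ?d)" by (rule sum_distrib_left[symmetric])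
      also have "(\<Sum>y\<in>?L - {x}. prob (cyl y) + ?d) = (\<Sum>y\<in>?L. prob (cyl y) + ?d) - (prob (cyl x) + ?d)"
        using sum.remove[OF fin, of x "\<lambda>y. prob (cyl y) + ?d"] by simp
      also have "(\<Sum>y\<in>?L. prob (cyl y) + ?d) = 1 + e"
        using one card by (simp add: sum.distrib)
      also have "real n * (1 + e - (prob (cyl x) + ?d)) \<le> real n - real n * (prob (cyl x) - e)"
        using e by (simp add: algebra_simps)
      finally show ?case by linarith
    qed
  qed
  have "(\<lambda>n. N x n / real n) \<longlonglongrightarrow> prob (cyl x)"
  proof (rule tendstoI)
    fix e :: real assume e: "e > 0"
    have "\<forall>\<^sub>F n in sequentially. N x n \<le> real n * (prob (cyl x) + e / 2)"
      using e by (intro upper) simp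
    moreover have "\<forall>\<^sub>F n in sequentially. real n * (prob (cyl x) - e / 2) \<le> N x n"
      using e by (intro lower) simp
    ultimately show "\<forall>\<^sub>F n in sequentially. dist (N x n / real n) (prob (cyl x)) < e"
      using eventually_gt_at_top[of 0]
    proof eventually_elim
      case (elim n)
      then have "N x n / real n \<le> prob (cyl x) + e / 2" "prob (cyl x) - e / 2 \<le> N x n / real n"
        by (simp_all add: field_simps)
      with e show ?case unfolding dist_real_def by linarith
    qed
  qed
  then show ?thesis by (simp add: N_def \<eta>_def)
qed

text \<open>A simple function below f. The infima over shrinking cylinders reach f by lower
  semicontinuity; the cap m keeps the coefficients finite, so that limits may be multiplied by
  them.\<close>

definition lower_approx :: "(cantor \<Rightarrow> ennreal) \<Rightarrow> nat \<Rightarrow> bool list \<Rightarrow> ennreal" where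
  "lower_approx f m x = min (of_nat m) (INF \<xi>\<in>cyl x. f \<xi>)"

lemma lower_approx_le: "lower_approx f m (pref \<xi> m) \<le> f \<xi>"
  unfolding lower_approx_def by (intro min.coboundedI2 INF_lower) (simp add: mem_cyl_iff)

lemma lower_approx_incseq: "incseq (\<lambda>m \<xi>. lower_approx f m (pref \<xi> m))"
  unfolding incseq_def le_fun_def
proof (intro allI impI)
  fix m n :: nat and \<xi> :: cantor assume "m \<le> n"
  then have "cyl (pref \<xi> n) \<subseteq> cyl (pref \<xi> m)"
    by (auto simp: mem_cyl_iff) (metis take_pref)
  with \<open>m \<le> n\<close> show "lower_approx f m (pref \<xi> m) \<le> lower_approx f n (pref \<xi> n)"
    unfolding lower_approx_def by (intro min.mono INF_superset_mono of_nat_mono) auto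
qed

lemma SUP_lower_approx:
  assumes lsc: "\<And>\<xi> q. ennreal (real_of_rat q) < f \<xi> \<Longrightarrow> \<exists>m. \<forall>\<zeta>\<in>cyl (pref \<xi> m). ennreal (real_of_rat q) < f \<zeta>"
  shows "(SUP m. lower_approx f m (pref \<xi> m)) = f \<xi>"
proof (rule antisym)
  show "(SUP m. lower_approx f m (pref \<xi> m)) \<le> f \<xi>"
    by (rule SUP_least) (rule lower_approx_le)
  show "f \<xi> \<le> (SUP m. lower_approx f m (pref \<xi> m))"
  proof (rule ccontr)
    assume "\<not> ?thesis"
    then obtain q where q: "(SUP m. lower_approx f m (pref \<xi> m)) < real_of_rat q" "real_of_rat q < f \<xi>"
      using ennreal_rat_dense[of "SUP m. lower_approx f m (pref \<xi> m)" "f \<xi>"] by (auto simp: not_le)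
    obtain m where m: "\<And>\<zeta>. \<zeta> \<in> cyl (pref \<xi> m) \<Longrightarrow> ennreal (real_of_rat q) < f \<zeta>" using lsc[OF q(2)] by blast
    obtain l :: nat where l: "real_of_rat q \<le> real l" using real_arch_simple by blast
    \<comment> \<open>m bits force the infimum up to q, and l lifts the cap to q.\<close>
    let ?n = "max m l"
    have "cyl (pref \<xi> ?n) \<subseteq> cyl (pref \<xi> m)"
      by (auto simp: mem_cyl_iff) (metis max.cobounded1 take_pref)
    then have "ennreal (real_of_rat q) \<le> (INF \<zeta>\<in>cyl (pref \<xi> ?n). f \<zeta>)"
      using m by (intro INF_greatest less_imp_le) auto
    moreover have "ennreal (real_of_rat q) \<le> of_nat ?n"
      using l by (simp add: ennreal_of_nat_eq_real_of_nat ennreal_leI)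
    ultimately have "ennreal (real_of_rat q) \<le> lower_approx f ?n (pref \<xi> ?n)"
      unfolding lower_approx_def by simp
    also have "\<dots> \<le> (SUP m. lower_approx f m (pref \<xi> m))" by (rule SUP_upper) simp
    finally show False using q(1) by simp
  qed
qed

lemma random_average_lower:
  assumes lsc: "\<And>\<xi> q. ennreal (real_of_rat q) < f \<xi> \<Longrightarrow> \<exists>m. \<forall>\<zeta>\<in>cyl (pref \<xi> m). ennreal (real_of_rat q) < f \<zeta>"
    and random: "martin_lof_random \<mu> \<omega>" and c: "c < (\<integral>\<^sup>+\<xi>. f \<xi> \<partial>\<mu>)"
  shows "\<forall>\<^sub>F n in sequentially. c < (\<Sum>k<n. f (the (iterate T k \<omega>))) / of_nat n"
proof -
  define \<eta> where "\<eta> k = the (iterate T k \<omega>)" for k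
  have "(\<integral>\<^sup>+\<xi>. f \<xi> \<partial>\<mu>) = (\<integral>\<^sup>+\<xi>. (SUP m. lower_approx f m (pref \<xi> m)) \<partial>\<mu>)"
    by (simp add: SUP_lower_approx[OF lsc])
  also have "\<dots> = (SUP m. \<integral>\<^sup>+\<xi>. lower_approx f m (pref \<xi> m) \<partial>\<mu>)"
    by (rule nn_integral_monotone_convergence_SUP[OF lower_approx_incseq]) measurable
  finally obtain m where m: "c < (\<integral>\<^sup>+\<xi>. lower_approx f m (pref \<xi> m) \<partial>\<mu>)"
    using c by (auto simp: less_SUP_iff)
  let ?L = "{x :: bool list. length x = m}" and ?g = "lower_approx f m"
  have fin: "finite ?L" using finite_strings[of m "\<lambda>_. True"] by simp
  \<comment> \<open>Exactly one cylinder of length m contains \<xi>, so averages of this function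
    are finite combinations of cylinder frequencies.\<close>
  have g: "?g (pref \<xi> m) = (\<Sum>x\<in>?L. ?g x * indicator (cyl x) \<xi>)" for \<xi>
  proof -
    have "(\<Sum>x\<in>?L. ?g x * indicator (cyl x) \<xi>) = (\<Sum>x\<in>{pref \<xi> m}. ?g x * indicator (cyl x) \<xi>)"
      by (rule sum.mono_neutral_right) (auto simp: fin mem_cyl_iff indicator_def)
    then show ?thesis by (simp add: mem_cyl_iff)
  qed
  have "(\<integral>\<^sup>+\<xi>. ?g (pref \<xi> m) \<partial>\<mu>) = (\<Sum>x\<in>?L. ?g x * ennreal (prob (cyl x)))"
    unfolding g by (subst nn_integral_sum) (auto simp: nn_integral_cmult_indicator emeasure_eq_measure)
  moreover have "(\<lambda>n. \<Sum>x\<in>?L. ?g x * ennreal ((\<Sum>k<n. indicator (cyl x) (\<eta> k)) / real n))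
      \<longlonglongrightarrow> (\<Sum>x\<in>?L. ?g x * ennreal (prob (cyl x)))"
  proof (intro tendsto_sum ennreal_tendsto_cmult tendsto_ennrealI)
    show "?g x < top" for x
      unfolding lower_approx_def by (simp add: min_less_iff_disj of_nat_less_top)
    show "(\<lambda>n. (\<Sum>k<n. indicator (cyl x) (\<eta> k)) / real n) \<longlonglongrightarrow> prob (cyl x)" for x
      unfolding \<eta>_def by (rule random_cylinder_average[OF random])
  qed
  ultimately have "\<forall>\<^sub>F n in sequentially. c < (\<Sum>x\<in>?L. ?g x * ennreal ((\<Sum>k<n. indicator (cyl x) (\<eta> k)) / real n))"
    using m by (simp add: order_tendstoD(1))
  then show ?thesis
    using eventually_gt_at_top[of 0]
  proof eventually_elim
    case (elim n)
    have "ennreal ((\<Sum>k<n. indicator (cyl x) (\<eta> k)) / real n) = (\<Sum>k<n. indicator (cyl x) (\<eta> k)) / of_nat n" for x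
    proof -
      have "ennreal ((\<Sum>k<n. indicator (cyl x) (\<eta> k)) / real n)
          = ennreal (\<Sum>k<n. indicator (cyl x) (\<eta> k)) / ennreal (real n)"
        using elim(2) by (intro divide_ennreal[symmetric]) (auto intro: sum_nonneg)
      also have "ennreal (\<Sum>k<n. indicator (cyl x) (\<eta> k)) = (\<Sum>k<n. indicator (cyl x) (\<eta> k))"
        by (subst sum_ennreal[symmetric]) (auto simp: ennreal_indicator)
      finally show ?thesis by (simp add: ennreal_of_nat_eq_real_of_nat)
    qed
    then have "(\<Sum>x\<in>?L. ?g x * ennreal ((\<Sum>k<n. indicator (cyl x) (\<eta> k)) / real n))
        = (\<Sum>x\<in>?L. \<Sum>k<n. ?g x * indicator (cyl x) (\<eta> k)) / of_nat n"
      by (simp only: divide_ennreal_def sum_distrib_left sum_distrib_right mult.assoc)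
    also have "(\<Sum>x\<in>?L. \<Sum>k<n. ?g x * indicator (cyl x) (\<eta> k)) = (\<Sum>k<n. ?g (pref (\<eta> k) m))"
      unfolding g by (rule sum.swap)
    also have "\<dots> / of_nat n \<le> (\<Sum>k<n. f (\<eta> k)) / of_nat n"
      by (intro divide_right_mono_ennreal sum_mono lower_approx_le)
    finally show ?case using elim(1) unfolding \<eta>_def by (rule less_le_trans[rotated])
  qed
qed

end

section \<open>Lower semicomputable functions\<close>

text \<open>A string enumerated at index t is acknowledged only by its extensions of length greater
  than t. The delay turns an enumeration into a decidable, upward closed predicate with the same
  open set.\<close>

lemma lower_semicomputable_decidable:
  assumes "lower_semicomputable f"
  obtains D :: "nat \<Rightarrow> bool list \<Rightarrow> bool" where "cmp (\<lambda>z. D (fst z) (snd z))"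
    "\<And>c \<sigma> \<tau>. prefix \<sigma> \<tau> \<Longrightarrow> D c \<sigma> \<Longrightarrow> D c \<tau>"
    "\<And>c \<xi>. (\<exists>m. D c (pref \<xi> m)) \<longleftrightarrow> ereal (of_rat (rat_of_code c)) < enn2ereal (f \<xi>)"
proof -
  obtain X :: "rat \<Rightarrow> bool list set"
    where enum: "comp_enumerable {prod_encode (c, str_code x) |c x. x \<in> X (rat_of_code c)}"
      and X: "\<And>q. {\<xi>. ereal (of_rat q) < enn2ereal (f \<xi>)} = (\<Union>x\<in>X q. cyl x)"
    using assms unfolding lower_semicomputable_def uniformly_effectively_open_def by auto
  let ?E = "{prod_encode (c, str_code x) |c x. x \<in> X (rat_of_code c)}"
  have iff: "(\<exists>m. pref \<xi> m \<in> X (rat_of_code c)) \<longleftrightarrow> ereal (of_rat (rat_of_code c)) < enn2ereal (f \<xi>)" for c \<xi>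
  proof -
    have "(\<exists>m. pref \<xi> m \<in> X (rat_of_code c)) \<longleftrightarrow> \<xi> \<in> (\<Union>x\<in>X (rat_of_code c). cyl x)"
    proof
      assume "\<exists>m. pref \<xi> m \<in> X (rat_of_code c)"
      moreover have "\<xi> \<in> cyl (pref \<xi> m)" for m by (simp add: mem_cyl_iff)
      ultimately show "\<xi> \<in> (\<Union>x\<in>X (rat_of_code c). cyl x)" by blast
    next
      assume "\<xi> \<in> (\<Union>x\<in>X (rat_of_code c). cyl x)"
      then obtain x where "x \<in> X (rat_of_code c)" "x = pref \<xi> (length x)" by (auto simp: mem_cyl_iff)
      then show "\<exists>m. pref \<xi> m \<in> X (rat_of_code c)" by metis
    qed
    then show ?thesis unfolding X[symmetric] by simp
  qed
  have mem: "x \<in> X (rat_of_code c) \<longleftrightarrow> prod_encode (c, str_code x) \<in> ?E" for c x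
    by (auto simp: str_code_eq)
  show ?thesis
  proof (cases "?E = {}")
    case True
    with mem have "X (rat_of_code c) = {}" for c by blast
    with iff have "\<not> ereal (of_rat (rat_of_code c)) < enn2ereal (f \<xi>)" for c \<xi> by auto
    then show ?thesis by (intro that[of "\<lambda>_ _. False"]) (auto intro: cmp_const)
  next
    case False
    with enum obtain e where e: "computable1 e" "?E = range e" unfolding comp_enumerable_def by blast
    define D :: "nat \<Rightarrow> bool list \<Rightarrow> bool" where "D c \<tau> \<longleftrightarrow> (\<exists>t<length \<tau>. \<exists>j<Suc (length \<tau>). e t = prod_encode (c, code (take j \<tau>)))" for c \<tau>
    show ?thesis
    proof (rule that[of D])
      have ce: "cmp e" using e(1) by (simp add: cmp_nat_iff)
      show "cmp (\<lambda>z. D (fst z) (snd z))"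
        unfolding D_def by (intro cmp_intros cmp_comp[OF ce] cmp_code)
      show "D c \<tau>" if pre: "prefix \<sigma> \<tau>" and \<sigma>: "D c \<sigma>" for c \<sigma> \<tau>
      proof -
        obtain t j where tj: "t < length \<sigma>" "j \<le> length \<sigma>" "e t = prod_encode (c, code (take j \<sigma>))"
          using \<sigma> by (auto simp: D_def less_Suc_eq_le)
        moreover have "take j \<sigma> = take j \<tau>" using pre tj(2) by (auto simp: prefix_def)
        ultimately show ?thesis
          unfolding D_def using prefix_length_le[OF pre]
          by (intro exI[of _ t] conjI exI[of _ j]) auto
      qed
      show "(\<exists>m. D c (pref \<xi> m)) \<longleftrightarrow> ereal (of_rat (rat_of_code c)) < enn2ereal (f \<xi>)" for c \<xi>
        unfolding iff[symmetric]
      proof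
        assume "\<exists>m. D c (pref \<xi> m)"
        then obtain m t j where "j \<le> m" "e t = prod_encode (c, code (take j (pref \<xi> m)))"
          by (auto simp: D_def less_Suc_eq_le)
        then have "prod_encode (c, str_code (pref \<xi> j)) = e t" by (simp add: str_code_eq take_pref)
        then have "prod_encode (c, str_code (pref \<xi> j)) \<in> ?E" unfolding e(2) by simp
        then show "\<exists>m. pref \<xi> m \<in> X (rat_of_code c)" using mem by blast
      next
        assume "\<exists>m. pref \<xi> m \<in> X (rat_of_code c)"
        then obtain j where "prod_encode (c, str_code (pref \<xi> j)) \<in> range e" using mem e(2) by blast
        then obtain t where t: "e t = prod_encode (c, code (pref \<xi> j))" by (auto simp: str_code_eq)
        have "D c (pref \<xi> (max (Suc t) j))"
          unfolding D_def using t
          by (intro exI[of _ t] conjI exI[of _ j]) (auto simp: take_pref)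
        then show "\<exists>m. D c (pref \<xi> m)" ..
      qed
    qed
  qed
qed

lemma rat_of_code_fraction: "rat_of_code (prod_encode (2 * i, d)) = of_nat i / of_nat (Suc d)"
  by (simp add: rat_of_code_def int_decode_def sum_decode_def del: of_nat_Suc)

lemma less_enn2ereal_iff: "ereal r < enn2ereal x \<longleftrightarrow> ennreal r < x" if "0 \<le> r"
  using that by (simp add: less_ennreal.rep_eq enn2ereal_ennreal)

context effective_dynamics
begin

text \<open>F counts the thresholds i / (d + 1) already seen to lie below f, so
  \<open>string_sup F\<close> is (d + 1) f rounded up, and the bound for integer-valued suprema
  applies with an error of at most 1 / (d + 1).\<close>

lemma random_average_lsc_upper:
  assumes D: "cmp (\<lambda>z. D (fst z) (snd z))" "\<And>c \<sigma> \<tau>. prefix \<sigma> \<tau> \<Longrightarrow> D c \<sigma> \<Longrightarrow> D c \<tau>"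
    and f: "\<And>c \<xi>. (\<exists>m. D c (pref \<xi> m)) \<longleftrightarrow> ereal (of_rat (rat_of_code c)) < enn2ereal (f \<xi>)"
    and meas: "f \<in> borel_measurable \<mu>"
    and random: "martin_lof_random \<mu> \<omega>" and c: "(\<integral>\<^sup>+\<xi>. f \<xi> \<partial>\<mu>) < c"
  shows "\<forall>\<^sub>F n in sequentially. (\<Sum>k<n. f (the (iterate T k \<omega>))) / of_nat n < c"
proof -
  \<comment> \<open>Two rationals are inserted; the gap between them pays for the rounding
    error.\<close>
  obtain p where p: "(\<integral>\<^sup>+\<xi>. f \<xi> \<partial>\<mu>) < ennreal (real_of_rat p)" "ennreal (real_of_rat p) < c"
    using ennreal_rat_dense[OF c] by blast
  obtain q where q: "ennreal (real_of_rat p) < ennreal (real_of_rat q)" "ennreal (real_of_rat q) < c"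
    using ennreal_rat_dense[OF p(2)] by blast
  define r s where "r = real_of_rat p" and "s = real_of_rat q"
  have rs: "(\<integral>\<^sup>+\<xi>. f \<xi> \<partial>\<mu>) < ennreal r" "ennreal r < ennreal s" "ennreal s < c"
    using p q by (simp_all add: r_def s_def)
  have "0 \<le> r" using rs(1) by (metis ennreal_neg linear not_less_zero)
  have "r < s" using rs(2) by (metis ennreal_leI leD not_le_imp_less)
  obtain d where d: "1 / real (Suc d) < s - r" using \<open>r < s\<close> nat_approx_posE[of "s - r"] by auto
  let ?d = "Suc d"
  define F where "F \<tau> = (\<Sum>i<length \<tau>. of_bool (D (prod_encode (2 * i, d)) \<tau>) :: nat)" for \<tau>
  have hit: "(\<exists>m. D (prod_encode (2 * i, d)) (pref \<xi> m)) \<longleftrightarrow> ennreal (real i / real ?d) < f \<xi>" for i \<xi>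
    unfolding f rat_of_code_fraction
    by (subst less_enn2ereal_iff[symmetric]) (simp_all add: of_rat_divide del: of_nat_Suc)
  have incr: "string_incr F"
    unfolding string_incr_def
  proof (intro allI impI)
    fix \<sigma> \<tau> :: "bool list" assume pre: "prefix \<sigma> \<tau>"
    have "F \<sigma> \<le> (\<Sum>i<length \<sigma>. of_bool (D (prod_encode (2 * i, d)) \<tau>))"
      unfolding F_def using D(2)[OF pre] by (intro sum_mono) auto
    also have "\<dots> \<le> F \<tau>" unfolding F_def using prefix_length_le[OF pre] by (intro sum_mono2) auto
    finally show "F \<sigma> \<le> F \<tau>" .
  qed
  have cF: "cmp F" unfolding F_def by (intro cmp_intros cmp_comp2[of D, OF D(1)])
  have below: "f \<xi> \<le> string_sup F \<xi> / of_nat ?d" for \<xi>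
  proof (rule ccontr)
    assume "\<not> ?thesis"
    then have less: "string_sup F \<xi> / of_nat ?d < f \<xi>" by simp
    \<comment> \<open>If f exceeded the quotient, a count that reaches N would see all thresholds
      with i \<le> N and so reach N + 1; the supremum and the quotient would be infinite.\<close>
    have "of_nat N \<le> string_sup F \<xi>" for N
    proof (induction N)
      case (Suc N)
      have lt: "ennreal (real i / real ?d) < f \<xi>" if "i \<le> N" for i
      proof -
        have "ennreal (real i / real ?d) = of_nat i / of_nat ?d"
          by (subst divide_ennreal[symmetric]) (simp_all add: ennreal_of_nat_eq_real_of_nat del: of_nat_Suc)
        also have "\<dots> \<le> string_sup F \<xi> / of_nat ?d"
          using Suc that by (intro divide_right_mono_ennreal) (meson of_nat_mono order_trans)
        also note less
        finally show ?thesis .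
      qed
      have "\<forall>\<^sub>F m in sequentially. D (prod_encode (2 * i, d)) (pref \<xi> m)" if i: "i \<le> N" for i
      proof -
        obtain m0 where "D (prod_encode (2 * i, d)) (pref \<xi> m0)" using hit lt[OF i] by blast
        then show ?thesis using D(2) pref_mono by (intro eventually_sequentiallyI[of m0]) blast
      qed
      then have "\<forall>\<^sub>F m in sequentially. \<forall>i\<in>{..N}. D (prod_encode (2 * i, d)) (pref \<xi> m)"
        by (intro eventually_ball_finite) auto
      with eventually_gt_at_top[of N]
      have "\<forall>\<^sub>F m in sequentially. N < m \<and> (\<forall>i\<in>{..N}. D (prod_encode (2 * i, d)) (pref \<xi> m))"
        by eventually_elim blast
      then obtain m where m: "N < m" "\<And>i. i \<le> N \<Longrightarrow> D (prod_encode (2 * i, d)) (pref \<xi> m)"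
        by (auto simp: eventually_sequentially)
      have "Suc N = (\<Sum>i<Suc N. of_bool (D (prod_encode (2 * i, d)) (pref \<xi> m)))"
        using m(2) by simp
      also have "\<dots> \<le> F (pref \<xi> m)" unfolding F_def using m(1) by (intro sum_mono2) auto
      finally have "of_nat (Suc N) \<le> (of_nat (F (pref \<xi> m)) :: ennreal)" by (rule of_nat_mono)
      then show ?case unfolding string_sup_def by (intro SUP_upper2[of m]) auto
    qed simp
    then have "string_sup F \<xi> = top" by (metis ennreal_Ex_less_of_nat leD not_top_less top.not_eq_extremum)
    with less show False by (simp add: ennreal_top_divide)
  qed
  have above: "string_sup F \<xi> \<le> of_nat ?d * f \<xi> + 1" for \<xi>
    unfolding string_sup_def
  proof (rule SUP_least)
    fix m
    let ?J = "{i \<in> {..<m}. D (prod_encode (2 * i, d)) (pref \<xi> m)}"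
    have FJ: "F (pref \<xi> m) = card ?J" by (simp add: F_def sum.If_cases of_bool_def Int_def)
    show "of_nat (F (pref \<xi> m)) \<le> of_nat ?d * f \<xi> + 1"
    proof (cases "?J = {}")
      case False
      \<comment> \<open>Thresholds start at i = 0, so the count exceeds the largest one seen by at
        most 1; this is the summand 1 of the claim.\<close>
      have "?J \<subseteq> {..Max ?J}" by auto
      then have "card ?J \<le> card {..Max ?J}" by (intro card_mono) auto
      then have le: "F (pref \<xi> m) \<le> Max ?J + 1" unfolding FJ by simp
      have "Max ?J \<in> ?J" using False by (intro Max_in) auto
      then have "ennreal (real (Max ?J) / real ?d) < f \<xi>" using hit by blast
      then have "of_nat ?d * ennreal (real (Max ?J) / real ?d) \<le> of_nat ?d * f \<xi>"
        by (intro mult_left_mono) (auto intro: less_imp_le)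
      also have "of_nat ?d * ennreal (real (Max ?J) / real ?d) = of_nat (Max ?J)"
        by (simp add: ennreal_of_nat_eq_real_of_nat ennreal_mult'[symmetric] del: of_nat_Suc)
      finally have "of_nat (Max ?J + 1) \<le> of_nat ?d * f \<xi> + 1" by (simp add: add_right_mono)
      moreover have "of_nat (F (pref \<xi> m)) \<le> (of_nat (Max ?J + 1) :: ennreal)" using le by (rule of_nat_mono)
      ultimately show ?thesis by (rule order_trans[rotated])
    next
      case True
      then have "F (pref \<xi> m) = 0" unfolding FJ by (simp only: card.empty)
      then show ?thesis by simp
    qed
  qed
  have "(\<integral>\<^sup>+\<xi>. string_sup F \<xi> \<partial>\<mu>) \<le> (\<integral>\<^sup>+\<xi>. of_nat ?d * f \<xi> + 1 \<partial>\<mu>)"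
    by (rule nn_integral_mono) (rule above)
  also have "\<dots> = of_nat ?d * (\<integral>\<^sup>+\<xi>. f \<xi> \<partial>\<mu>) + 1"
    using meas emeasure_space_1 by (simp add: nn_integral_add nn_integral_cmult del: of_nat_Suc)
  also have "\<dots> \<le> of_nat ?d * ennreal r + 1"
    using rs(1) by (intro add_right_mono mult_left_mono) auto
  also have "\<dots> = ennreal (real ?d * r + 1)"
    using \<open>0 \<le> r\<close> by (simp add: ennreal_of_nat_eq_real_of_nat ennreal_mult'[symmetric] ennreal_plus del: of_nat_Suc)
  also have "\<dots> < ennreal (real ?d * s)"
  proof (rule ennreal_lessI)
    have "1 < real ?d * (s - r)" using d by (simp add: field_simps del: of_nat_Suc)
    then show "real ?d * r + 1 < real ?d * s" by (simp add: algebra_simps del: of_nat_Suc)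
    with \<open>0 \<le> r\<close> show "0 < real ?d * s" by (meson le_less_trans mult_nonneg_nonneg of_nat_0_le_iff add_nonneg_nonneg zero_le_one)
  qed
  finally have "\<forall>\<^sub>F n in sequentially. (\<Sum>k<n. string_sup F (the (iterate T k \<omega>))) \<le> ennreal (real n * (real ?d * s))"
    by (rule random_average_upper[OF incr cF _ random])
  then show ?thesis
    using eventually_gt_at_top[of 0]
  proof eventually_elim
    case (elim n)
    have "(\<Sum>k<n. f (the (iterate T k \<omega>))) / of_nat n \<le> (\<Sum>k<n. string_sup F (the (iterate T k \<omega>)) / of_nat ?d) / of_nat n"
      by (intro divide_right_mono_ennreal sum_mono below)
    also have "\<dots> = (\<Sum>k<n. string_sup F (the (iterate T k \<omega>))) / of_nat ?d / of_nat n"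
      by (simp add: divide_ennreal_def sum_distrib_right)
    also have "\<dots> \<le> ennreal (real n * (real ?d * s)) / of_nat ?d / of_nat n"
      by (intro divide_right_mono_ennreal elim)
    also have "\<dots> = ennreal s"
      using elim(2) \<open>0 \<le> r\<close> \<open>r < s\<close>
      by (simp add: ennreal_of_nat_eq_real_of_nat divide_ennreal del: of_nat_Suc)
    also note rs(3)
    finally show ?case .
  qed
qed

end

theorem theorem9:
  fixes \<mu> :: "cantor measure" and T :: "cantor \<rightharpoonup> cantor"
    and f :: "cantor \<Rightarrow> ennreal" and \<omega> :: cantor
  assumes "prob_space \<mu>" and "sets \<mu> = sets borel" and "computable_measure \<mu>"
    and "computable_transformation T" and "ae_defined \<mu> T"
    and "measure_preserving_map \<mu> T" and "ergodic_map \<mu> T"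
    and "lower_semicomputable f"
    and "martin_lof_random \<mu> \<omega>"
  shows "(\<forall>k. \<omega> \<in> dom (iterate T k)) \<and>
    (\<lambda>n. (\<Sum>k<n. f (the (iterate T k \<omega>))) / of_nat n) \<longlonglongrightarrow> (\<integral>\<^sup>+ x. f x \<partial>\<mu>)"
proof -
  obtain P where P: "T = machine_map P" using assms(4) unfolding computable_transformation_def by blast
  interpret prob_space \<mu> by (rule assms(1))
  interpret effective_dynamics \<mu> T "machine_string P"
    by unfold_locales
      (use assms P in \<open>auto intro: cmp_machine_string string_mono_machine_string simp: machine_map_iff\<close>)
  obtain D where D: "cmp (\<lambda>z. D (fst z) (snd z))" "\<And>c \<sigma> \<tau>. prefix \<sigma> \<tau> \<Longrightarrow> D c \<sigma> \<Longrightarrow> D c \<tau>"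
    and f: "\<And>c \<xi>. (\<exists>m. D c (pref \<xi> m)) \<longleftrightarrow> ereal (of_rat (rat_of_code c)) < enn2ereal (f \<xi>)"
    using lower_semicomputable_decidable[OF assms(8)] by blast
  have lsc: "\<exists>m. \<forall>\<zeta>\<in>cyl (pref \<xi> m). ennreal (real_of_rat q) < f \<zeta>"
    if q: "ennreal (real_of_rat q) < f \<xi>" for \<xi> q
  proof -
    \<comment> \<open>\<open>ennreal\<close> sends negative numbers to 0 whereas
      \<open>ereal\<close> does not, so a negative q is replaced by 0 before the two comparisons are
      identified.\<close>
    obtain c where c: "rat_of_code c = max 0 q" using surj_rat_of_code by (metis surjD)
    have eq: "ennreal (real_of_rat q) = ennreal (real_of_rat (rat_of_code c))"
      by (auto simp: c max_def ennreal_neg)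
    have iff: "(\<exists>m. D c (pref \<zeta> m)) \<longleftrightarrow> ennreal (real_of_rat q) < f \<zeta>" for \<zeta>
      unfolding f eq by (rule less_enn2ereal_iff) (simp add: c)
    obtain m where m: "D c (pref \<xi> m)" using iff q by blast
    have "ennreal (real_of_rat q) < f \<zeta>" if "\<zeta> \<in> cyl (pref \<xi> m)" for \<zeta>
      using that m iff by (metis length_pref mem_cyl_iff)
    then show ?thesis by blast
  qed
  have meas: "f \<in> borel_measurable \<mu>"
  proof -
    have "(\<lambda>\<xi>. SUP m. lower_approx f m (pref \<xi> m)) \<in> borel_measurable \<mu>" by measurable
    then show ?thesis by (simp add: SUP_lower_approx[OF lsc])
  qed
  have "\<omega> \<in> dom (iterate T k)" for k using random_iterate[OF assms(9)] by blast
  moreover have "(\<lambda>n. (\<Sum>k<n. f (the (iterate T k \<omega>))) / of_nat n) \<longlonglongrightarrow> (\<integral>\<^sup>+ x. f x \<partial>\<mu>)"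
    by (rule order_tendstoI)
      (use random_average_lower[OF lsc assms(9)] random_average_lsc_upper[OF D f meas assms(9)] in auto)
  ultimately show ?thesis by blast
qed

end
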